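(* Let $m\ge2$, let $\alpha_1,\dots,\alpha_m\ge2$ be integers, let $C=\mathrm{diag}(\alpha_1,\dots,\alpha_m)$, and let $\lambda_1,\dots,\lambda_m\in\mathbb C\setminus\{0\}$. Let $A(x,y)$ be the quiver A-polynomial of $C$ and $N(A)$ its Newton polygon. Consider the index set $\mathcal I=\{(p,q):p,q\ge0,\ p+q=m\}\cup\{(0,0)\}$ and the polynomials $\phi_{p,q}$, $(p,q)\in\mathcal I$, defined in the context. Then the edges of $N(A)$ are in one-to-one correspondence with the $\phi_{p,q}$, i.e. the assignment $(p,q)\mapsto\pi(N(\phi_{p,q}))$ is a bijection from $\mathcal I$ onto the set of edges of $N(A)$, if and only if $\alpha_1=\alpha_2=\dots=\alpha_m$. Moreover, in that case the set of vertices of $N(A)$ is $\{\pi(\phi_{p,q}^{\min}),\ \pi(\phi_{p,q}^{\max}):(p,q)\in\mathcal I\}$.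
   Context: Quiver resultant. Consider $$F_0=a_0+a_1z_1\cdots z_m,\qquad F_i=b_{i,0}+b_{i,1}z_i+b_{i,2}z_i^{\alpha_i}\quad(i=1,\dots,m),$$ with indeterminate coefficients. The (refined) quiver resultant $\mathcal R$ is the sparse mixed resultant of $F_0,\dots,F_m$: the irreducible integer polynomial in the variables $a_0,a_1,b_{i,j}$, unique up to sign, vanishing on the closure of the set of coefficient vectors (all coefficients nonzero) for which $F_0,\dots,F_m$ have a common zero in $(\mathbb C\setminus\{0\})^m$ (a hypersurface here). Quiver A-polynomial. $A(x_1,\dots,x_m,y)$ is obtained from $\mathcal R$ by setting $a_0=y$, $a_1=-1$, $b_{i,0}=-1$, $b_{i,1}=1$, $b_{i,2}=(-1)^{\alpha_i}x_i$; and $A(x,y):=A(\lambda_1x,\dots,\lambda_mx,y)$. For a polynomial $P$, $N(P)$ is its Newton polytope. The forms $\phi_{p,q}$ with $p+q=m$. For disjoint $I,K$ with $I\sqcup K=\{1,\dots,m\}$ put $N_K=\prod_{k\in K}(\alpha_k-1)$, $N_{K,k}=\prod_{k'\in K,\,k'\ne k}(\alpha_{k'}-1)$ (empty products are $1$), $g=g_K=\gcd(N_K,\{N_{K,k}\}_{k\in K})$, $\varepsilon=(-1)^{1+(1+|I|)N_K/g+\sum_{k\in K}N_{K,k}/g}$, and $$\Phi_{I,K}=\Big(\big(a_0\prod_{i\in I}b_{i,1}\big)^{N_K/g}\prod_{k\in K}b_{k,2}^{N_{K,k}/g}+\varepsilon\,\big(a_1\prod_{i\in I}b_{i,0}\big)^{N_K/g}\prod_{k\in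 K}b_{k,1}^{N_{K,k}/g}\Big)^{g}.$$ With $K'$ ranging over subsets of $\{1,\dots,m\}$, let $$\mu_{p,q}=a_0^{\sum_{|K'|\le q-1}N_{K'}}\;a_1^{\sum_{|K'|\ge q+1}N_{K'}}\;\prod_{i=1}^m b_{i,0}^{\sum_{|K'|\ge q+1,\ i\notin K'}N_{K'}}\;b_{i,2}^{\sum_{|K'|\le q-2,\ i\notin K'}N_{K'}}$$ (empty sums are $0$, $N_\emptyset=1$), and $$\phi_{p,q}=\mu_{p,q}\prod_{|I|=p,\,|K|=q}\Phi_{I,K},$$ the product being over all $\frac{m!}{p!\,q!}$ decompositions $I\sqcup K=\{1,\dots,m\}$. The form $\phi_{0,0}$. Put $P=\prod_j\alpha_j$, $P_j=\prod_{j'\ne j}\alpha_{j'}$, $g_0=\gcd(P,P_1,\dots,P_m)$, $\varepsilon_0=(-1)^{1+P/g_0+\sum_jP_j/g_0}$, and $$\phi_{0,0}=\Big(a_0^{P/g_0}\prod_jb_{j,2}^{P_j/g_0}+\varepsilon_0\,a_1^{P/g_0}\prod_jb_{j,0}^{P_j/g_0}\Big)^{g_0}.$$ Extremal monomials and projection. $\phi_{p,q}^{\min}$ and $\phi_{p,q}^{\max}$ denote the (unique) terms of $\phi_{p,q}$ of minimal and maximal degree in $a_0$. The projection $\pi$ sends the exponent vector of a monomial in the variables $a_0,a_1,b_{i,j}$ to $(\sum_{i=1}^m\deg_{b_{i,2}},\ \deg_{a_0})\in\mathbb R^2$ and is extended linearly; this is the effect on exponents of the specialization to $(x,y)$. 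*)

theory Defs
  imports
    "HOL-Analysis.Analysis"
    "HOL-Computational_Algebra.Factorial_Ring"
    "HOL-Library.Poly_Mapping"
begin

text \<open>
  Throughout, the index set \<open>{1,\<dots>,m}\<close> is a finite type \<open>'n\<close> with \<open>m = CARD('n)\<close>, and
  \<open>\<alpha> :: 'n \<Rightarrow> nat\<close> is the diagonal of the matrix \<open>C\<close>.
\<close>

section \<open>Multivariate polynomials\<close>

text \<open>Polynomials in variables \<open>'v\<close>: finitely supported coefficient functions on exponent vectors.\<close>

type_synonym ('v, 'c) mpoly = "('v \<Rightarrow>\<^sub>0 nat) \<Rightarrow>\<^sub>0 'c"

definition Var :: "'v \<Rightarrow> ('v, 'c::comm_ring_1) mpoly" where
  "Var v = Poly_Mapping.single (Poly_Mapping.single v 1) 1"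

definition Const :: "'c \<Rightarrow> ('v, 'c::comm_ring_1) mpoly" where
  "Const c = Poly_Mapping.single 0 c"

text \<open>
  The value of an integer polynomial under \<open>v \<mapsto> f v\<close>: evaluation at a point for \<open>'r = complex\<close>,
  substitution of polynomials if \<open>'r\<close> is a polynomial ring.
\<close>

definition subst :: "('v \<Rightarrow> 'r) \<Rightarrow> ('v, int) mpoly \<Rightarrow> 'r::comm_ring_1" where
  "subst f p = (\<Sum>e\<in>Poly_Mapping.keys p.
     of_int (Poly_Mapping.lookup p e) *
     (\<Prod>v\<in>Poly_Mapping.keys e. f v ^ Poly_Mapping.lookup e v))"

definition expvec :: "('v::finite \<Rightarrow>\<^sub>0 nat) \<Rightarrow> real ^ 'v" where
  "expvec e = (\<chi> v. real (Poly_Mapping.lookup e v))"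

definition newton_polytope :: "('v::finite, 'c::zero) mpoly \<Rightarrow> (real ^ 'v) set" where
  "newton_polytope p = convex hull (expvec ` Poly_Mapping.keys p)"

section \<open>The quiver resultant\<close>

text \<open>The coefficient variables \<open>a\<^sub>0\<close>, \<open>a\<^sub>1\<close>, \<open>b\<^bsub>i,0\<^esub>\<close>, \<open>b\<^bsub>i,1\<^esub>\<close>, \<open>b\<^bsub>i,2\<^esub>\<close>.\<close>

datatype 'n qvar = A0 | A1 | B0 'n | B1 'n | B2 'n

instance qvar :: (finite) finite
proof
  have "(UNIV :: 'a qvar set) \<subseteq> {A0, A1} \<union> range B0 \<union> range B1 \<union> range B2"
  proof
    fix v :: "'a qvar"
    show "v \<in> {A0, A1} \<union> range B0 \<union> range B1 \<union> range B2"
      by (cases v) auto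
  qed
  then show "finite (UNIV :: 'a qvar set)"
    by (rule finite_subset) auto
qed

definition F0 :: "('n::finite qvar \<Rightarrow> complex) \<Rightarrow> ('n \<Rightarrow> complex) \<Rightarrow> complex" where
  "F0 c z = c A0 + c A1 * (\<Prod>i\<in>UNIV. z i)"

definition Fi :: "('n \<Rightarrow> nat) \<Rightarrow> 'n \<Rightarrow> ('n qvar \<Rightarrow> complex) \<Rightarrow> ('n \<Rightarrow> complex) \<Rightarrow> complex" where
  "Fi \<alpha> i c z = c (B0 i) + c (B1 i) * z i + c (B2 i) * z i ^ \<alpha> i"

definition solvable_coeffs :: "('n::finite \<Rightarrow> nat) \<Rightarrow> ('n qvar \<Rightarrow> complex) set" where
  "solvable_coeffs \<alpha> = {c. (\<forall>v. c v \<noteq> 0) \<and>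
     (\<exists>z. (\<forall>i. z i \<noteq> 0) \<and> F0 c z = 0 \<and> (\<forall>i. Fi \<alpha> i c z = 0))}"

text \<open>
  The closure is the Euclidean one (product topology on a finite product of copies of
  \<open>complex\<close>); for this constructible set it coincides with the Zariski closure.
  The closure being an irreducible hypersurface, these conditions determine the resultant up to
  sign. The Hilbert choice below fixes a sign.
\<close>

definition is_quiver_resultant :: "('n::finite \<Rightarrow> nat) \<Rightarrow> ('n qvar, int) mpoly \<Rightarrow> bool" where
  "is_quiver_resultant \<alpha> R \<longleftrightarrow>
     irreducible R \<and> (\<forall>c\<in>closure (solvable_coeffs \<alpha>). subst c R = 0)"

definition quiver_resultant :: "('n::finite \<Rightarrow> nat) \<Rightarrow> ('n qvar, int) mpoly" where
  "quiver_resultant \<alpha> = (SOME R. is_quiver_resultant \<alpha> R)"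

section \<open>The quiver A-polynomial\<close>

datatype 'n avar = X 'n | Y

fun specialize :: "('n \<Rightarrow> nat) \<Rightarrow> 'n qvar \<Rightarrow> ('n avar, int) mpoly" where
  "specialize \<alpha> A0 = Var Y"
| "specialize \<alpha> A1 = - 1"
| "specialize \<alpha> (B0 i) = - 1"
| "specialize \<alpha> (B1 i) = 1"
| "specialize \<alpha> (B2 i) = (- 1) ^ \<alpha> i * Var (X i)"

definition quiver_A_multi :: "('n::finite \<Rightarrow> nat) \<Rightarrow> ('n avar, int) mpoly" where
  "quiver_A_multi \<alpha> = subst (specialize \<alpha>) (quiver_resultant \<alpha>)"

text \<open>
  Polynomials in two variables \<open>x\<close>, \<open>y\<close> have variable type \<open>2\<close>, with \<open>x\<close> the variable
  \<open>1\<close> and \<open>y\<close> the variable \<open>2\<close>; their Newton polygons thus live in \<open>real ^ 2\<close>.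
\<close>

fun diagonal_vars :: "('n \<Rightarrow> complex) \<Rightarrow> 'n avar \<Rightarrow> (2, complex) mpoly" where
  "diagonal_vars lam (X i) = Const (lam i) * Var 1"
| "diagonal_vars lam Y = Var 2"

definition quiver_A :: "('n::finite \<Rightarrow> nat) \<Rightarrow> ('n \<Rightarrow> complex) \<Rightarrow> (2, complex) mpoly" where
  "quiver_A \<alpha> lam = subst (diagonal_vars lam) (quiver_A_multi \<alpha>)"

section \<open>The forms phi\<close>

text \<open>\<open>N\<^sub>K\<close>; note that \<open>N\<^bsub>K,k\<^esub> = NK \<alpha> (K - {k})\<close>. The subtraction is on \<open>nat\<close> and is used for \<open>\<alpha> k \<ge> 2\<close>.\<close>

definition NK :: "('n \<Rightarrow> nat) \<Rightarrow> 'n set \<Rightarrow> nat" where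
  "NK \<alpha> K = (\<Prod>k\<in>K. \<alpha> k - 1)"

definition gK :: "('n \<Rightarrow> nat) \<Rightarrow> 'n set \<Rightarrow> nat" where
  "gK \<alpha> K = Gcd (insert (NK \<alpha> K) ((\<lambda>k. NK \<alpha> (K - {k})) ` K))"

definition Phi :: "('n::finite \<Rightarrow> nat) \<Rightarrow> 'n set \<Rightarrow> 'n set \<Rightarrow> ('n qvar, int) mpoly" where
  "Phi \<alpha> I K =
     (let g = gK \<alpha> K;
          n = NK \<alpha> K div g;
          nk = (\<lambda>k. NK \<alpha> (K - {k}) div g);
          \<epsilon> = (- 1) ^ (1 + (1 + card I) * n + (\<Sum>k\<in>K. nk k))
      in ((Var A0 * (\<Prod>i\<in>I. Var (B1 i))) ^ n * (\<Prod>k\<in>K. Var (B2 k) ^ nk k)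
          + \<epsilon> * (Var A1 * (\<Prod>i\<in>I. Var (B0 i))) ^ n * (\<Prod>k\<in>K. Var (B1 k) ^ nk k)) ^ g)"

text \<open>
  The conditions \<open>|K'| \<le> q - 1\<close> and \<open>|K'| \<le> q - 2\<close> are over the integers (so void for small \<open>q\<close>),
  hence their formulation without subtraction.
\<close>

definition mu :: "('n::finite \<Rightarrow> nat) \<Rightarrow> nat \<Rightarrow> ('n qvar, int) mpoly" where
  "mu \<alpha> q =
     Var A0 ^ (\<Sum>K' | card K' + 1 \<le> q. NK \<alpha> K') *
     Var A1 ^ (\<Sum>K' | card K' \<ge> q + 1. NK \<alpha> K') *
     (\<Prod>i\<in>UNIV.
        Var (B0 i) ^ (\<Sum>K' | card K' \<ge> q + 1 \<and> i \<notin> K'. NK \<alpha> K') *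
        Var (B2 i) ^ (\<Sum>K' | card K' + 2 \<le> q \<and> i \<notin> K'. NK \<alpha> K'))"

definition phi_pq :: "('n::finite \<Rightarrow> nat) \<Rightarrow> nat \<Rightarrow> nat \<Rightarrow> ('n qvar, int) mpoly" where
  "phi_pq \<alpha> p q = mu \<alpha> q *
     (\<Prod>(I, K)\<in>{(I, K). I \<inter> K = {} \<and> I \<union> K = UNIV \<and> card I = p \<and> card K = q}. Phi \<alpha> I K)"

definition phi_00 :: "('n::finite \<Rightarrow> nat) \<Rightarrow> ('n qvar, int) mpoly" where
  "phi_00 \<alpha> =
     (let P = (\<Prod>j\<in>UNIV. \<alpha> j);
          Pj = (\<lambda>j. \<Prod>j'\<in>UNIV - {j}. \<alpha> j');
          g = Gcd (insert P (range Pj));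
          \<epsilon> = (- 1) ^ (1 + P div g + (\<Sum>j\<in>UNIV. Pj j div g))
      in (Var A0 ^ (P div g) * (\<Prod>j\<in>UNIV. Var (B2 j) ^ (Pj j div g))
          + \<epsilon> * Var A1 ^ (P div g) * (\<Prod>j\<in>UNIV. Var (B0 j) ^ (Pj j div g))) ^ g)"

text \<open>No clash: \<open>p + q = m\<close> excludes \<open>(0,0)\<close>, since \<open>m = CARD('n) > 0\<close>.\<close>

definition phi :: "('n::finite \<Rightarrow> nat) \<Rightarrow> nat \<times> nat \<Rightarrow> ('n qvar, int) mpoly" where
  "phi \<alpha> pq = (if pq = (0, 0) then phi_00 \<alpha> else phi_pq \<alpha> (fst pq) (snd pq))"

section \<open>Extremal monomials and projection\<close>

text \<open>Exponent vectors of the (unique) terms of minimal and maximal degree in \<open>a\<^sub>0\<close>.\<close>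

definition min_term :: "('n qvar, int) mpoly \<Rightarrow> 'n qvar \<Rightarrow>\<^sub>0 nat" where
  "min_term p = (THE e. is_arg_min (\<lambda>e. Poly_Mapping.lookup e A0) (\<lambda>e. e \<in> Poly_Mapping.keys p) e)"

definition max_term :: "('n qvar, int) mpoly \<Rightarrow> 'n qvar \<Rightarrow>\<^sub>0 nat" where
  "max_term p = (THE e. is_arg_max (\<lambda>e. Poly_Mapping.lookup e A0) (\<lambda>e. e \<in> Poly_Mapping.keys p) e)"

definition proj :: "real ^ 'n::finite qvar \<Rightarrow> real ^ 2" where
  "proj u = vector [\<Sum>i\<in>UNIV. u $ B2 i, u $ A0]"

end

theory Submission
  imports Defs "Subresultants.Subresultant" "HOL-Computational_Algebra.Fundamental_Theorem_Algebra"
begin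

text \<open>
  Up to sign the resultant is the norm \<open>D = (\<Prod>i. b\<^bsub>i,2\<^esub> ^ P\<^sub>i) * (\<Prod>\<zeta>. a\<^sub>0 + a\<^sub>1 \<zeta>\<^sub>1 \<cdots> \<zeta>\<^sub>m)\<close>, with \<open>\<zeta>\<^sub>i\<close>
  running over the roots of \<open>F\<^sub>i\<close>: for generic coefficients the products of roots are distinct, so \<open>D\<close>
  divides, as a polynomial in \<open>a\<^sub>0\<close>, every polynomial that vanishes on the solvable coefficients, and as these
  have a polynomial parametrization, \<open>D\<close> is irreducible.

  The Newton polygon of the A-polynomial can therefore be read off from the growth of the roots \<open>y\<close>. As
  \<open>x \<rightarrow> 0\<close>, one root of the specialized \<open>F\<^sub>i\<close> tends to \<open>1\<close> and the other \<open>\<alpha>\<^sub>i - 1\<close> grow like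
  \<open>x powr (- 1 / (\<alpha>\<^sub>i - 1))\<close>, so there are \<open>N\<^sub>K\<close> products of size \<open>x powr (- s\<^sub>K)\<close> for each \<open>K\<close>, where
  \<open>s\<^sub>K = (\<Sum>k\<in>K. 1 / (\<alpha>\<^sub>k - 1))\<close>. As \<open>x \<rightarrow> \<infinity>\<close>, all of them have size \<open>x powr (- (\<Sum>i. 1 / \<alpha>\<^sub>i))\<close>. Hence
  the polygon has one edge for each distinct value of \<open>s\<^sub>K\<close>, with direction \<open>(s\<^sub>K, 1)\<close>, and one further
  edge. There are at least \<open>m + 1\<close> such values, with equality iff all \<open>\<alpha>\<^sub>i\<close> agree; in that
  case \<open>s\<^sub>K\<close> only depends on the size of \<open>K\<close>, and the edge of slope \<open>q / (\<alpha> - 1)\<close> is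
  the projection of \<open>\<phi>\<^bsub>m-q,q\<^esub>\<close>.
\<close>

section \<open>Evaluation of polynomials\<close>

text \<open>Growth estimates take the place of Puiseux expansions: only absolute values of the
  A-polynomial at complex points are used. Along a curve \<open>x = r u\<close>,
  \<open>y = r powr (- s) w\<close> its order in \<open>r\<close> is the support function of the
  polygon in direction \<open>(1, -s)\<close>. Upper bounds hold for every \<open>s\<close>, lower
  bounds only if \<open>s\<close> is not a slope, since otherwise \<open>y\<close> may collide with
  a root of the same order. That is enough: the support function is piecewise linear in
  \<open>s\<close>, and each vertex of the lower chain is the only contact point for an open
  interval of values \<open>s\<close>. For \<open>x\<close> near infinity an upper bound suffices,
  as it gives a line through two points already known to be exponents, the origin and the sum of all
  edge vectors. Divisibility over the integers comes from pseudo-division in \<open>a_0\<close>. Its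
  spurious factor is a monomial in the \<open>b_{i,2}\<close>, which cancels because the term of the
  norm polynomial free of \<open>a_0\<close> is also free of the \<open>b_{i,2}\<close>.\<close>

definition insertion ::
    "('c \<Rightarrow> 'r) \<Rightarrow> ('v \<Rightarrow> 'r) \<Rightarrow> ('v::finite, 'c::comm_ring_1) mpoly \<Rightarrow> 'r::comm_ring_1" where
  "insertion h f p = (\<Sum>e\<in>Poly_Mapping.keys p.
     h (Poly_Mapping.lookup p e) * (\<Prod>v\<in>UNIV. f v ^ Poly_Mapping.lookup e v))"

text \<open>Running the product over all variables makes it multiplicative in the exponent, and the
  free coefficient map \<open>h\<close> lets the same evaluation serve integer and complex
  polynomials.\<close>

lemma subst_eq_insertion: "subst f p = insertion of_int f p"
proof -
  have "(\<Prod>v\<in>Poly_Mapping.keys e. f v ^ Poly_Mapping.lookup e v)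
      = (\<Prod>v\<in>UNIV. f v ^ Poly_Mapping.lookup e v)" for e
    by (rule prod.mono_neutral_left) (auto simp: in_keys_iff)
  then show ?thesis unfolding subst_def insertion_def by simp
qed

lemma poly_mapping_sum_single:
  "p = (\<Sum>e\<in>Poly_Mapping.keys p. Poly_Mapping.single e (Poly_Mapping.lookup p e))"
proof (rule poly_mapping_eqI)
  fix k
  have "Poly_Mapping.lookup (\<Sum>e\<in>Poly_Mapping.keys p. Poly_Mapping.single e (Poly_Mapping.lookup p e)) k
    = (\<Sum>e\<in>Poly_Mapping.keys p. if e = k then Poly_Mapping.lookup p e else 0)"
    by (simp add: lookup_sum lookup_single when_def)
  also have "\<dots> = Poly_Mapping.lookup p k" by (auto simp: in_keys_iff)
  finally show "Poly_Mapping.lookup p k = Poly_Mapping.lookup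
     (\<Sum>e\<in>Poly_Mapping.keys p. Poly_Mapping.single e (Poly_Mapping.lookup p e)) k" by simp
qed

context comm_ring_hom
begin

text \<open>A sum may lose terms by cancellation, so additivity is proved over a common finite set
  of exponents.\<close>

lemma insertion_superset:
  assumes "finite E" "Poly_Mapping.keys p \<subseteq> E"
  shows "insertion hom f p = (\<Sum>e\<in>E. hom (Poly_Mapping.lookup p e) * (\<Prod>v\<in>UNIV. f v ^ Poly_Mapping.lookup e v))"
  unfolding insertion_def using assms by (intro sum.mono_neutral_left) (auto simp: in_keys_iff)

lemma insertion_zero: "insertion hom f 0 = 0"
  by (simp add: insertion_def)

lemma insertion_single:
  "insertion hom f (Poly_Mapping.single e c) = hom c * (\<Prod>v\<in>UNIV. f v ^ Poly_Mapping.lookup e v)"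
  by (subst insertion_superset[of "{e}"]) (auto simp: lookup_single)

lemma insertion_add: "insertion hom f (p + q) = insertion hom f p + insertion hom f q"
proof -
  let ?E = "Poly_Mapping.keys p \<union> Poly_Mapping.keys q"
  have "Poly_Mapping.keys (p + q) \<subseteq> ?E" by (rule Poly_Mapping.keys_add)
  then show ?thesis
    by (subst (1 2 3) insertion_superset[of ?E])
       (auto simp: lookup_add hom_add distrib_right sum.distrib)
qed

lemma insertion_sum: "insertion hom f (sum g A) = (\<Sum>a\<in>A. insertion hom f (g a))"
  by (induction A rule: infinite_finite_induct) (auto simp: insertion_zero insertion_add)

lemma insertion_mult: "insertion hom f (p * q) = insertion hom f p * insertion hom f q"
proof -
  have 1: "insertion hom f (Poly_Mapping.single e c * Poly_Mapping.single e' c')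
     = insertion hom f (Poly_Mapping.single e c) * insertion hom f (Poly_Mapping.single e' c')" for e c e' c'
    by (simp add: mult_single insertion_single lookup_add power_add prod.distrib hom_mult mult_ac)
  show ?thesis
    by (subst (1 2) poly_mapping_sum_single[of p], subst (1 2) poly_mapping_sum_single[of q])
       (simp add: sum_product insertion_sum 1)
qed

lemma comm_ring_hom_insertion: "comm_ring_hom (insertion hom f)"
proof -
  have "insertion hom f 1 = 1"
    using insertion_single[of f 0 1] by simp
  then show ?thesis
    by unfold_locales (auto simp: insertion_zero insertion_add insertion_mult)
qed

lemma insertion_Var: "insertion hom f (Var v) = f v"
proof -
  have "(\<Prod>w\<in>UNIV. f w ^ Poly_Mapping.lookup (Poly_Mapping.single v (1::nat)) w) = (\<Prod>w\<in>UNIV. if w = v then f w else 1)"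
    by (intro prod.cong) (auto simp: lookup_single when_def)
  then show ?thesis by (simp add: Var_def insertion_single)
qed

lemma insertion_Const: "insertion hom f (Const c) = hom c"
  by (simp add: Const_def insertion_single)

end

interpretation subst_hom: comm_ring_hom "subst f"
  for f :: "'v::finite \<Rightarrow> 'r::comm_ring_1"
  using of_int_hom.comm_ring_hom_insertion[of f] unfolding subst_eq_insertion .

lemma subst_Var [simp]: "subst f (Var v) = f v" for f :: "'v::finite \<Rightarrow> 'r::comm_ring_1"
  by (simp add: subst_eq_insertion of_int_hom.insertion_Var)

text \<open>A ring homomorphism respects integer coefficients, so it acts on the values only.
  Composition of substitutions, restriction to a line and evaluation of univariate polynomials are
  all instances.\<close>

lemma hom_subst:
  fixes f :: "'v::finite \<Rightarrow> 'r::comm_ring_1"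
  assumes "comm_ring_hom h"
  shows "h (subst f p) = subst (\<lambda>v. h (f v)) p"
proof -
  interpret comm_ring_hom h by fact
  show ?thesis by (simp add: subst_eq_insertion insertion_def hom_distribs)
qed

lemma subst_subst:
  fixes f :: "'v::finite \<Rightarrow> ('w::finite, int) mpoly"
  shows "subst g (subst f p) = subst (\<lambda>v. subst g (f v)) p"
  by (rule hom_subst[OF subst_hom.comm_ring_hom_axioms])

lemma prod_Var_power:
  "(\<Prod>v\<in>UNIV. (Var v :: ('v::finite, 'c::comm_ring_1) mpoly) ^ Poly_Mapping.lookup e v) = Poly_Mapping.single e 1"
proof -
  have 1: "(Var v :: ('v, 'c) mpoly) ^ n = Poly_Mapping.single (Poly_Mapping.single v n) 1" for v n
    by (induction n) (auto simp: Var_def mult_single single_add[symmetric] add.commute)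
  have "finite A \<Longrightarrow> (\<Prod>v\<in>A. (Var v :: ('v, 'c) mpoly) ^ Poly_Mapping.lookup e v)
      = Poly_Mapping.single (\<Sum>v\<in>A. Poly_Mapping.single v (Poly_Mapping.lookup e v)) 1" for A
    by (induction A rule: finite_induct) (auto simp: 1 mult_single)
  then have "(\<Prod>v\<in>UNIV. (Var v :: ('v, 'c) mpoly) ^ Poly_Mapping.lookup e v)
      = Poly_Mapping.single (\<Sum>v\<in>UNIV. Poly_Mapping.single v (Poly_Mapping.lookup e v)) 1" by simp
  also have "(\<Sum>v\<in>UNIV. Poly_Mapping.single v (Poly_Mapping.lookup e v)) = e"
    by (rule poly_mapping_eqI) (simp add: lookup_sum lookup_single when_def)
  finally show ?thesis .
qed

lemma of_int_mpoly: "(of_int c :: ('v, 'c::comm_ring_1) mpoly) = Poly_Mapping.single 0 (of_int c)"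
  by (induction c rule: int_induct[where k = 0]) (auto simp: single_add single_diff)

lemma subst_Var_id [simp]: "subst Var p = p" for p :: "('v::finite, int) mpoly"
proof -
  have "of_int (Poly_Mapping.lookup p e) * (\<Prod>v\<in>UNIV. (Var v :: ('v, int) mpoly) ^ Poly_Mapping.lookup e v)
      = Poly_Mapping.single e (Poly_Mapping.lookup p e)" for e :: "'v \<Rightarrow>\<^sub>0 nat" and p
    unfolding prod_Var_power of_int_mpoly by (simp add: mult_single)
  then show ?thesis
    unfolding subst_eq_insertion insertion_def using poly_mapping_sum_single[of p] by simp
qed

subsection \<open>Polynomials as univariate polynomials in one of the variables\<close>

text \<open>The coefficients stay in the full ring, where \<open>v\<close> merely does not occur, so
  the type of variables is kept, and putting \<open>Var v\<close> for the indeterminate recovers the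
  polynomial.\<close>

definition uni :: "'v \<Rightarrow> ('v::finite, int) mpoly \<Rightarrow> ('v, int) mpoly poly" where
  "uni v = subst (\<lambda>w. if w = v then [:0, 1:] else [:Var w:])"

interpretation uni_hom: comm_ring_hom "uni v" for v :: "'v::finite"
  unfolding uni_def by (rule subst_hom.comm_ring_hom_axioms)

lemma poly_uni: "poly (uni v p) x = subst (Var(v := x)) p"
  unfolding uni_def hom_subst[where h = "\<lambda>q. poly q x", OF poly_hom.comm_ring_hom_axioms]
  by (rule arg_cong[of _ _ "\<lambda>f. subst f p"]) (auto simp: fun_eq_iff)

lemma poly_uni_Var [simp]: "poly (uni v p) (Var v) = p"
  by (simp add: poly_uni)

lemma uni_eq_0_iff: "uni v p = 0 \<longleftrightarrow> p = 0"
  using poly_uni_Var[of v p] by (auto simp del: poly_uni_Var)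

definition uni_eval :: "('v \<Rightarrow> complex) \<Rightarrow> 'v \<Rightarrow> ('v::finite, int) mpoly \<Rightarrow> complex poly" where
  "uni_eval c v = subst (\<lambda>w. if w = v then [:0, 1:] else [:c w:])"

interpretation uni_eval_hom: comm_ring_hom "uni_eval c v" for c and v :: "'v::finite"
  unfolding uni_eval_def by (rule subst_hom.comm_ring_hom_axioms)

lemma map_poly_uni: "map_poly (subst c) (uni v p) = uni_eval c v p"
proof -
  interpret map_poly_comm_ring_hom "subst c" ..
  show ?thesis
    unfolding uni_def uni_eval_def hom_subst[OF comm_ring_hom_axioms]
    by (rule arg_cong[of _ _ "\<lambda>f. subst f p"]) (auto simp: fun_eq_iff hom_distribs)
qed

lemma coeff_uni_eval: "coeff (uni_eval c v p) k = subst c (coeff (uni v p) k)"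
  by (simp add: map_poly_uni[symmetric])

lemma poly_uni_eval: "poly (uni_eval c v p) x = subst (c(v := x)) p"
  unfolding uni_eval_def hom_subst[where h = "\<lambda>q. poly q x", OF poly_hom.comm_ring_hom_axioms]
  by (rule arg_cong[of _ _ "\<lambda>f. subst f p"]) (auto simp: fun_eq_iff)

section \<open>Variables that occur in a polynomial\<close>

definition vars :: "('v, 'c::zero) mpoly \<Rightarrow> 'v set" where
  "vars p = (\<Union>e\<in>Poly_Mapping.keys p. Poly_Mapping.keys e)"

lemma vars_add: "vars (p + q) \<subseteq> vars p \<union> vars q" for p :: "('v, 'c::monoid_add) mpoly"
  unfolding vars_def using Poly_Mapping.keys_add[of p q] by blast

lemma vars_mult: "vars (p * q) \<subseteq> vars p \<union> vars q" for p :: "('v, 'c::semiring_0) mpoly"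
proof
  fix v assume "v \<in> vars (p * q)"
  then obtain e where "e \<in> Poly_Mapping.keys (p * q)" "v \<in> Poly_Mapping.keys e"
    by (auto simp: vars_def)
  moreover obtain a b where "a \<in> Poly_Mapping.keys p" "b \<in> Poly_Mapping.keys q" "e = a + b"
    using calculation(1) keys_mult[of p q] by blast
  ultimately show "v \<in> vars p \<union> vars q"
    using Poly_Mapping.keys_add[of a b] by (auto simp: vars_def)
qed

lemma vars_of_int: "vars (of_int c :: ('v, int) mpoly) = {}"
  by (auto simp: vars_def of_int_mpoly split: if_splits)

lemma vars_Var: "vars (Var v :: ('v, 'c::comm_ring_1) mpoly) \<subseteq> {v}"
  by (auto simp: vars_def Var_def)

lemma vars_sum:
  fixes g :: "'i \<Rightarrow> ('v, 'c::comm_monoid_add) mpoly"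
  assumes "\<And>i. i \<in> A \<Longrightarrow> vars (g i) \<subseteq> S"
  shows "vars (sum g A) \<subseteq> S"
  using assms
proof (induction A rule: infinite_finite_induct)
  case (insert x F)
  then show ?case using vars_add[of "g x" "sum g F"] by auto
qed (auto simp: vars_def)

lemma vars_coeff_mult:
  fixes P Q :: "('v, 'c::comm_semiring_0) mpoly poly"
  assumes "\<And>k. vars (coeff P k) \<subseteq> S" "\<And>k. vars (coeff Q k) \<subseteq> S"
  shows "vars (coeff (P * Q) k) \<subseteq> S"
  unfolding coeff_mult
proof (rule vars_sum)
  fix i
  show "vars (coeff P i * coeff Q (k - i)) \<subseteq> S"
    using vars_mult[of "coeff P i" "coeff Q (k - i)"] assms(1)[of i] assms(2)[of "k - i"] by blast
qed

lemma vars_coeff_prod: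
  fixes f :: "'i \<Rightarrow> ('v, 'c::comm_semiring_1) mpoly poly"
  assumes "finite A" "\<And>i k. i \<in> A \<Longrightarrow> vars (coeff (f i) k) \<subseteq> S"
  shows "vars (coeff (prod f A) k) \<subseteq> S"
  using assms
proof (induction A arbitrary: k rule: finite_induct)
  case empty
  have "vars (1 :: ('v, 'c) mpoly) = {}" by (simp add: vars_def)
  then show ?case by (auto simp: coeff_1 vars_def)
next
  case (insert x F)
  then show ?case by (simp add: vars_coeff_mult)
qed

lemma vars_coeff_uni:
  fixes p :: "('v::finite, int) mpoly"
  shows "vars (coeff (uni v p) k) \<subseteq> vars p - {v}"
proof -
  have 1: "vars (1 :: ('v, int) mpoly) = {}" "vars (0 :: ('v, int) mpoly) = {}" by (simp_all add: vars_def)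
  define g :: "'v \<Rightarrow> ('v, int) mpoly poly" where "g = (\<lambda>w. if w = v then [:0, 1:] else [:Var w:])"
  have f: "vars (coeff (g w ^ Poly_Mapping.lookup e w) k) \<subseteq> vars p - {v}"
    if "e \<in> Poly_Mapping.keys p" for e w k
  proof (cases "Poly_Mapping.lookup e w = 0")
    case True
    then show ?thesis using 1 by (auto simp: coeff_1)
  next
    case False
    then have "w \<in> vars p" using that by (auto simp: vars_def in_keys_iff)
    then have "vars (coeff (g w) k) \<subseteq> vars p - {v}" for k
      using vars_Var[of w, where 'c = int] 1 by (auto simp: g_def coeff_pCons split: nat.splits)
    then show ?thesis
      using vars_coeff_prod[of "{..<Poly_Mapping.lookup e w}" "\<lambda>_. g w"] by simp
  qed
  have c: "vars (coeff (of_int c :: ('v, int) mpoly poly) k) \<subseteq> vars p - {v}" for c k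
    using vars_of_int[where 'v = 'v] 1 by (auto simp: of_int_poly coeff_pCons split: nat.splits)
  show ?thesis
    unfolding uni_def subst_eq_insertion insertion_def coeff_sum g_def[symmetric]
    by (intro vars_sum vars_coeff_mult vars_coeff_prod f c) auto
qed

lemma vars_empty: "vars p = {} \<longleftrightarrow> (\<exists>c. p = of_int c)" for p :: "('v, int) mpoly"
proof
  assume "vars p = {}"
  then have "Poly_Mapping.keys p \<subseteq> {0}" by (auto simp: vars_def)
  then have "p = of_int (Poly_Mapping.lookup p 0)"
    unfolding of_int_mpoly by (intro poly_mapping_eqI) (auto simp: lookup_single when_def in_keys_iff subset_iff)
  then show "\<exists>c. p = of_int c" by blast
qed (auto simp: vars_of_int)

text \<open>Generic points are found by choosing the values of the variables one at a time.\<close>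

lemma nonzero_eliminate:
  fixes p :: "('v::finite, int) mpoly"
  assumes "p \<noteq> 0" "vars p \<subseteq> insert v S"
  obtains q where "q \<noteq> 0" "vars q \<subseteq> S"
    "\<And>c. subst c q \<noteq> 0 \<Longrightarrow> finite {x. subst (c(v := x)) p = (0::complex)}"
proof -
  from assms obtain k where k: "coeff (uni v p) k \<noteq> 0"
    using uni_eq_0_iff[of v p] leading_coeff_neq_0 by blast
  show ?thesis
  proof (rule that[of "coeff (uni v p) k"])
    show "vars (coeff (uni v p) k) \<subseteq> S" using vars_coeff_uni[of v p k] assms by blast
  next
    fix c :: "'v \<Rightarrow> complex"
    assume "subst c (coeff (uni v p) k) \<noteq> 0"
    then have "uni_eval c v p \<noteq> 0" by (metis coeff_0 coeff_uni_eval)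
    from poly_roots_finite[OF this]
    show "finite {x. subst (c(v := x)) p = 0}" by (simp add: poly_uni_eval)
  qed (fact k)
qed

text \<open>The condition \<open>good\<close> may be as far from algebraic as distinctness of
  products of chosen roots: it only has to exclude finitely many values of the variable added last.
  The arbitrary \<open>q\<close> in \<open>base\<close> stands for the coefficient of
  \<open>p\<close> that has to survive at the smaller stage.\<close>

lemma exists_generic_extension:
  fixes p :: "('v::finite, int) mpoly" and good :: "'v set \<Rightarrow> ('v \<Rightarrow> complex) \<Rightarrow> bool"
  assumes base: "\<And>q. q \<noteq> 0 \<Longrightarrow> vars q \<subseteq> S \<Longrightarrow> \<exists>c. subst c q \<noteq> 0 \<and> good S c"
    and step: "\<And>c. good S c \<Longrightarrow> finite {x. \<not> good (insert v S) (c(v := x))}"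
    and p: "p \<noteq> 0" "vars p \<subseteq> insert v S"
  shows "\<exists>c. subst c p \<noteq> 0 \<and> good (insert v S) c"
proof -
  obtain q where q: "q \<noteq> 0" "vars q \<subseteq> S"
    "\<And>c. subst c q \<noteq> 0 \<Longrightarrow> finite {x. subst (c(v := x)) p = (0::complex)}"
    using nonzero_eliminate[OF p] by metis
  from base[OF q(1,2)] obtain c where c: "subst c q \<noteq> 0" "good S c" by blast
  have "finite ({x. subst (c(v := x)) p = 0} \<union> {x. \<not> good (insert v S) (c(v := x))})"
    using q(3)[OF c(1)] step[OF c(2)] by blast
  then obtain x where "x \<notin> {x. subst (c(v := x)) p = 0} \<union> {x. \<not> good (insert v S) (c(v := x))}"
    using infinite_UNIV_char_0[where 'a = complex] by (metis ex_new_if_finite)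
  then show ?thesis by blast
qed

lemma exists_generic:
  fixes p :: "('v::finite, int) mpoly" and good :: "'v set \<Rightarrow> ('v \<Rightarrow> complex) \<Rightarrow> bool"
  assumes "finite S" "p \<noteq> 0" "vars p \<subseteq> S"
    and "\<And>c. good {} c"
    and "\<And>T v c. v \<notin> T \<Longrightarrow> insert v T \<subseteq> S \<Longrightarrow> good T c \<Longrightarrow> finite {x. \<not> good (insert v T) (c(v := x))}"
  shows "\<exists>c. subst c p \<noteq> 0 \<and> good S c"
  using assms
proof (induction S arbitrary: p rule: finite_induct)
  case empty
  then obtain k where "p = of_int k" using vars_empty[of p] by blast
  with empty show ?case by (auto simp: subst_hom.hom_of_int)
next
  case (insert v S)
  show ?case
  proof (rule exists_generic_extension[OF _ _ insert.prems(1,2)])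
    show "\<exists>c. subst c q \<noteq> 0 \<and> good S c" if "q \<noteq> 0" "vars q \<subseteq> S" for q
      using that insert by (meson subset_insertI2)
    show "finite {x. \<not> good (insert v S) (c(v := x))}" if "good S c" for c
      using insert.prems(4)[of v S c] that insert.hyps(2) by blast
  qed
qed

lemma exists_nonzero_value:
  fixes p :: "('v::finite, int) mpoly"
  assumes "p \<noteq> 0"
  obtains c :: "'v \<Rightarrow> complex" where "subst c p \<noteq> 0" "\<And>v. c v \<noteq> 0"
proof -
  have "\<exists>c. subst c p \<noteq> 0 \<and> (\<forall>v\<in>UNIV. c v \<noteq> (0::complex))"
  proof (rule exists_generic[where good = "\<lambda>T c. \<forall>v\<in>T. c v \<noteq> 0"])
    fix T v and c :: "'v \<Rightarrow> complex"
    assume "v \<notin> T" "\<forall>w\<in>T. c w \<noteq> 0"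
    then have "{x. \<not> (\<forall>w\<in>insert v T. (c(v := x)) w \<noteq> 0)} \<subseteq> {0}" by auto
    then show "finite {x. \<not> (\<forall>w\<in>insert v T. (c(v := x)) w \<noteq> 0)}" by (rule finite_subset) simp
  qed (use assms in auto)
  then show ?thesis using that by blast
qed

lemma mpoly_eq_0_iff: "p = 0 \<longleftrightarrow> (\<forall>c::'v \<Rightarrow> complex. (\<forall>v. c v \<noteq> 0) \<longrightarrow> subst c p = 0)"
  for p :: "('v::finite, int) mpoly"
  using exists_nonzero_value[of p] by (metis subst_hom.hom_zero)

text \<open>Points with a zero coordinate can be left out, so identities are tested only where the
  trinomials keep their degree and have nonzero roots.\<close>

lemma mpoly_eqI:
  fixes p q :: "('v::finite, int) mpoly"
  assumes "\<And>c::'v \<Rightarrow> complex. (\<And>v. c v \<noteq> 0) \<Longrightarrow> subst c p = subst c q"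
  shows "p = q"
proof -
  have "p - q = 0" unfolding mpoly_eq_0_iff using assms by (simp add: subst_hom.hom_minus)
  then show ?thesis by simp
qed

subsection \<open>Divisibility\<close>

text \<open>Restricting two nonzero polynomials to the line through two points where they do not vanish
  reduces the claim to univariate polynomials over a field.\<close>

lemma mpoly_mult_eq_0_iff: "p * q = 0 \<longleftrightarrow> p = 0 \<or> q = 0" for p q :: "('v::finite, int) mpoly"
proof (rule iffI, rule ccontr)
  assume pq: "p * q = 0" and "\<not> (p = 0 \<or> q = 0)"
  then have "p \<noteq> 0" "q \<noteq> 0" by auto
  from exists_nonzero_value[OF this(1)] obtain c :: "'v \<Rightarrow> complex" where c: "subst c p \<noteq> 0" .
  from exists_nonzero_value[OF \<open>q \<noteq> 0\<close>] obtain d :: "'v \<Rightarrow> complex" where d: "subst d q \<noteq> 0" .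
  define f where "f v = [:c v, d v - c v:]" for v
  have ev: "poly (subst f r) x = subst (\<lambda>v. c v + x * (d v - c v)) r" for r x
    unfolding hom_subst[where h = "\<lambda>q. poly q x", OF poly_hom.comm_ring_hom_axioms] by (simp add: f_def)
  have "poly (subst f p) 0 \<noteq> 0" "poly (subst f q) 1 \<noteq> 0" using c d by (simp_all add: ev)
  then have "subst f p \<noteq> 0" "subst f q \<noteq> 0" by auto
  moreover have "subst f p * subst f q = 0" using arg_cong[OF pq, of "subst f"] by (simp add: subst_hom.hom_mult)
  ultimately show False by simp
qed auto

lemma mpoly_mult_cancel_left: "p * q = p * r \<longleftrightarrow> p = 0 \<or> q = r" for p q r :: "('v::finite, int) mpoly"
  using mpoly_mult_eq_0_iff[of p "q - r"] by (auto simp: right_diff_distrib)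

lemma Var_neq_0: "(Var v :: ('v::finite, int) mpoly) \<noteq> 0"
proof
  assume "(Var v :: ('v, int) mpoly) = 0"
  then have "subst (\<lambda>_. 1 :: complex) (Var v :: ('v, int) mpoly) = 0" by simp
  then show False by (simp del: subst_hom.hom_zero)
qed

lemma mpoly_prod_eq_0_iff: "finite A \<Longrightarrow> prod f A = 0 \<longleftrightarrow> (\<exists>a\<in>A. f a = 0)"
  for f :: "'i \<Rightarrow> ('v::finite, int) mpoly"
proof (induction A rule: finite_induct)
  case empty
  have "subst (\<lambda>_. 0 :: complex) (1 :: ('v, int) mpoly) \<noteq> 0" by simp
  then show ?case by auto
qed (auto simp: mpoly_mult_eq_0_iff)

lemma Var_dvd_iff: "Var v dvd p \<longleftrightarrow> subst (Var(v := 0 :: ('v, int) mpoly)) p = 0"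
  for p :: "('v::finite, int) mpoly"
proof
  assume 0: "subst (Var(v := 0 :: ('v, int) mpoly)) p = 0"
  obtain a P where P: "uni v p = pCons a P" by (cases "uni v p")
  have "a = 0" using 0 poly_uni[of v p 0] by (simp add: P)
  then have "p = Var v * poly P (Var v)" using poly_uni_Var[of v p] by (simp add: P)
  then show "Var v dvd p" ..
qed (auto simp: subst_hom.hom_mult elim!: dvdE)

text \<open>Reduction modulo \<open>Var v\<close> is the substitution of 0, which maps into a ring
  without zero divisors. So \<open>Var v\<close> is prime and, not dividing \<open>D\<close>,
  divides the cofactor \<open>Q\<close>.\<close>

lemma dvd_cancel_Var:
  fixes D R :: "('v::finite, int) mpoly"
  assumes "\<not> Var v dvd D" "D dvd Var v ^ n * R"
  shows "D dvd R"
  using assms(2)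
proof (induction n)
  case (Suc n)
  then obtain Q where Q: "Var v * (Var v ^ n * R) = D * Q" by (metis dvdE mult.assoc power_Suc)
  from arg_cong[OF this, of "subst (Var(v := 0 :: ('v, int) mpoly))"] have "Var v dvd Q"
    using assms(1) by (simp add: subst_hom.hom_mult mpoly_mult_eq_0_iff Var_dvd_iff)
  then obtain Q' where "Q = Var v * Q'" ..
  with Q have "Var v * (Var v ^ n * R) = Var v * (D * Q')" by (simp add: mult_ac)
  then have "Var v ^ n * R = D * Q'" unfolding mpoly_mult_cancel_left using Var_neq_0 by blast
  then show ?case using Suc.IH by simp
qed simp

lemma dvd_cancel_monomial:
  fixes D R :: "('v::finite, int) mpoly"
  assumes "finite I" "\<And>i. i \<in> I \<Longrightarrow> \<not> Var (w i) dvd D" "D dvd (\<Prod>i\<in>I. Var (w i) ^ n i) * R"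
  shows "D dvd R"
  using assms
proof (induction I arbitrary: R rule: finite_induct)
  case (insert i I)
  have "D dvd Var (w i) ^ n i * ((\<Prod>i\<in>I. Var (w i) ^ n i) * R)"
    using insert.prems(2) insert.hyps by (simp add: mult.assoc)
  from dvd_cancel_Var[OF insert.prems(1)[OF insertI1] this]
  show ?case using insert.prems(1) by (rule insert.IH[rotated]) blast
qed simp

section \<open>Pseudo-division and divisibility through common roots\<close>

lemma pseudo_division:
  fixes F G :: "'a::comm_ring_1 poly"
  assumes "\<And>i. i > d \<Longrightarrow> coeff G i = 0"
  shows "\<exists>k Q S. Polynomial.smult (coeff G d ^ k) F = G * Q + S \<and> (\<forall>i\<ge>d. coeff S i = 0)"
proof -
  have "(\<And>i. i \<ge> n \<Longrightarrow> coeff F i = 0) \<Longrightarrow>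
    \<exists>k Q S. Polynomial.smult (coeff G d ^ k) F = G * Q + S \<and> (\<forall>i\<ge>d. coeff S i = 0)" for n and F :: "'a poly"
  proof (induction n arbitrary: F)
    case 0
    then show ?case by (intro exI[of _ 0] exI[of _ "0::'a poly"] exI[of _ F]) auto
  next
    case (Suc n)
    show ?case
    proof (cases "n < d")
      case True
      then show ?thesis using Suc.prems by (intro exI[of _ 0] exI[of _ "0::'a poly"] exI[of _ F]) auto
    next
      case False
      define M where "M = monom (coeff F n) (n - d)"
      have "coeff (Polynomial.smult (coeff G d) F - M * G) i = 0" if "i \<ge> n" for i
      proof (cases "i = n")
        case True
        then show ?thesis using False by (simp add: M_def coeff_monom_mult)
      next
        case False
        then show ?thesis using that Suc.prems[of i] assms[of "i - (n - d)"] \<open>\<not> n < d\<close>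
          by (auto simp: M_def coeff_monom_mult)
      qed
      from Suc.IH[OF this] obtain k Q S where
        1: "Polynomial.smult (coeff G d ^ k) (Polynomial.smult (coeff G d) F - M * G) = G * Q + S" "\<forall>i\<ge>d. coeff S i = 0" by blast
      have "Polynomial.smult (coeff G d ^ Suc k) F = Polynomial.smult (coeff G d ^ k) (Polynomial.smult (coeff G d) F - M * G) + Polynomial.smult (coeff G d ^ k) (M * G)"
        by (simp add: smult_diff_right mult_ac)
      also have "\<dots> = G * (Q + Polynomial.smult (coeff G d ^ k) M) + S"
        unfolding 1(1) by (simp add: algebra_simps)
      finally show ?thesis using 1(2) by blast
    qed
  qed
  moreover have "\<exists>n. \<forall>i\<ge>n. coeff F i = 0" by (metis coeff_eq_0 less_eq_Suc_le)
  ultimately show ?thesis by blast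
qed

lemma poly_eq_0_if_many_roots:
  fixes p :: "'a::idom poly"
  assumes "finite Z" "card Z \<ge> d" "\<And>z. z \<in> Z \<Longrightarrow> poly p z = 0" "\<And>i. i \<ge> d \<Longrightarrow> coeff p i = 0"
  shows "p = 0"
proof (rule ccontr)
  assume p: "p \<noteq> 0"
  then have "degree p < d" using assms(4)[of "degree p"] by (metis leading_coeff_0_iff not_less)
  moreover have "card Z \<le> card {z. poly p z = 0}"
    using assms(3) poly_roots_finite[OF p] by (intro card_mono) auto
  ultimately show False using card_poly_roots_bound[of p] p assms(2) by simp
qed

text \<open>In the variable \<open>v\<close> the pseudo-remainder of \<open>R\<close> by
  \<open>D\<close> has no terms of degree \<open>d\<close> or more, yet at generic values of the
  other variables it has \<open>d\<close> roots, so it vanishes. What remains is a power of the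
  leading coefficient in front of \<open>R\<close>, a monomial that is cancelled through
  \<open>ndvd\<close>. The point in \<open>roots\<close> may depend on \<open>S\<close>: it is
  chosen after the coefficient that is supposed to be nonzero.\<close>

lemma dvd_if_common_roots:
  fixes D R :: "('v::finite, int) mpoly"
  assumes lead: "\<And>i. i > d \<Longrightarrow> coeff (uni v D) i = 0" "coeff (uni v D) d = (\<Prod>i\<in>I. Var (w i) ^ n i)"
    and "finite I" and ndvd: "\<And>i. i \<in> I \<Longrightarrow> \<not> Var (w i) dvd D"
    and roots: "\<And>S :: ('v, int) mpoly. S \<noteq> 0 \<Longrightarrow> \<exists>c Z. subst c S \<noteq> (0::complex) \<and> finite Z \<and> card Z \<ge> d \<and>
       (\<forall>z\<in>Z. subst (c(v := z)) D = 0 \<and> subst (c(v := z)) R = 0)"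
  shows "D dvd R"
proof -
  obtain k Q S where QS: "Polynomial.smult (coeff (uni v D) d ^ k) (uni v R) = uni v D * Q + S" "\<forall>i\<ge>d. coeff S i = 0"
    using pseudo_division[OF lead(1), where F = "uni v R"] by blast
  have L: "coeff (uni v D) d ^ k = (\<Prod>i\<in>I. Var (w i) ^ (n i * k))"
    by (simp add: lead(2) prod_power_distrib[symmetric] power_mult)
  have "coeff S i = 0" for i
  proof (rule ccontr)
    assume "coeff S i \<noteq> 0"
    from roots[OF this] obtain c Z where c: "subst c (coeff S i) \<noteq> (0::complex)" "finite Z" "card Z \<ge> d"
      "\<And>z. z \<in> Z \<Longrightarrow> subst (c(v := z)) D = 0 \<and> subst (c(v := z)) R = 0" by blast
    interpret mp: map_poly_comm_ring_hom "subst c" ..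
    have "map_poly (subst c) S = 0"
    proof (rule poly_eq_0_if_many_roots[OF c(2,3)])
      fix z assume z: "z \<in> Z"
      have "poly (map_poly (subst c) (Polynomial.smult (coeff (uni v D) d ^ k) (uni v R))) z
          = poly (map_poly (subst c) (uni v D * Q + S)) z" by (simp add: QS(1))
      then show "poly (map_poly (subst c) S) z = 0"
        using c(4)[OF z] by (simp add: hom_distribs map_poly_uni poly_uni_eval)
    qed (use QS(2) in simp)
    then have "coeff (map_poly (subst c) S) i = 0" by simp
    with c(1) show False by simp
  qed
  then have "S = 0" by (simp add: poly_eq_iff)
  from arg_cong[OF QS(1)[unfolded this], of "\<lambda>P. poly P (Var v)"]
  have "(\<Prod>i\<in>I. Var (w i) ^ (n i * k)) * R = D * poly Q (Var v)" by (simp add: L)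
  then have "D dvd (\<Prod>i\<in>I. Var (w i) ^ (n i * k)) * R" by simp
  then show ?thesis using dvd_cancel_monomial[of I w D "\<lambda>i. n i * k" R] ndvd \<open>finite I\<close> by blast
qed

text \<open>A unit has no zeros, so along every coordinate line it is a complex polynomial without
  roots, hence constant. Moving the coordinates to 1 one at a time shows that it is constant
  altogether.\<close>

lemma mpoly_unit_constant:
  fixes u :: "('v::finite, int) mpoly"
  assumes "u dvd 1"
  obtains k where "u = of_int k" "k \<noteq> 0"
proof -
  from assms obtain w where w: "1 = u * w" by (rule dvdE)
  have one: "subst (\<lambda>_. 1) u = (of_int (subst (\<lambda>_. 1::int) u) :: complex)"
    unfolding hom_subst[OF of_int_hom.comm_ring_hom_axioms] by simp
  have nz: "subst c u \<noteq> 0" for c :: "'v \<Rightarrow> complex"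
  proof
    assume "subst c u = 0"
    then have "subst c (1 :: ('v, int) mpoly) = 0" unfolding w subst_hom.hom_mult by simp
    then show False by simp
  qed
  have upd: "subst (c(v := x)) u = subst c u" for c :: "'v \<Rightarrow> complex" and v x
  proof -
    have "\<not> (\<exists>y. poly (uni_eval c v u) y = 0)" unfolding poly_uni_eval using nz by blast
    then have "degree (uni_eval c v u) = 0"
      using alg_closed_imp_poly_has_root[of "uni_eval c v u"] by (cases "degree (uni_eval c v u)") auto
    then obtain a where "uni_eval c v u = [:a:]" by (rule degree_eq_zeroE)
    then have "poly (uni_eval c v u) x = poly (uni_eval c v u) (c v)" by simp
    then show ?thesis by (simp add: poly_uni_eval)
  qed
  have const: "subst c u = of_int (subst (\<lambda>_. 1) u)" for c :: "'v \<Rightarrow> complex"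
  proof -
    have "finite A \<Longrightarrow> subst (\<lambda>v. if v \<in> A then 1 else c v) u = subst c u" for A
    proof (induction A rule: finite_induct)
      case (insert v A)
      have "(\<lambda>w. if w \<in> insert v A then 1 else c w) = (\<lambda>w. if w \<in> A then 1 else c w)(v := 1)" by auto
      then show ?case using insert upd by simp
    qed simp
    from this[of UNIV] show ?thesis by (simp add: one)
  qed
  have "u = of_int (subst (\<lambda>_. 1) u)"
    by (rule mpoly_eqI) (simp add: const one subst_hom.hom_of_int)
  moreover have "subst (\<lambda>_. 1::int) u \<noteq> 0"
    using nz[of "\<lambda>_. 1"] one by auto
  ultimately show ?thesis using that by blast
qed

section \<open>The resultant as a product over roots\<close>

text \<open>Both sides are \<open>a ^ m * b ^ n\<close> times a product of all differences of roots,
  with a factor \<open>-1\<close> for each pair.\<close>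

lemma prod_over_roots_swap:
  fixes f g :: "'a::field poly" and n m :: nat
  assumes f: "f = Polynomial.smult a (\<Prod>i<n. [:- \<zeta> i, 1:])" and g: "g = Polynomial.smult b (\<Prod>j<m. [:- \<eta> j, 1:])"
  shows "a ^ m * (\<Prod>i<n. poly g (\<zeta> i)) = (-1) ^ (n * m) * (b ^ n * (\<Prod>j<m. poly f (\<eta> j)))"
proof -
  have "(\<Prod>i<n. \<Prod>j<m. \<zeta> i - \<eta> j) = (\<Prod>i<n. \<Prod>j<m. (-1) * (\<eta> j - \<zeta> i))" by simp
  also have "\<dots> = (-1) ^ (n * m) * (\<Prod>i<n. \<Prod>j<m. \<eta> j - \<zeta> i)"
    unfolding prod.distrib by (simp add: power_mult[symmetric] mult.commute)
  also have "(\<Prod>i<n. \<Prod>j<m. \<eta> j - \<zeta> i) = (\<Prod>j<m. \<Prod>i<n. \<eta> j - \<zeta> i)" by (rule prod.swap)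
  finally show ?thesis
    by (simp add: f g poly_prod prod.distrib)
qed

lemma degree_smult_prod_linear:
  "degree (Polynomial.smult a (\<Prod>i<n. [:- \<zeta> i, 1:])) = (if a = 0 then 0 else n)"
  for a :: "'a::field" and n :: nat
proof -
  have "degree (\<Prod>i<n. [:- \<zeta> i, 1:]) = n" by (subst degree_prod_eq_sum_degree) auto
  then show ?thesis by (simp add: degree_smult_eq)
qed

lemma alg_closed_linear_factors:
  fixes f :: "'a::alg_closed_field poly"
  assumes "f \<noteq> 0"
  obtains \<zeta> where "f = Polynomial.smult (lead_coeff f) (\<Prod>i<degree f. [:- \<zeta> i, 1:])"
proof -
  from alg_closed_imp_factorization[OF assms] obtain A where
    A: "size A = degree f" "f = Polynomial.smult (lead_coeff f) (\<Prod>x\<in>#A. [:- x, 1:])" by blast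
  obtain xs where "mset xs = A" using ex_mset by blast
  then have "(\<Prod>x\<in>#A. [:- x, 1:]) = (\<Prod>i<degree f. [:- (xs ! i), 1:])"
    using A(1) prod_mset_prod_list[of "map (\<lambda>x. [:- x, 1:]) xs"]
    by (auto simp: prod.list_conv_set_nth lessThan_atLeast0)
  with A(2) that show ?thesis by metis
qed

text \<open>Poisson's formula by the Euclidean algorithm: \<open>f\<close> and
  \<open>f mod g\<close> agree at the roots of \<open>g\<close>, so the formula for \<open>g\<close>
  and \<open>f mod g\<close> turns into the one for \<open>f\<close> and \<open>g\<close> after
  swapping the roles of the roots.\<close>

lemma resultant_prod_roots_aux:
  fixes f g :: "'a::alg_closed_field poly" and n :: nat
  assumes "f = Polynomial.smult a (\<Prod>i<n. [:- \<zeta> i, 1:])" "a \<noteq> 0" "g \<noteq> 0" "degree g \<le> degree f"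
  shows "resultant f g = a ^ degree g * (\<Prod>i<n. poly g (\<zeta> i))"
  using assms
proof (induction "degree g" arbitrary: f g a n \<zeta> rule: less_induct)
  case less
  have n: "degree f = n" using less.prems(2) unfolding less.prems(1) degree_smult_prod_linear by simp
  obtain \<eta> where \<eta>: "g = Polynomial.smult (lead_coeff g) (\<Prod>j<degree g. [:- \<eta> j, 1:])"
    using alg_closed_linear_factors[OF less.prems(3)] .
  note swap = prod_over_roots_swap[OF less.prems(1) \<eta>]
  show ?case
  proof (cases "degree g = 0")
    case True
    then obtain b where "g = [:b:]" by (rule degree_eq_zeroE)
    then show ?thesis using n by simp
  next
    case False
    define H where "H = f mod g"
    have eq: "f + (- (f div g)) * g = H" unfolding H_def by (simp add: minus_div_mult_eq_mod[symmetric] )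
    have dH: "degree H < degree g" unfolding H_def using False degree_mod_less'[of g f] less.prems(3)
      by (cases "f mod g = 0") auto
    have root: "poly f (\<eta> j) = poly H (\<eta> j)" if "j < degree g" for j
    proof -
      have "poly g (\<eta> j) = 0" using that by (subst \<eta>) (auto simp: poly_prod)
      then show ?thesis by (simp flip: eq)
    qed
    have sr: "subresultant 0 f g = [:resultant f g:]" by (rule subresultant_resultant)
    have "resultant f g = (-1) ^ (n * degree g) * (lead_coeff g ^ n * (\<Prod>j<degree g. poly H (\<eta> j)))"
    \<comment> \<open>With a constant remainder the Euclidean sequence ends, and the resultant is
      read off as a power of that constant; this includes \<open>H = 0\<close>.\<close>
    proof (cases "degree H = 0")
      case True
      then obtain h where h: "H = [:h:]" by (rule degree_eq_zeroE)
      have "[:resultant f g:] = Polynomial.smult ((-1)^((degree f - degree H) * (degree g - degree H)) *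
          lead_coeff g ^ (degree f - degree H) * lead_coeff H ^ (degree g - degree H - 1)) H"
        using BT_lemma_1_13'[OF eq less.prems(4), of 0] dH sr True by auto
      then have "resultant f g = (-1)^(n * degree g) * lead_coeff g ^ n * h ^ (degree g - 1) * h"
        by (simp add: h n)
      also have "\<dots> = (-1)^(n * degree g) * (lead_coeff g ^ n * h ^ degree g)"
        using False by (cases "degree g") auto
      finally show ?thesis by (simp add: h)
    next
      case Hpos: False
      have "[:resultant f g:] = Polynomial.smult ((-1)^((degree f - 0) * (degree g - 0)) *
          lead_coeff g ^ (degree f - degree H)) (subresultant 0 g H)"
        unfolding sr[symmetric] using Hpos dH by (intro BT_lemma_1_12[OF eq less.prems(4)]) auto
      then have "resultant f g = (-1)^(n * degree g) * lead_coeff g ^ (n - degree H) * resultant g H"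
        by (simp add: subresultant_resultant n)
      also have "resultant g H = lead_coeff g ^ degree H * (\<Prod>j<degree g. poly H (\<eta> j))"
        using less.prems(3) dH Hpos by (intro less.hyps[OF dH \<eta>]) auto
      also have "(-1)^(n * degree g) * lead_coeff g ^ (n - degree H) * (lead_coeff g ^ degree H * (\<Prod>j<degree g. poly H (\<eta> j)))
        = (-1)^(n * degree g) * (lead_coeff g ^ (n - degree H + degree H) * (\<Prod>j<degree g. poly H (\<eta> j)))"
        unfolding power_add by simp
      finally show ?thesis using dH less.prems(4) n by simp
    qed
    then show ?thesis unfolding swap using root by simp
  qed
qed

theorem resultant_prod_roots:
  fixes f g :: "'a::alg_closed_field poly" and n :: nat
  assumes f: "f = Polynomial.smult a (\<Prod>i<n. [:- \<zeta> i, 1:])" and "a \<noteq> 0" "g \<noteq> 0"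
  shows "resultant f g = a ^ degree g * (\<Prod>i<n. poly g (\<zeta> i))"
proof (cases "degree g \<le> degree f")
  case True
  then show ?thesis using resultant_prod_roots_aux assms by blast
next
  case False
  have n: "degree f = n" "f \<noteq> 0" using assms degree_smult_prod_linear[of a \<zeta> n] by (auto simp: degree_smult_prod_linear)
  obtain \<eta> where \<eta>: "g = Polynomial.smult (lead_coeff g) (\<Prod>j<degree g. [:- \<eta> j, 1:])"
    using alg_closed_linear_factors[OF \<open>g \<noteq> 0\<close>] .
  have "resultant g f = lead_coeff g ^ degree f * (\<Prod>j<degree g. poly f (\<eta> j))"
    using False n \<open>g \<noteq> 0\<close> by (intro resultant_prod_roots_aux[OF \<eta>]) auto
  then show ?thesis
    unfolding resultant_swap[of f g] prod_over_roots_swap[OF f \<eta>] n by simp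
qed

section \<open>Roots of a trinomial\<close>

definition trinomial :: "nat \<Rightarrow> 'a \<Rightarrow> 'a \<Rightarrow> 'a \<Rightarrow> 'a::comm_ring_1 poly" where
  "trinomial a b0 b1 b2 = [:b0, b1:] + monom b2 a"

text \<open>The roots with multiplicity, in an order that depends on the coefficients of this
  trinomial only. Changing \<open>a_0\<close> or the coefficients of another \<open>F_i\<close>
  therefore leaves the numbering alone.\<close>

definition zeta :: "nat \<Rightarrow> complex \<Rightarrow> complex \<Rightarrow> complex \<Rightarrow> nat \<Rightarrow> complex" where
  "zeta a b0 b1 b2 = (SOME \<zeta>. trinomial a b0 b1 b2 = Polynomial.smult b2 (\<Prod>k<a. [:- \<zeta> k, 1:]))"

lemma coeff_trinomial: "a \<ge> 2 \<Longrightarrow> coeff (trinomial a b0 b1 b2) a = b2"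
  and coeff_trinomial_gt: "a \<ge> 2 \<Longrightarrow> i > a \<Longrightarrow> coeff (trinomial a b0 b1 b2) i = 0"
  by (auto simp: trinomial_def coeff_pCons split: nat.splits)

lemma degree_trinomial: "a \<ge> 2 \<Longrightarrow> b2 \<noteq> 0 \<Longrightarrow> degree (trinomial a b0 b1 b2) = a"
  by (rule antisym[OF degree_le le_degree]) (simp_all add: coeff_trinomial coeff_trinomial_gt)

context
  fixes a :: nat and b0 b1 b2 :: complex
  assumes a: "a \<ge> 2" and b2: "b2 \<noteq> 0"
begin

lemma trinomial_eq_prod_zeta:
  "trinomial a b0 b1 b2 = Polynomial.smult b2 (\<Prod>k<a. [:- zeta a b0 b1 b2 k, 1:])"
proof -
  have "trinomial a b0 b1 b2 \<noteq> 0" using degree_trinomial[OF a b2, of b0 b1] a by auto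
  from alg_closed_linear_factors[OF this] obtain \<zeta> where
    "trinomial a b0 b1 b2 = Polynomial.smult (lead_coeff (trinomial a b0 b1 b2))
       (\<Prod>i<degree (trinomial a b0 b1 b2). [:- \<zeta> i, 1:])" .
  then have "trinomial a b0 b1 b2 = Polynomial.smult b2 (\<Prod>k<a. [:- \<zeta> k, 1:])"
    unfolding degree_trinomial[OF a b2] coeff_trinomial[OF a] .
  then show ?thesis unfolding zeta_def 
    by (rule someI[where P = "\<lambda>\<zeta>. trinomial a b0 b1 b2 = Polynomial.smult b2 (\<Prod>k<a. [:- \<zeta> k, 1:])"])
qed

lemma trinomial_value: "b0 + b1 * z + b2 * z ^ a = b2 * (\<Prod>k<a. z - zeta a b0 b1 b2 k)"
  using arg_cong[OF trinomial_eq_prod_zeta, of "\<lambda>p. poly p z"]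
  by (simp add: trinomial_def poly_monom poly_prod algebra_simps)

lemma zeta_root: "k < a \<Longrightarrow> b0 + b1 * zeta a b0 b1 b2 k + b2 * zeta a b0 b1 b2 k ^ a = 0"
  unfolding trinomial_value by auto

lemma root_imp_zeta: "b0 + b1 * z + b2 * z ^ a = 0 \<Longrightarrow> \<exists>k<a. z = zeta a b0 b1 b2 k"
  unfolding trinomial_value using b2 by auto

lemma zeta_nonzero: "b0 \<noteq> 0 \<Longrightarrow> k < a \<Longrightarrow> zeta a b0 b1 b2 k \<noteq> 0"
  using zeta_root[of k] a by (auto simp: power_0_left)

lemma prod_zeta: "b2 * (\<Prod>k<a. zeta a b0 b1 b2 k) = (-1) ^ a * b0"
proof -
  define Q where "Q = (\<Prod>k<a. zeta a b0 b1 b2 k)"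
  have "b0 = b2 * ((-1) ^ a * Q)"
    using trinomial_value[of 0] a by (simp add: power_0_left prod_uminus Q_def)
  then have "(-1) ^ a * b0 = ((-1) ^ a * (-1) ^ a) * (b2 * Q)" by simp
  also have "(-1) ^ a * (-1) ^ a = (1::complex)" unfolding power_mult_distrib[symmetric] by simp
  finally show ?thesis by (simp add: Q_def)
qed

end

section \<open>The resultant as an iterated norm\<close>

definition zt :: "('n \<Rightarrow> nat) \<Rightarrow> ('n qvar \<Rightarrow> complex) \<Rightarrow> 'n \<Rightarrow> nat \<Rightarrow> complex" where
  "zt \<alpha> c i = zeta (\<alpha> i) (c (B0 i)) (c (B1 i)) (c (B2 i))"

abbreviation root_choices :: "('n \<Rightarrow> nat) \<Rightarrow> 'n set \<Rightarrow> ('n \<Rightarrow> nat) set" where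
  "root_choices \<alpha> T \<equiv> PiE T (\<lambda>i. {..<\<alpha> i})"

lemma prod_root_choices_insert:
  assumes "finite T" "k \<notin> T"
  shows "(\<Prod>f\<in>root_choices \<alpha> (insert k T). h (f k) (\<lambda>i\<in>T. f i)) = (\<Prod>l<\<alpha> k. \<Prod>f\<in>root_choices \<alpha> T. h l f)"
proof -
  have inj: "inj_on (\<lambda>(y, g). g(k := y)) ({..<\<alpha> k} \<times> root_choices \<alpha> T)"
    by (rule inj_combinator[OF assms(2)])
  have "(\<Prod>f\<in>root_choices \<alpha> (insert k T). h (f k) (\<lambda>i\<in>T. f i))
      = (\<Prod>(y, g)\<in>{..<\<alpha> k} \<times> root_choices \<alpha> T. h ((g(k := y)) k) (\<lambda>i\<in>T. (g(k := y)) i))"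
    unfolding PiE_insert_eq prod.reindex[OF inj] by (simp add: case_prod_unfold fun_upd_def)
  also have "\<dots> = (\<Prod>(y, g)\<in>{..<\<alpha> k} \<times> root_choices \<alpha> T. h y g)"
  proof (intro prod.cong refl, clarify)
    fix y g assume g: "g \<in> root_choices \<alpha> T"
    then have "(\<lambda>i\<in>T. (g(k := y)) i) = g" using assms(2) by (auto simp: fun_eq_iff restrict_def PiE_def extensional_def)
    then show "h ((g(k := y)) k) (\<lambda>i\<in>T. (g(k := y)) i) = h y g" by simp
  qed
  finally show ?thesis by (simp add: prod.cartesian_product)
qed

lemma poly_eqI_nonzero:
  fixes p q :: "complex poly"
  assumes "\<And>x. x \<noteq> 0 \<Longrightarrow> poly p x = poly q x"
  shows "p = q"
proof (rule ccontr)
  assume "p \<noteq> q"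
  then have "finite {x. poly (p - q) x = 0}" by (intro poly_roots_finite) simp
  moreover have "UNIV - {0} \<subseteq> {x. poly (p - q) x = 0}" using assms by auto
  ultimately have "finite (UNIV - {0 :: complex})" using finite_subset by blast
  then show False using infinite_UNIV_char_0[where 'a = complex] by simp
qed

text \<open>Adjoining the variable of \<open>F\<^sub>k\<close> means taking the resultant, with respect to \<open>u\<close>, of \<open>F\<^sub>k(u)\<close> and
  of the polynomial constructed so far with \<open>a\<^sub>1\<close> replaced by \<open>a\<^sub>1 u\<close>.\<close>

lemma exists_norm_polynomial:
  fixes \<alpha> :: "'n::finite \<Rightarrow> nat"
  assumes \<alpha>: "\<And>i. \<alpha> i \<ge> 2"
  shows "\<exists>D :: ('n qvar, int) mpoly. \<forall>c. (\<forall>v. v \<noteq> A0 \<longrightarrow> c v \<noteq> 0) \<longrightarrow>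
    subst c D = (\<Prod>i\<in>T. c (B2 i) ^ (\<Prod>j\<in>T - {i}. \<alpha> j)) *
      (\<Prod>f\<in>root_choices \<alpha> T. c A0 + c A1 * (\<Prod>i\<in>T. zt \<alpha> c i (f i)))"
proof -
  have "finite T" by simp
  then show ?thesis
  proof (induction T rule: finite_induct)
    case empty
    show ?case by (rule exI[of _ "Var A0 + Var A1"]) (simp add: subst_hom.hom_add)
  next
    case (insert k T)
    from insert.IH obtain D :: "('n qvar, int) mpoly" where D: "\<forall>c. (\<forall>v. v \<noteq> A0 \<longrightarrow> c v \<noteq> 0) \<longrightarrow>
      subst c D = (\<Prod>i\<in>T. c (B2 i) ^ (\<Prod>j\<in>T - {i}. \<alpha> j)) *
        (\<Prod>f\<in>root_choices \<alpha> T. c A0 + c A1 * (\<Prod>i\<in>T. zt \<alpha> c i (f i)))" ..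
    define G :: "('n qvar, int) mpoly poly" where
      "G = subst (\<lambda>v. if v = A1 then [:0, Var A1:] else [:Var v:]) D"
    define F :: "('n qvar, int) mpoly poly" where
      "F = trinomial (\<alpha> k) (Var (B0 k)) (Var (B1 k)) (Var (B2 k))"
    define N where "N = (\<Prod>j\<in>T. \<alpha> j)"
    define B where "B c = (\<Prod>i\<in>T. c (B2 i) ^ (\<Prod>j\<in>T - {i}. \<alpha> j))" for c :: "'n qvar \<Rightarrow> complex"
    define \<theta> where "\<theta> c f = (\<Prod>i\<in>T. zt \<alpha> c i (f i))" for c f
    have fin: "finite (root_choices \<alpha> T)" by (intro finite_PiE insert.hyps) auto
    have card: "card (root_choices \<alpha> T) = N" unfolding N_def by (subst card_PiE) (auto simp: insert.hyps)
    have mapF: "map_poly (subst c) F = trinomial (\<alpha> k) (c (B0 k)) (c (B1 k)) (c (B2 k))" for c :: "'n qvar \<Rightarrow> complex"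
    proof -
      interpret map_poly_comm_ring_hom "subst c" ..
      show ?thesis by (simp add: F_def trinomial_def hom_distribs)
    qed
    have degF: "degree F = \<alpha> k" unfolding F_def by (intro degree_trinomial \<alpha> Var_neq_0)
    have pG: "poly (map_poly (subst c) G) u = subst (c(A1 := c A1 * u)) D" for c :: "'n qvar \<Rightarrow> complex" and u
    proof -
      interpret map_poly_comm_ring_hom "subst c" ..
      show ?thesis
        unfolding G_def hom_subst[OF comm_ring_hom_axioms]
          hom_subst[where h = "\<lambda>q. poly q u", OF poly_hom.comm_ring_hom_axioms]
        by (rule arg_cong[of _ _ "\<lambda>f. subst f D"]) (auto simp: fun_eq_iff hom_distribs)
    qed
    have mapG: "map_poly (subst c) G = Polynomial.smult (B c) (\<Prod>f\<in>root_choices \<alpha> T. [:c A0, c A1 * \<theta> c f:])"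
      and mapG_nz: "B c \<noteq> 0" "f \<in> root_choices \<alpha> T \<Longrightarrow> c A1 * \<theta> c f \<noteq> 0"
      if c: "\<forall>v. v \<noteq> A0 \<longrightarrow> c v \<noteq> 0" for c :: "'n qvar \<Rightarrow> complex" and f
    proof -
      show "map_poly (subst c) G = Polynomial.smult (B c) (\<Prod>f\<in>root_choices \<alpha> T. [:c A0, c A1 * \<theta> c f:])"
      \<comment> \<open>The induction hypothesis is applied at the point with \<open>a_1\<close>
        replaced by \<open>a_1 u\<close>, which must be nonzero.\<close>
      proof (rule poly_eqI_nonzero)
        fix u :: complex assume u: "u \<noteq> 0"
        have "poly (map_poly (subst c) G) u = subst (c(A1 := c A1 * u)) D" by (rule pG)
        also have "\<dots> = B c * (\<Prod>f\<in>root_choices \<alpha> T. c A0 + c A1 * u * \<theta> c f)"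
          using c u by (subst D[rule_format]) (auto simp: B_def \<theta>_def zt_def)
        also have "\<dots> = poly (Polynomial.smult (B c) (\<Prod>f\<in>root_choices \<alpha> T. [:c A0, c A1 * \<theta> c f:])) u"
          by (simp add: poly_prod mult_ac)
        finally show "poly (map_poly (subst c) G) u = poly (Polynomial.smult (B c) (\<Prod>f\<in>root_choices \<alpha> T. [:c A0, c A1 * \<theta> c f:])) u" .
      qed
      show "B c \<noteq> 0" using c by (simp add: B_def)
      show "c A1 * \<theta> c f \<noteq> 0" if "f \<in> root_choices \<alpha> T"
        using c that zeta_nonzero[OF \<alpha>] by (auto simp: \<theta>_def zt_def PiE_iff insert.hyps)
    qed
    have deg_mapG: "degree (map_poly (subst c) G) = N" if "\<forall>v. v \<noteq> A0 \<longrightarrow> c v \<noteq> 0" for c :: "'n qvar \<Rightarrow> complex"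
      unfolding mapG[OF that] card[symmetric] using mapG_nz[OF that]
      by (simp add: degree_prod_eq_sum_degree)
    \<comment> \<open>For the resultant to commute with evaluation the degrees must be kept. The
      degree of \<open>G\<close>, hidden in its construction, is recovered from values: the
      coefficients above \<open>N\<close> vanish at all points with nonzero coordinates, and the
      \<open>N\<close>-th one does not vanish where all coordinates are 1.\<close>
    have degG: "degree G = N"
    proof (rule antisym[OF degree_le le_degree])
      show "\<forall>i>N. coeff G i = 0"
      proof (intro allI impI)
        fix i assume i: "i > N"
        show "coeff G i = 0"
        proof (rule mpoly_eqI)
          fix c :: "'n qvar \<Rightarrow> complex" assume "\<And>v. c v \<noteq> 0"
          then have "coeff (map_poly (subst c) G) i = 0" using deg_mapG[of c] i by (intro coeff_eq_0) simp
          then show "subst c (coeff G i) = subst c 0" by simp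
        qed
      qed
      have "map_poly (subst (\<lambda>_. 1 :: complex)) G \<noteq> 0"
        using mapG[of "\<lambda>_. 1"] mapG_nz[of "\<lambda>_. 1"] fin by (auto simp: prod_zero_iff)
      then have "coeff (map_poly (subst (\<lambda>_. 1 :: complex)) G) N \<noteq> 0"
        using deg_mapG[of "\<lambda>_. 1"] by (metis leading_coeff_0_iff one_neq_zero)
      then show "coeff G N \<noteq> 0" by auto
    qed
    show ?case
    proof (intro exI[of _ "resultant F G"] allI impI)
      fix c :: "'n qvar \<Rightarrow> complex" assume c: "\<forall>v. v \<noteq> A0 \<longrightarrow> c v \<noteq> 0"
      note nz = mapG_nz[OF c]
      have b2: "c (B2 k) \<noteq> 0" using c by simp
      have Gnz: "map_poly (subst c) G \<noteq> 0" unfolding mapG[OF c] using nz fin by (auto simp: prod_zero_iff)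
      have "subst c (resultant F G) = resultant (map_poly (subst c) F) (map_poly (subst c) G)"
        using degF degG deg_mapG[OF c] degree_trinomial[OF \<alpha> b2]
        by (intro subst_hom.resultant_map_poly[symmetric]) (simp_all add: mapF)
      also have "\<dots> = c (B2 k) ^ N * (\<Prod>l<\<alpha> k. poly (map_poly (subst c) G) (zt \<alpha> c k l))"
        unfolding mapF deg_mapG[OF c, symmetric] zt_def
        by (rule resultant_prod_roots[OF trinomial_eq_prod_zeta[OF \<alpha> b2] b2 Gnz])
      also have "(\<Prod>l<\<alpha> k. poly (map_poly (subst c) G) (zt \<alpha> c k l))
          = B c ^ \<alpha> k * (\<Prod>l<\<alpha> k. \<Prod>f\<in>root_choices \<alpha> T. c A0 + c A1 * (zt \<alpha> c k l * \<theta> c f))"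
        unfolding mapG[OF c] by (simp add: poly_prod prod.distrib mult_ac)
      also have "(\<Prod>l<\<alpha> k. \<Prod>f\<in>root_choices \<alpha> T. c A0 + c A1 * (zt \<alpha> c k l * \<theta> c f))
          = (\<Prod>f\<in>root_choices \<alpha> (insert k T). c A0 + c A1 * (zt \<alpha> c k (f k) * \<theta> c (\<lambda>i\<in>T. f i)))"
        by (rule prod_root_choices_insert[symmetric]) (use insert.hyps in auto)
      also have "\<dots> = (\<Prod>f\<in>root_choices \<alpha> (insert k T). c A0 + c A1 * (\<Prod>i\<in>insert k T. zt \<alpha> c i (f i)))"
        using insert.hyps by (simp add: \<theta>_def cong: prod.cong)
      also have "c (B2 k) ^ N * (B c ^ \<alpha> k * (\<Prod>f\<in>root_choices \<alpha> (insert k T). c A0 + c A1 * (\<Prod>i\<in>insert k T. zt \<alpha> c i (f i))))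
          = (c (B2 k) ^ N * B c ^ \<alpha> k) * (\<Prod>f\<in>root_choices \<alpha> (insert k T). c A0 + c A1 * (\<Prod>i\<in>insert k T. zt \<alpha> c i (f i)))"
        by (rule mult.assoc[symmetric])
      also have "c (B2 k) ^ N * B c ^ \<alpha> k = (\<Prod>i\<in>insert k T. c (B2 i) ^ (\<Prod>j\<in>insert k T - {i}. \<alpha> j))"
      proof -
        have "(\<Prod>j\<in>insert k T - {i}. \<alpha> j) = (\<Prod>j\<in>T - {i}. \<alpha> j) * \<alpha> k" if "i \<in> T" for i
        proof -
          have "insert k T - {i} = insert k (T - {i})" using that insert.hyps by auto
          then show ?thesis using insert.hyps by simp
        qed
        moreover have "insert k T - {k} = T" using insert.hyps by auto
        ultimately show ?thesis
          using insert.hyps by (simp add: N_def B_def prod_power_distrib power_mult)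
      qed
      finally show "subst c (resultant F G) = (\<Prod>i\<in>insert k T. c (B2 i) ^ (\<Prod>j\<in>insert k T - {i}. \<alpha> j)) *
        (\<Prod>f\<in>root_choices \<alpha> (insert k T). c A0 + c A1 * (\<Prod>i\<in>insert k T. zt \<alpha> c i (f i)))" .
    qed
  qed
qed

section \<open>Generic coefficients give distinct products of roots\<close>

definition rootprod :: "('n \<Rightarrow> nat) \<Rightarrow> 'n set \<Rightarrow> ('n qvar \<Rightarrow> complex) \<Rightarrow> ('n \<Rightarrow> nat) \<Rightarrow> complex" where
  "rootprod \<alpha> T c f = (\<Prod>i\<in>T. zt \<alpha> c i (f i))"

lemma pderiv_double_root:
  fixes z :: "'a::idom"
  assumes "finite I" "l \<in> I" "l' \<in> I" "l \<noteq> l'" "\<zeta> l = z" "\<zeta> l' = z"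
  shows "poly (pderiv (Polynomial.smult b (\<Prod>k\<in>I. [:- \<zeta> k, 1:]))) z = 0"
proof -
  define L where "L = [:- z, 1:]"
  have "(\<Prod>k\<in>I. [:- \<zeta> k, 1:]) = L * (L * (\<Prod>k\<in>I - {l} - {l'}. [:- \<zeta> k, 1:]))"
    unfolding L_def using assms by (subst prod.remove[of I l], simp, simp, subst prod.remove[of "I - {l}" l']) auto
  moreover have "poly L z = 0" by (simp add: L_def)
  ultimately show ?thesis by (simp add: pderiv_smult pderiv_mult)
qed

text \<open>If two roots of \<open>F = b\<^sub>0 + b\<^sub>1 z + x z\<^sup>a\<close> have ratio \<open>t\<close>, then \<open>t\<^sup>a F(z) - F(tz)\<close>, respectively
  \<open>a F(z) - z F'(z)\<close> if \<open>t = 1\<close>, is a nonzero linear polynomial independent of \<open>x\<close>. So \<open>t\<close>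
  determines \<open>z\<close> and \<open>x\<close>.\<close>

lemma finite_bad_leading_coeffs:
  fixes b0 b1 :: complex
  assumes a: "a \<ge> 2" and b: "b0 \<noteq> 0" "b1 \<noteq> 0" and "finite Q"
  shows "finite {x. x \<noteq> 0 \<and> (\<exists>l<a. \<exists>l'<a. l \<noteq> l' \<and> (\<exists>t\<in>Q. zeta a b0 b1 x l' = t * zeta a b0 b1 x l))}"
proof -
  define zz where "zz t = (if t = 1 then - of_nat a * b0 / ((of_nat a - 1) * b1) else - b0 * (t ^ a - 1) / (b1 * (t ^ a - t)))" for t
  define xx where "xx z = - (b0 + b1 * z) / z ^ a" for z
  have "x \<in> (\<lambda>t. xx (zz t)) ` Q"
    if x: "x \<noteq> 0" and l: "l < a" "l' < a" "l \<noteq> l'" and t: "t \<in> Q" and eq: "zeta a b0 b1 x l' = t * zeta a b0 b1 x l"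
    for x l l' t
  proof -
    define z where "z = zeta a b0 b1 x l"
    have z0: "z \<noteq> 0" using zeta_nonzero[OF a x b(1) l(1)] by (simp add: z_def)
    have F: "b0 + b1 * z + x * z ^ a = 0" using zeta_root[OF a x l(1)] by (simp add: z_def)
    have Ft: "b0 + b1 * (t * z) + x * (t * z) ^ a = 0"
      using zeta_root[OF a x l(2), of b0 b1] eq by (simp add: z_def)
    have "x = xx z" using F z0 by (simp add: xx_def eq_divide_eq add_eq_0_iff)
    moreover have "z = zz t"
    proof (cases "t = 1")
      case True
      have "poly (pderiv (trinomial a b0 b1 x)) z = 0"
        unfolding trinomial_eq_prod_zeta[OF a x]
        by (rule pderiv_double_root[of _ l l']) (use l eq True in \<open>auto simp: z_def\<close>)
      then have "b1 + of_nat a * x * z ^ (a - 1) = 0"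
        by (simp add: trinomial_def pderiv_add pderiv_pCons pderiv_monom poly_monom mult_ac)
      then have "z * (b1 + of_nat a * x * z ^ (a - 1)) = 0" by simp
      moreover have "z ^ a = z * z ^ (a - 1)" using a by (cases a) auto
      ultimately have "b1 * z + of_nat a * (x * z ^ a) = 0" by (simp add: distrib_left mult_ac)
      moreover have "x * z ^ a = - b0 - b1 * z" using F by (simp add: algebra_simps add_eq_0_iff)
      ultimately have "z * ((of_nat a - 1) * b1) = - of_nat a * b0" by (simp add: algebra_simps)
      moreover have "(of_nat a - 1) * b1 \<noteq> 0" using a b by simp
      ultimately have "z = - of_nat a * b0 / ((of_nat a - 1) * b1)" by (simp only: eq_divide_eq if_True not_False_eq_True)
      then show ?thesis using True by (simp add: zz_def)
    next
      case False
      have "t ^ a * (b0 + b1 * z + x * z ^ a) - (b0 + b1 * (t * z) + x * (t * z) ^ a) = 0"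
        unfolding F Ft by simp
      then have *: "b0 * (t ^ a - 1) + z * (b1 * (t ^ a - t)) = 0"
        by (simp add: power_mult_distrib algebra_simps)
      \<comment> \<open>If \<open>t ^ a = t\<close>, the equation would reduce to
        \<open>b0 * (t - 1) = 0\<close>.\<close>
      have "t ^ a \<noteq> t" using * False b by auto
      then have "b1 * (t ^ a - t) \<noteq> 0" using b by simp
      moreover have "z * (b1 * (t ^ a - t)) = - b0 * (t ^ a - 1)" using * by (simp add: add_eq_0_iff)
      ultimately have "z = - b0 * (t ^ a - 1) / (b1 * (t ^ a - t))" by (simp only: eq_divide_eq if_True not_False_eq_True)
      then show ?thesis using False by (simp add: zz_def)
    qed
    ultimately show ?thesis using t by blast
  qed
  then have "{x. x \<noteq> 0 \<and> (\<exists>l<a. \<exists>l'<a. l \<noteq> l' \<and> (\<exists>t\<in>Q. zeta a b0 b1 x l' = t * zeta a b0 b1 x l))}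
      \<subseteq> (\<lambda>t. xx (zz t)) ` Q" by blast
  then show ?thesis by (rule finite_subset) (use \<open>finite Q\<close> in simp)
qed

context
  fixes \<alpha> :: "'n::finite \<Rightarrow> nat"
  assumes \<alpha>: "\<And>i. \<alpha> i \<ge> 2"
begin

lemma zt_nonzero: "c (B2 i) \<noteq> 0 \<Longrightarrow> c (B0 i) \<noteq> 0 \<Longrightarrow> k < \<alpha> i \<Longrightarrow> zt \<alpha> c i k \<noteq> 0"
  unfolding zt_def by (rule zeta_nonzero[OF \<alpha>])

lemma rootprod_nonzero:
  "\<forall>v. v \<noteq> A0 \<longrightarrow> c v \<noteq> 0 \<Longrightarrow> f \<in> root_choices \<alpha> T \<Longrightarrow> rootprod \<alpha> T c f \<noteq> 0"
  by (auto simp: rootprod_def PiE_iff zt_nonzero)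

text \<open>The set \<open>U\<close> holds the variables that have already received a value; the
  products run only over the trinomials whose leading coefficient is among them.\<close>

definition distinct_coeffs :: "'n qvar set \<Rightarrow> ('n qvar \<Rightarrow> complex) \<Rightarrow> bool" where
  "distinct_coeffs U c \<longleftrightarrow> (\<forall>v\<in>U. c v \<noteq> 0) \<and>
     inj_on (rootprod \<alpha> {i. B2 i \<in> U} c) (root_choices \<alpha> {i. B2 i \<in> U})"

text \<open>If two products over \<open>insert k T\<close> agree, either the roots of
  \<open>F_k\<close> in them have the same index and cancel, or their ratio is a quotient of two
  products over \<open>T\<close>. There are finitely many such quotients, and each is a ratio of two
  roots for only finitely many values of \<open>b_{k,2}\<close>.\<close>

lemma finite_not_distinct_coeffs:
  assumes U: "\<And>i. B0 i \<in> U \<and> B1 i \<in> U" and k: "B2 k \<notin> U" and c: "distinct_coeffs U c"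
  shows "finite {x. \<not> distinct_coeffs (insert (B2 k) U) (c(B2 k := x))}"
proof -
  define T where "T = {i. B2 i \<in> U}"
  have kT: "k \<notin> T" and T': "{i. B2 i \<in> insert (B2 k) U} = insert k T" using k by (auto simp: T_def)
  have nz: "\<And>v. v \<in> U \<Longrightarrow> c v \<noteq> 0" and inj: "inj_on (rootprod \<alpha> T c) (root_choices \<alpha> T)"
    using c by (auto simp: distinct_coeffs_def T_def)
  have b: "c (B0 k) \<noteq> 0" "c (B1 k) \<noteq> 0" using U nz by auto
  define Q where "Q = (\<lambda>(g, g'). rootprod \<alpha> T c g / rootprod \<alpha> T c g') ` (root_choices \<alpha> T \<times> root_choices \<alpha> T)"
  have finQ: "finite Q" unfolding Q_def by (intro finite_imageI finite_cartesian_product finite_PiE) auto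
  have rp0: "rootprod \<alpha> T c g \<noteq> 0" if "g \<in> root_choices \<alpha> T" for g
    using that U nz by (auto simp: rootprod_def PiE_iff T_def zt_nonzero)
  have "x = 0 \<or> (\<exists>l<\<alpha> k. \<exists>l'<\<alpha> k. l \<noteq> l' \<and> (\<exists>t\<in>Q. zeta (\<alpha> k) (c (B0 k)) (c (B1 k)) x l' = t * zeta (\<alpha> k) (c (B0 k)) (c (B1 k)) x l))"
    if bad: "\<not> distinct_coeffs (insert (B2 k) U) (c(B2 k := x))" for x
  proof (rule disjCI)
    assume nex: "\<not> (\<exists>l<\<alpha> k. \<exists>l'<\<alpha> k. l \<noteq> l' \<and> (\<exists>t\<in>Q. zeta (\<alpha> k) (c (B0 k)) (c (B1 k)) x l' = t * zeta (\<alpha> k) (c (B0 k)) (c (B1 k)) x l))"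
    show "x = 0"
    proof (rule ccontr)
      assume x: "x \<noteq> 0"
      define c' where "c' = c(B2 k := x)"
      define Z where "Z = zeta (\<alpha> k) (c (B0 k)) (c (B1 k)) x"
      have Znz: "Z l \<noteq> 0" if "l < \<alpha> k" for l unfolding Z_def by (rule zeta_nonzero[OF \<alpha> x b(1) that])
      have rp: "rootprod \<alpha> (insert k T) c' f = Z (f k) * rootprod \<alpha> T c (restrict f T)" for f
      proof -
        have "(\<Prod>i\<in>T. zt \<alpha> c' i (f i)) = (\<Prod>i\<in>T. zt \<alpha> c i (restrict f T i))"
          using kT by (intro prod.cong) (auto simp: c'_def zt_def)
        then show ?thesis using kT by (simp add: rootprod_def) (simp add: zt_def c'_def Z_def)
      qed
      have "inj_on (rootprod \<alpha> (insert k T) c') (root_choices \<alpha> (insert k T))"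
      proof (rule inj_onI)
        fix f f' assume f: "f \<in> root_choices \<alpha> (insert k T)" "f' \<in> root_choices \<alpha> (insert k T)"
          and eq: "rootprod \<alpha> (insert k T) c' f = rootprod \<alpha> (insert k T) c' f'"
        have r: "restrict f T \<in> root_choices \<alpha> T" "restrict f' T \<in> root_choices \<alpha> T" using f by auto
        have l: "f k < \<alpha> k" "f' k < \<alpha> k" using f by auto
        have "f k = f' k"
        proof (rule ccontr)
          assume ne: "f k \<noteq> f' k"
          have "Z (f' k) = (rootprod \<alpha> T c (restrict f T) / rootprod \<alpha> T c (restrict f' T)) * Z (f k)"
            using eq rp0[OF r(2)] unfolding rp by (simp add: field_simps)
          moreover have "rootprod \<alpha> T c (restrict f T) / rootprod \<alpha> T c (restrict f' T) \<in> Q"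
            unfolding Q_def using r by force
          ultimately show False using nex ne l unfolding Z_def by blast
        qed
        then have "rootprod \<alpha> T c (restrict f T) = rootprod \<alpha> T c (restrict f' T)"
          using eq Znz[OF l(1)] unfolding rp by simp
        then have "restrict f T = restrict f' T" using inj r by (meson inj_onD)
        then have "f i = f' i" if "i \<in> T" for i using that by (metis restrict_apply')
        with \<open>f k = f' k\<close> show "f = f'" using f by (intro PiE_ext[of f _ _ f']) auto
      qed
      then have "distinct_coeffs (insert (B2 k) U) c'"
        unfolding distinct_coeffs_def T' using nz x by (auto simp: c'_def)
      with bad show False by (simp add: c'_def)
    qed
  qed
  then have "{x. \<not> distinct_coeffs (insert (B2 k) U) (c(B2 k := x))} \<subseteq> insert 0
     {x. x \<noteq> 0 \<and> (\<exists>l<\<alpha> k. \<exists>l'<\<alpha> k. l \<noteq> l' \<and> (\<exists>t\<in>Q. zeta (\<alpha> k) (c (B0 k)) (c (B1 k)) x l' = t * zeta (\<alpha> k) (c (B0 k)) (c (B1 k)) x l))}"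
    by blast
  then show ?thesis
    by (rule finite_subset) (use finite_bad_leading_coeffs[OF \<alpha> b finQ] in simp)
qed

lemma exists_distinct_coeffs:
  fixes p :: "('n qvar, int) mpoly"
  assumes "p \<noteq> 0"
  shows "\<exists>c. subst c p \<noteq> 0 \<and> distinct_coeffs UNIV c"
proof -
  \<comment> \<open>The variables other than the \<open>b_{i,2}\<close> receive their values first,
    so that \<open>F_k\<close> has fixed nonzero lower coefficients when its leading coefficient is
    chosen.\<close>
  define U where "U = - range (B2 :: 'n \<Rightarrow> 'n qvar)"
  have U: "B0 i \<in> U" "B1 i \<in> U" "B2 i \<notin> U" for i by (auto simp: U_def)
  have "\<exists>c. subst c q \<noteq> 0 \<and> distinct_coeffs (U \<union> B2 ` T) c"
    if "q \<noteq> 0" "vars q \<subseteq> U \<union> B2 ` T" for q :: "('n qvar, int) mpoly" and T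
  proof -
    have "finite T" by simp
    then show ?thesis using that
    proof (induction T arbitrary: q rule: finite_induct)
      case empty
      have U0: "distinct_coeffs V c \<longleftrightarrow> (\<forall>v\<in>V. c v \<noteq> 0)" if "V \<subseteq> U" for V c
      proof -
        have "{i. B2 i \<in> V} = {}" using that U(3) by blast
        then show ?thesis by (simp add: distinct_coeffs_def)
      qed
      show ?case
      proof (rule exists_generic)
        fix V v and c :: "'n qvar \<Rightarrow> complex"
        assume V: "v \<notin> V" "insert v V \<subseteq> U \<union> B2 ` {}" "distinct_coeffs V c"
        then have "{x. \<not> distinct_coeffs (insert v V) (c(v := x))} \<subseteq> {0}" using U0[of V] U0[of "insert v V"] by auto
        then show "finite {x. \<not> distinct_coeffs (insert v V) (c(v := x))}" by (rule finite_subset) simp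
      qed (use empty U0 in auto)
    next
      case (insert k T)
      have *: "U \<union> B2 ` insert k T = insert (B2 k) (U \<union> B2 ` T)" by auto
      show ?case unfolding *
      proof (rule exists_generic_extension)
        show "finite {x. \<not> distinct_coeffs (insert (B2 k) (U \<union> B2 ` T)) (c(B2 k := x))}"
          if "distinct_coeffs (U \<union> B2 ` T) c" for c
          using U insert.hyps by (intro finite_not_distinct_coeffs[OF _ _ that]) auto
      qed (use insert * in auto)
    qed
  qed
  from this[OF assms, of UNIV] show ?thesis by (simp add: U_def)
qed

subsection \<open>The norm polynomial is the quiver resultant\<close>

abbreviation Pj :: "'n \<Rightarrow> nat" where "Pj i \<equiv> \<Prod>j\<in>UNIV - {i}. \<alpha> j"

definition norm_poly :: "('n qvar, int) mpoly" where
  "norm_poly = (SOME D. \<forall>c. (\<forall>v. v \<noteq> A0 \<longrightarrow> c v \<noteq> 0) \<longrightarrow>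
    subst c D = (\<Prod>i\<in>UNIV. c (B2 i) ^ Pj i) *
      (\<Prod>f\<in>root_choices \<alpha> UNIV. c A0 + c A1 * (\<Prod>i\<in>UNIV. zt \<alpha> c i (f i))))"

lemma norm_poly:
  assumes "\<forall>v. v \<noteq> A0 \<longrightarrow> c v \<noteq> 0"
  shows "subst c norm_poly = (\<Prod>i\<in>UNIV. c (B2 i) ^ Pj i) *
      (\<Prod>f\<in>root_choices \<alpha> UNIV. c A0 + c A1 * rootprod \<alpha> UNIV c f)"
  using someI_ex[OF exists_norm_polynomial[where \<alpha> = \<alpha> and T = UNIV, OF \<alpha>], folded norm_poly_def] assms
  unfolding rootprod_def by blast

lemma rootprod_upd_A0: "rootprod \<alpha> T (c(A0 := x)) = rootprod \<alpha> T c"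
  by (simp add: rootprod_def zt_def fun_eq_iff)

lemma finite_choices: "finite (root_choices \<alpha> (UNIV :: 'n set))"
  by (intro finite_PiE) auto

lemma card_choices: "card (root_choices \<alpha> (UNIV :: 'n set)) = (\<Prod>i\<in>UNIV. \<alpha> i)"
  by (simp add: card_PiE)

lemma uni_eval_norm_poly:
  assumes c: "\<forall>v. v \<noteq> A0 \<longrightarrow> c v \<noteq> 0"
  shows "uni_eval c A0 norm_poly = Polynomial.smult (\<Prod>i\<in>UNIV. c (B2 i) ^ Pj i)
     (\<Prod>f\<in>root_choices \<alpha> UNIV. [:c A1 * rootprod \<alpha> UNIV c f, 1:])"
proof (rule poly_eqI_nonzero)
  fix x :: complex
  show "poly (uni_eval c A0 norm_poly) x = poly (Polynomial.smult (\<Prod>i\<in>UNIV. c (B2 i) ^ Pj i)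
     (\<Prod>f\<in>root_choices \<alpha> UNIV. [:c A1 * rootprod \<alpha> UNIV c f, 1:])) x"
    unfolding poly_uni_eval using c by (subst norm_poly) (auto simp: rootprod_upd_A0 poly_prod add.commute)
qed

lemma degree_norm_poly_eval:
  assumes c: "\<forall>v. v \<noteq> A0 \<longrightarrow> c v \<noteq> 0"
  shows "degree (uni_eval c A0 norm_poly) = (\<Prod>i\<in>UNIV. \<alpha> i)"
    and "coeff (uni_eval c A0 norm_poly) (\<Prod>i\<in>UNIV. \<alpha> i) = (\<Prod>i\<in>UNIV. c (B2 i) ^ Pj i)"
proof -
  let ?p = "\<Prod>f\<in>root_choices \<alpha> UNIV. [:c A1 * rootprod \<alpha> UNIV c f, 1:]"
  have B: "(\<Prod>i\<in>UNIV. c (B2 i) ^ Pj i) \<noteq> 0" using c by simp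
  have d: "degree ?p = (\<Prod>i\<in>UNIV. \<alpha> i)"
    unfolding card_choices[symmetric] by (subst degree_prod_eq_sum_degree) auto
  have l: "lead_coeff ?p = 1" by (subst lead_coeff_prod) auto
  show "degree (uni_eval c A0 norm_poly) = (\<Prod>i\<in>UNIV. \<alpha> i)"
    unfolding uni_eval_norm_poly[OF c] degree_smult_eq using B d by (simp only: if_False)
  show "coeff (uni_eval c A0 norm_poly) (\<Prod>i\<in>UNIV. \<alpha> i) = (\<Prod>i\<in>UNIV. c (B2 i) ^ Pj i)"
    unfolding uni_eval_norm_poly[OF c] coeff_smult using l[unfolded d] by (simp only: mult_1_right)
qed

lemma coeff_uni_norm_poly:
  "i > (\<Prod>i\<in>UNIV. \<alpha> i) \<Longrightarrow> coeff (uni A0 norm_poly) i = 0"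
  "coeff (uni A0 norm_poly) (\<Prod>i\<in>UNIV. \<alpha> i) = (\<Prod>i\<in>UNIV. Var (B2 i) ^ Pj i)"
proof -
  show "coeff (uni A0 norm_poly) i = 0" if i: "i > (\<Prod>i\<in>UNIV. \<alpha> i)"
  proof (rule mpoly_eqI)
    fix c :: "'n qvar \<Rightarrow> complex" assume "\<And>v. c v \<noteq> 0"
    then have "coeff (uni_eval c A0 norm_poly) i = 0"
      using i degree_norm_poly_eval(1)[of c] by (intro coeff_eq_0) simp
    then show "subst c (coeff (uni A0 norm_poly) i) = subst c 0" by (simp add: coeff_uni_eval)
  qed
  show "coeff (uni A0 norm_poly) (\<Prod>i\<in>UNIV. \<alpha> i) = (\<Prod>i\<in>UNIV. Var (B2 i) ^ Pj i)"
  proof (rule mpoly_eqI)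
    fix c :: "'n qvar \<Rightarrow> complex" assume "\<And>v. c v \<noteq> 0"
    then show "subst c (coeff (uni A0 norm_poly) (\<Prod>i\<in>UNIV. \<alpha> i)) = subst c (\<Prod>i\<in>UNIV. Var (B2 i) ^ Pj i)"
      using degree_norm_poly_eval(2)[of c]
      by (simp add: coeff_uni_eval subst_hom.hom_prod subst_hom.hom_power)
  qed
qed

lemma prod_choices_component:
  "(\<Prod>f\<in>root_choices \<alpha> UNIV. g (f i)) = (\<Prod>l<\<alpha> i. g l) ^ Pj i" for g :: "nat \<Rightarrow> 'a::comm_semiring_1"
proof -
  have "insert i (UNIV - {i}) = UNIV" by auto
  then have "(\<Prod>f\<in>root_choices \<alpha> UNIV. g (f i)) = (\<Prod>l<\<alpha> i. \<Prod>f\<in>root_choices \<alpha> (UNIV - {i}). g l)"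
    using prod_root_choices_insert[of "UNIV - {i}" i "\<lambda>l _. g l" \<alpha>] by simp
  then show ?thesis by (simp add: card_PiE prod_power_distrib)
qed

lemma prod_rootprod:
  assumes "\<forall>v. v \<noteq> A0 \<longrightarrow> c v \<noteq> 0"
  shows "(\<Prod>i\<in>UNIV. c (B2 i) ^ Pj i) * (\<Prod>f\<in>root_choices \<alpha> UNIV. rootprod \<alpha> UNIV c f)
    = (\<Prod>i\<in>UNIV. ((-1) ^ \<alpha> i * c (B0 i)) ^ Pj i)"
proof -
  have "(\<Prod>f\<in>root_choices \<alpha> UNIV. rootprod \<alpha> UNIV c f) = (\<Prod>i\<in>UNIV. (\<Prod>l<\<alpha> i. zt \<alpha> c i l) ^ Pj i)"
    unfolding rootprod_def by (subst prod.swap) (simp add: prod_choices_component)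
  then have "(\<Prod>i\<in>UNIV. c (B2 i) ^ Pj i) * (\<Prod>f\<in>root_choices \<alpha> UNIV. rootprod \<alpha> UNIV c f)
     = (\<Prod>i\<in>UNIV. (c (B2 i) * (\<Prod>l<\<alpha> i. zt \<alpha> c i l)) ^ Pj i)"
    by (simp add: power_mult_distrib prod.distrib)
  also have "\<dots> = (\<Prod>i\<in>UNIV. ((-1) ^ \<alpha> i * c (B0 i)) ^ Pj i)"
    using assms prod_zeta[OF \<alpha>] by (simp add: zt_def)
  finally show ?thesis .
qed

text \<open>By Vieta's formula the powers of \<open>b_{i,2}\<close> cancel against the denominators
  of the products of roots. That no \<open>b_{i,2}\<close> is left is the reason why none divides
  the norm polynomial.\<close>

lemma norm_poly_const_term:
  "subst (Var(A0 := 0)) norm_poly =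
     (Var A1 ^ (\<Prod>i\<in>UNIV. \<alpha> i) * (\<Prod>i\<in>UNIV. ((-1) ^ \<alpha> i * Var (B0 i)) ^ Pj i) :: ('n qvar, int) mpoly)"
proof (rule mpoly_eqI)
  fix c :: "'n qvar \<Rightarrow> complex" assume c: "\<And>v. c v \<noteq> 0"
  have "subst c (subst (Var(A0 := 0)) norm_poly) = subst (c(A0 := 0)) norm_poly"
    unfolding subst_subst by (rule arg_cong[of _ _ "\<lambda>f. subst f norm_poly"]) (auto simp: fun_eq_iff)
  also have "\<dots> = (\<Prod>i\<in>UNIV. c (B2 i) ^ Pj i) * (\<Prod>f\<in>root_choices \<alpha> UNIV. c A1 * rootprod \<alpha> UNIV c f)"
    using c by (subst norm_poly) (simp_all add: rootprod_upd_A0)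
  also have "\<dots> = c A1 ^ (\<Prod>i\<in>UNIV. \<alpha> i) * ((\<Prod>i\<in>UNIV. c (B2 i) ^ Pj i) * (\<Prod>f\<in>root_choices \<alpha> UNIV. rootprod \<alpha> UNIV c f))"
    unfolding prod.distrib prod_constant card_choices by (simp only: mult_ac)
  also have "\<dots> = c A1 ^ (\<Prod>i\<in>UNIV. \<alpha> i) * (\<Prod>i\<in>UNIV. ((-1) ^ \<alpha> i * c (B0 i)) ^ Pj i)"
    using c by (subst prod_rootprod) auto
  finally show "subst c (subst (Var(A0 := 0)) norm_poly)
      = subst c (Var A1 ^ (\<Prod>i\<in>UNIV. \<alpha> i) * (\<Prod>i\<in>UNIV. ((-1) ^ \<alpha> i * Var (B0 i)) ^ Pj i))"
    by (simp add: subst_hom.hom_mult subst_hom.hom_prod subst_hom.hom_power subst_hom.hom_uminus)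
qed

lemma not_Var_dvd_norm_poly: "\<not> Var (B2 i) dvd norm_poly"
proof
  assume "Var (B2 i) dvd norm_poly"
  then obtain E where E: "norm_poly = Var (B2 i) * E" ..
  define c :: "'n qvar \<Rightarrow> complex" where "c v = (if v = B2 i then 0 else 1)" for v
  have "subst c (subst (Var(A0 := 0)) norm_poly) = 0"
    unfolding E subst_hom.hom_mult by (simp add: c_def)
  moreover have "subst c (subst (Var(A0 := 0)) norm_poly) \<noteq> 0"
    unfolding norm_poly_const_term
    by (simp add: subst_hom.hom_mult subst_hom.hom_prod subst_hom.hom_power subst_hom.hom_uminus c_def)
  ultimately show False by simp
qed

section \<open>The norm polynomial and the solvable coefficients\<close>

lemma solvable_coeffsI:
  assumes "\<And>v. c v \<noteq> 0" "\<And>i. z i \<noteq> 0" "c A0 + c A1 * (\<Prod>i\<in>UNIV. z i) = 0"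
    "\<And>i. c (B0 i) + c (B1 i) * z i + c (B2 i) * z i ^ \<alpha> i = 0"
  shows "c \<in> solvable_coeffs \<alpha>"
  unfolding solvable_coeffs_def F0_def Fi_def using assms by blast

lemma norm_poly_solvable:
  assumes "c \<in> solvable_coeffs \<alpha>"
  shows "subst c norm_poly = 0"
proof -
  from assms obtain z where c: "\<And>v. c v \<noteq> 0" and z: "\<And>i. z i \<noteq> 0" "c A0 + c A1 * (\<Prod>i\<in>UNIV. z i) = 0"
    "\<And>i. c (B0 i) + c (B1 i) * z i + c (B2 i) * z i ^ \<alpha> i = 0"
    unfolding solvable_coeffs_def F0_def Fi_def by blast
  have "\<exists>k<\<alpha> i. z i = zt \<alpha> c i k" for i
    using root_imp_zeta[OF \<alpha> c z(3)] by (simp add: zt_def)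
  then obtain f where f: "\<And>i. f i < \<alpha> i" "\<And>i. z i = zt \<alpha> c i (f i)" by metis
  have "f \<in> root_choices \<alpha> UNIV" "c A0 + c A1 * rootprod \<alpha> UNIV c f = 0"
    using f z(2) by (auto simp: rootprod_def)
  then have "(\<Prod>f\<in>root_choices \<alpha> UNIV. c A0 + c A1 * rootprod \<alpha> UNIV c f) = 0"
    using finite_choices by (auto simp: prod_zero_iff)
  then show ?thesis using c by (subst norm_poly) auto
qed

text \<open>At a generic point the numbers \<open>- a_1 * rootprod\<close> are as many distinct
  values of \<open>a_0\<close> as the degree of the norm polynomial in \<open>a_0\<close>. Each
  makes the system solvable, so it is a zero of \<open>R\<close> as well.\<close>

lemma norm_poly_dvd:
  fixes R :: "('n qvar, int) mpoly"
  assumes R: "\<And>c. c \<in> solvable_coeffs \<alpha> \<Longrightarrow> subst c R = 0"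
  shows "norm_poly dvd R"
proof (rule dvd_if_common_roots[of "\<Prod>i\<in>UNIV. \<alpha> i" A0 norm_poly B2 "Pj" UNIV])
  fix S :: "('n qvar, int) mpoly" assume "S \<noteq> 0"
  from exists_distinct_coeffs[OF this] obtain c where
    c: "subst c S \<noteq> 0" "\<And>v. c v \<noteq> 0" and inj: "inj_on (rootprod \<alpha> UNIV c) (root_choices \<alpha> UNIV)"
    by (auto simp: distinct_coeffs_def)
  define Z where "Z = (\<lambda>f. - c A1 * rootprod \<alpha> UNIV c f) ` root_choices \<alpha> UNIV"
  have "inj_on (\<lambda>f. - c A1 * rootprod \<alpha> UNIV c f) (root_choices \<alpha> UNIV)"
    using inj c(2) by (auto simp: inj_on_def)
  then have "card Z = (\<Prod>i\<in>UNIV. \<alpha> i)" unfolding Z_def card_choices[symmetric] by (rule card_image)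
  moreover have "finite Z" using finite_choices by (simp add: Z_def)
  moreover have "c(A0 := x) \<in> solvable_coeffs \<alpha>" if "x \<in> Z" for x
  proof -
    from that obtain f where f: "f \<in> root_choices \<alpha> UNIV" and x: "x = - c A1 * rootprod \<alpha> UNIV c f"
      by (auto simp: Z_def)
    have fi: "f i < \<alpha> i" for i using f by (auto simp: PiE_iff)
    show ?thesis
    proof (rule solvable_coeffsI[where z = "\<lambda>i. zt \<alpha> c i (f i)"])
      show "(c(A0 := x)) v \<noteq> 0" for v using c(2) x rootprod_nonzero[OF _ f] by auto
      show "zt \<alpha> c i (f i) \<noteq> 0" for i using c(2) fi by (simp add: zt_nonzero)
      show "(c(A0 := x)) A0 + (c(A0 := x)) A1 * (\<Prod>i\<in>UNIV. zt \<alpha> c i (f i)) = 0"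
        by (simp add: x rootprod_def)
      show "(c(A0 := x)) (B0 i) + (c(A0 := x)) (B1 i) * zt \<alpha> c i (f i) + (c(A0 := x)) (B2 i) * zt \<alpha> c i (f i) ^ \<alpha> i = 0" for i
        using zeta_root[OF \<alpha> c(2) fi] by (simp add: zt_def)
    qed
  qed
  ultimately show "\<exists>c Z. subst c S \<noteq> (0::complex) \<and> finite Z \<and> card Z \<ge> (\<Prod>i\<in>UNIV. \<alpha> i) \<and>
       (\<forall>z\<in>Z. subst (c(A0 := z)) norm_poly = 0 \<and> subst (c(A0 := z)) R = 0)"
    using c(1) R norm_poly_solvable by (intro exI[of _ c] exI[of _ Z]) auto
qed (auto simp: coeff_uni_norm_poly not_Var_dvd_norm_poly)

lemma solvable_coeffs_nonempty: "\<exists>c. c \<in> solvable_coeffs \<alpha>"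
proof
  show "(\<lambda>v. case v of A0 \<Rightarrow> 1 | A1 \<Rightarrow> -1 | B0 i \<Rightarrow> -2 | B1 i \<Rightarrow> 1 | B2 i \<Rightarrow> 1) \<in> solvable_coeffs \<alpha>"
    by (rule solvable_coeffsI[where z = "\<lambda>_. 1"]) (auto split: qvar.splits)
qed

text \<open>A polynomial parametrization of the solvable coefficients. The variable \<open>b\<^bsub>i,0\<^esub>\<close>, being
  determined by the others, is used for the coordinate \<open>z\<^sub>i\<close> of the common zero.\<close>

definition param :: "'n qvar \<Rightarrow> ('n qvar, int) mpoly" where
  "param v = (case v of A0 \<Rightarrow> - Var A1 * (\<Prod>i\<in>UNIV. Var (B0 i))
     | B0 i \<Rightarrow> - (Var (B1 i) * Var (B0 i) + Var (B2 i) * Var (B0 i) ^ \<alpha> i)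
     | _ \<Rightarrow> Var v)"

lemma subst_param: "subst c (param v) = (case v of A0 \<Rightarrow> - c A1 * (\<Prod>i\<in>UNIV. c (B0 i))
     | B0 i \<Rightarrow> - (c (B1 i) * c (B0 i) + c (B2 i) * c (B0 i) ^ \<alpha> i)
     | _ \<Rightarrow> c v)"
  by (cases v) (simp_all add: param_def subst_hom.hom_mult subst_hom.hom_prod subst_hom.hom_power
      subst_hom.hom_uminus subst_hom.hom_add subst_hom.hom_minus)

lemma solvable_imp_param:
  assumes "c \<in> solvable_coeffs \<alpha>"
  obtains c' where "\<And>v. subst c' (param v) = c v"
proof -
  from assms obtain z where z: "c A0 + c A1 * (\<Prod>i\<in>UNIV. z i) = 0"
    "\<And>i. c (B0 i) + c (B1 i) * z i + c (B2 i) * z i ^ \<alpha> i = 0"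
    unfolding solvable_coeffs_def F0_def Fi_def by blast
  define c' where "c' v = (case v of B0 i \<Rightarrow> z i | _ \<Rightarrow> c v)" for v
  have "subst c' (param v) = c v" for v
  proof (cases v)
    case (B0 i)
    have "c (B0 i) = - (c (B1 i) * z i + c (B2 i) * z i ^ \<alpha> i)"
      unfolding eq_neg_iff_add_eq_0 using z(2)[of i] by (simp only: add.assoc)
    with B0 show ?thesis by (simp add: subst_param c'_def)
  next
    case A0
    have "c A0 = - (c A1 * (\<Prod>i\<in>UNIV. z i))" unfolding eq_neg_iff_add_eq_0 by (rule z(1))
    with A0 show ?thesis by (simp add: subst_param c'_def)
  qed (auto simp: subst_param c'_def)
  with that show ?thesis .
qed

lemma subst_param_norm_poly: "subst param norm_poly = 0"
proof (rule ccontr)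
  assume nz: "subst param norm_poly \<noteq> 0"
  have "param v \<noteq> 0" for v
  proof -
    have "subst (\<lambda>_. 1 :: complex) (param v) \<noteq> 0" by (auto simp: subst_param split: qvar.splits)
    then show ?thesis by auto
  qed
  \<comment> \<open>The image of the parametrization meets the coordinate hyperplanes, where no
    point counts as solvable; the extra factor keeps the chosen point away from them.\<close>
  then have "(\<Prod>v\<in>UNIV. param v) * subst param norm_poly \<noteq> 0"
    using nz by (simp add: mpoly_mult_eq_0_iff mpoly_prod_eq_0_iff)
  from exists_nonzero_value[OF this] obtain c :: "'n qvar \<Rightarrow> complex" where
    c: "subst c ((\<Prod>v\<in>UNIV. param v) * subst param norm_poly) \<noteq> 0" "\<And>v. c v \<noteq> 0" by blast
  then have p: "subst c (param v) \<noteq> 0" for v by (auto simp: subst_hom.hom_mult subst_hom.hom_prod)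
  have "(\<lambda>v. subst c (param v)) \<in> solvable_coeffs \<alpha>"
    by (rule solvable_coeffsI[where z = "\<lambda>i. c (B0 i)"], rule p, rule c(2)) (simp_all add: subst_param)
  then have "subst c (subst param norm_poly) = 0" unfolding subst_subst by (rule norm_poly_solvable)
  with c(1) show False by (simp add: subst_hom.hom_mult)
qed

text \<open>Substituting \<open>param\<close> is a homomorphism into a ring without zero divisors,
  with kernel generated by \<open>norm_poly\<close>. Of two factors, one lies in the kernel, hence
  is a multiple of \<open>norm_poly\<close>, and leaves a unit for the other.\<close>

lemma irreducible_norm_poly: "irreducible norm_poly"
proof (rule irreducibleI)
  have vanish: "norm_poly dvd F" if "subst param F = 0" for F
  proof (rule norm_poly_dvd)
    fix c assume "c \<in> solvable_coeffs \<alpha>"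
    from solvable_imp_param[OF this] obtain c' where c': "\<And>v. subst c' (param v) = c v" by blast
    have "subst c' (subst param F) = subst c F" unfolding subst_subst c' ..
    then show "subst c F = 0" using that by simp
  qed
  obtain c where c: "c \<in> solvable_coeffs \<alpha>" using solvable_coeffs_nonempty by blast
  show nz: "norm_poly \<noteq> 0" using not_Var_dvd_norm_poly[of undefined] by auto
  show "\<not> norm_poly dvd 1"
  proof
    assume "norm_poly dvd 1"
    then obtain E where "1 = norm_poly * E" ..
    from arg_cong[OF this, of "subst c"] show False by (simp add: subst_hom.hom_mult norm_poly_solvable[OF c])
  qed
  have cancel: "b dvd 1" if "norm_poly = a * b" "norm_poly dvd a" for a b
  proof -
    from that(2) obtain E where "a = norm_poly * E" ..
    with that(1) have "norm_poly * 1 = norm_poly * (E * b)" by (simp add: mult.assoc)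
    then have "1 = E * b" unfolding mpoly_mult_cancel_left using nz by simp
    then show ?thesis by (intro dvdI[of _ _ E]) (simp add: mult.commute)
  qed
  fix a b assume ab: "norm_poly = a * b"
  have "subst param a = 0 \<or> subst param b = 0"
    using subst_param_norm_poly unfolding ab subst_hom.hom_mult mpoly_mult_eq_0_iff .
  then show "a dvd 1 \<or> b dvd 1"
  proof
    assume "subst param a = 0"
    from cancel[OF ab vanish[OF this]] show ?thesis ..
  next
    assume "subst param b = 0"
    from cancel[OF ab[unfolded mult.commute[of a]] vanish[OF this]] show ?thesis ..
  qed
qed

lemma continuous_on_subst: "continuous_on UNIV (\<lambda>c :: 'n qvar \<Rightarrow> complex. subst c p)"
  unfolding subst_eq_insertion insertion_def
  by (intro continuous_intros continuous_on_product_coordinates)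

lemma is_quiver_resultant_norm_poly: "is_quiver_resultant \<alpha> norm_poly"
proof -
  have "closed {c :: 'n qvar \<Rightarrow> complex. subst c norm_poly = 0}"
    by (intro closed_Collect_eq continuous_on_subst continuous_on_const)
  then have "closure (solvable_coeffs \<alpha>) \<subseteq> {c. subst c norm_poly = 0}"
    using norm_poly_solvable by (intro closure_minimal) auto
  then show ?thesis unfolding is_quiver_resultant_def using irreducible_norm_poly by auto
qed

text \<open>The chosen resultant is an irreducible multiple of a non-unit, so the cofactor is a
  unit. A nonzero constant factor leaves the Newton polygon unchanged.\<close>

theorem quiver_resultant_eq_norm_poly:
  obtains k where "k \<noteq> 0" "quiver_resultant \<alpha> = of_int k * norm_poly"
proof -
  have "is_quiver_resultant \<alpha> (quiver_resultant \<alpha>)"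
    unfolding quiver_resultant_def by (rule someI, rule is_quiver_resultant_norm_poly)
  then have irr: "irreducible (quiver_resultant \<alpha>)" and
    "\<And>c. c \<in> solvable_coeffs \<alpha> \<Longrightarrow> subst c (quiver_resultant \<alpha>) = 0"
    unfolding is_quiver_resultant_def using closure_subset by auto
  from norm_poly_dvd[OF this(2)] obtain E where E: "quiver_resultant \<alpha> = norm_poly * E" ..
  have "E dvd 1" using irreducibleD[OF irr E] irreducible_norm_poly by (auto simp: irreducible_def)
  then obtain k where "E = of_int k" "k \<noteq> 0" by (rule mpoly_unit_constant)
  with E that show ?thesis by (simp add: mult.commute)
qed

end

section \<open>Newton polygons and growth along weighted curves\<close>

definition eval2 :: "complex \<Rightarrow> complex \<Rightarrow> (2, complex) mpoly \<Rightarrow> complex" where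
  "eval2 x y = insertion (\<lambda>c. c) (\<lambda>v. if v = 1 then x else y)"

interpretation eval2_hom: comm_ring_hom "eval2 x y" for x y
proof -
  interpret comm_ring_hom "\<lambda>c :: complex. c" by unfold_locales auto
  show "comm_ring_hom (eval2 x y)" unfolding eval2_def by (rule comm_ring_hom_insertion)
qed

lemma eval2_eq:
  "eval2 x y p = (\<Sum>e\<in>Poly_Mapping.keys p. Poly_Mapping.lookup p e *
     (x ^ Poly_Mapping.lookup e 1 * y ^ Poly_Mapping.lookup e 2))"
proof -
  have "(\<Prod>v\<in>UNIV. (if v = 1 then x else y) ^ Poly_Mapping.lookup e v)
      = x ^ Poly_Mapping.lookup e 1 * y ^ Poly_Mapping.lookup e 2" for e :: "2 \<Rightarrow>\<^sub>0 nat"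
    unfolding UNIV_2 by simp
  then show ?thesis by (simp add: eval2_def insertion_def)
qed

lemma eval2_Var [simp]: "eval2 x y (Var v) = (if v = 1 then x else y)"
  and eval2_Const [simp]: "eval2 x y (Const c) = c"
proof -
  interpret comm_ring_hom "\<lambda>c :: complex. c" by unfold_locales auto
  show "eval2 x y (Var v) = (if v = 1 then x else y)" "eval2 x y (Const c) = c"
    unfolding eval2_def by (rule insertion_Var, rule insertion_Const)
qed

definition weight :: "real \<Rightarrow> real \<Rightarrow> (2 \<Rightarrow>\<^sub>0 nat) \<Rightarrow> real" where
  "weight w1 w2 e = w1 * real (Poly_Mapping.lookup e 1) + w2 * real (Poly_Mapping.lookup e 2)"

lemma tendsto_powr_0: "d > 0 \<Longrightarrow> ((\<lambda>r::real. r powr d) \<longlongrightarrow> 0) (at_right 0)"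
  by (rule tendsto_zero_powrI[where b = d]) (auto simp: eventually_at_right_less intro: eventually_mono[OF eventually_at_right_less])

lemma powr_exponent_le:
  fixes a b c C :: real
  assumes "c > 0" "r0 > 0" and le: "\<And>r. 0 < r \<Longrightarrow> r < r0 \<Longrightarrow> c * r powr a \<le> C * r powr b"
  shows "b \<le> a"
proof (rule ccontr)
  assume "\<not> b \<le> a"
  then have "((\<lambda>r. C * r powr (b - a)) \<longlongrightarrow> C * 0) (at_right 0)" by (intro tendsto_mult tendsto_const tendsto_powr_0) simp
  then have "\<forall>\<^sub>F r in at_right 0. C * r powr (b - a) < c" using \<open>c > 0\<close> by (intro order_tendstoD(2)) auto
  moreover have "\<forall>\<^sub>F r in at_right 0. r \<in> {0<..<r0}" using \<open>r0 > 0\<close> by (rule eventually_at_right_real)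
  ultimately have "\<forall>\<^sub>F r::real in at_right 0. False"
  proof eventually_elim
    case (elim r)
    then have r: "0 < r" "r < r0" by auto
    have "r powr b = r powr (b - a) * r powr a" by (simp flip: powr_add)
    then have "c * r powr a \<le> C * r powr (b - a) * r powr a" using le[OF r] by simp
    then have "c \<le> C * r powr (b - a)" using r by simp
    then show False using elim by simp
  qed
  then show False by simp
qed

context
  fixes w1 w2 :: real
begin

text \<open>A monomial with exponent \<open>e\<close> grows like
  \<open>r powr weight w1 w2 e\<close> along this orbit. As \<open>r\<close> tends to 0, the terms
  of least weight dominate unless they cancel at the phases \<open>u\<close> and
  \<open>w\<close>.\<close>

definition curve :: "real \<Rightarrow> complex \<Rightarrow> complex \<Rightarrow> (2, complex) mpoly \<Rightarrow> complex" where
  "curve r u w p = eval2 (of_real (r powr w1) * u) (of_real (r powr w2) * w) p"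

lemma curve_eq:
  assumes "r > 0"
  shows "curve r u w p = (\<Sum>e\<in>Poly_Mapping.keys p. of_real (r powr weight w1 w2 e) *
    (Poly_Mapping.lookup p e * (u ^ Poly_Mapping.lookup e 1 * w ^ Poly_Mapping.lookup e 2)))"
proof -
  have "r powr weight w1 w2 e = (r powr w1) ^ Poly_Mapping.lookup e 1 * (r powr w2) ^ Poly_Mapping.lookup e 2" for e
    using assms by (simp add: weight_def powr_add powr_powr flip: powr_realpow)
  then show ?thesis
    unfolding curve_def eval2_eq by (intro sum.cong refl) (simp add: power_mult_distrib mult_ac)
qed

lemma curve_upper:
  assumes m: "\<And>e. e \<in> Poly_Mapping.keys p \<Longrightarrow> m \<le> weight w1 w2 e" and r: "0 < r" "r \<le> 1"
    and "norm u = 1" "norm w = 1"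
  shows "norm (curve r u w p) \<le> (\<Sum>e\<in>Poly_Mapping.keys p. norm (Poly_Mapping.lookup p e)) * r powr m"
  unfolding curve_eq[OF r(1)] sum_distrib_right
proof (rule order_trans[OF norm_sum sum_mono])
  fix e assume "e \<in> Poly_Mapping.keys p"
  then have "norm (Poly_Mapping.lookup p e) * r powr weight w1 w2 e \<le> norm (Poly_Mapping.lookup p e) * r powr m"
    using r m by (intro mult_left_mono powr_mono') auto
  then show "norm (of_real (r powr weight w1 w2 e) * (Poly_Mapping.lookup p e * (u ^ Poly_Mapping.lookup e 1 * w ^ Poly_Mapping.lookup e 2)))
     \<le> norm (Poly_Mapping.lookup p e) * r powr m"
    using assms(4,5) by (simp add: norm_mult norm_power mult.commute)
qed

text \<open>On the torus, \<open>w = u\<^sup>M\<close> with \<open>M\<close> large separates the monomials of the initial form.\<close>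

lemma curve_lower:
  assumes e0: "e0 \<in> Poly_Mapping.keys p" and m: "\<And>e. e \<in> Poly_Mapping.keys p \<Longrightarrow> weight w1 w2 e0 \<le> weight w1 w2 e"
  obtains u w c r0 where "norm u = 1" "norm w = 1" "c > 0" "r0 > 0"
    "\<And>r. 0 < r \<Longrightarrow> r < r0 \<Longrightarrow> c * r powr weight w1 w2 e0 \<le> norm (curve r u w p)"
proof -
  let ?m = "weight w1 w2 e0"
  define I where "I = {e \<in> Poly_Mapping.keys p. weight w1 w2 e = ?m}"
  have finI: "finite I" by (simp add: I_def)
  \<comment> \<open>Larger than all first exponents, so that \<open>d\<close> reads the two
    exponents as digits in base \<open>M\<close> and no two terms of the initial form merge.\<close>
  define M where "M = Suc (Max ((\<lambda>e. Poly_Mapping.lookup e 1) ` Poly_Mapping.keys p))"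
  have M: "Poly_Mapping.lookup e 1 < M" if "e \<in> I" for e
    unfolding M_def less_Suc_eq_le using that by (intro Max_ge) (auto simp: I_def)
  define d where "d e = Poly_Mapping.lookup e 1 + M * Poly_Mapping.lookup e 2" for e :: "2 \<Rightarrow>\<^sub>0 nat"
  have inj: "e = e'" if "e \<in> I" "e' \<in> I" "d e = d e'" for e e'
  proof -
    have "Poly_Mapping.lookup e 1 = Poly_Mapping.lookup e' 1"
      using arg_cong[OF that(3), of "\<lambda>n. n mod M"] M[OF that(1)] M[OF that(2)] by (simp add: d_def)
    moreover have "Poly_Mapping.lookup e 2 = Poly_Mapping.lookup e' 2"
      using that(3) M[OF that(1)] calculation by (simp add: d_def)
    ultimately have "Poly_Mapping.lookup e v = Poly_Mapping.lookup e' v" for v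
      using exhaust_2[of v] by auto
    then show ?thesis by (rule poly_mapping_eqI)
  qed
  \<comment> \<open>The initial form on the torus at \<open>w = u ^ M\<close>. As no terms merge, it
    is nonzero, so some \<open>u\<close> of absolute value 1 is not a root.\<close>
  define Q where "Q = (\<Sum>e\<in>I. monom (Poly_Mapping.lookup p e) (d e))"
  have "coeff Q (d e0) = (\<Sum>e\<in>I. if e = e0 then Poly_Mapping.lookup p e else 0)"
    unfolding Q_def coeff_sum using inj[of _ e0] e0 by (intro sum.cong) (auto simp: I_def)
  also have "\<dots> = Poly_Mapping.lookup p e0" using finI e0 by (simp add: I_def)
  finally have "Q \<noteq> 0" using e0 by (auto simp: in_keys_iff)
  then have "finite {z. poly Q z = 0}" by (rule poly_roots_finite)
  moreover have "infinite (sphere (0::complex) 1)"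
  proof
    assume "finite (sphere (0::complex) 1)"
    moreover have "cis ` {0..1} \<subseteq> sphere 0 1" by auto
    ultimately have "finite (cis ` {0..1})" by (rule finite_subset[rotated])
    moreover have "inj_on cis {0..1}"
    proof (rule inj_onI)
      fix x y :: real assume xy: "x \<in> {0..1}" "y \<in> {0..1}" "cis x = cis y"
      then have "Re (cis x) = Re (cis y)" by simp
      then have "cos x = cos y" by simp
      moreover have "x \<le> pi" "y \<le> pi" using xy pi_gt3 by auto
      ultimately show "x = y" using xy cos_inj_pi[of x y] by auto
    qed
    ultimately have "finite {0..1::real}" by (rule finite_imageD)
    then show False using infinite_Icc[of "0::real" 1] by simp
  qed
  ultimately have "\<not> sphere 0 1 \<subseteq> {z. poly Q z = 0}" using finite_subset by blast
  then obtain u where "u \<in> sphere 0 1" "poly Q u \<noteq> 0" by blast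
  then have u: "norm u = 1" "poly Q u \<noteq> 0" by simp_all
  define w where "w = u ^ M"
  have w: "norm w = 1" by (simp add: w_def norm_power u)
  \<comment> \<open>The value on the curve divided by the least power of \<open>r\<close>; the terms
    of larger weight die out in the limit.\<close>
  define F where "F r = (\<Sum>e\<in>Poly_Mapping.keys p. of_real (r powr (weight w1 w2 e - ?m)) *
    (Poly_Mapping.lookup p e * (u ^ Poly_Mapping.lookup e 1 * w ^ Poly_Mapping.lookup e 2)))" for r :: real
  have "(F \<longlongrightarrow> (\<Sum>e\<in>Poly_Mapping.keys p. (if weight w1 w2 e = ?m then 1 else 0) *
    (Poly_Mapping.lookup p e * (u ^ Poly_Mapping.lookup e 1 * w ^ Poly_Mapping.lookup e 2)))) (at_right 0)"
    unfolding F_def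
  proof (intro tendsto_sum tendsto_mult tendsto_const)
    fix e assume e: "e \<in> Poly_Mapping.keys p"
    show "((\<lambda>r. complex_of_real (r powr (weight w1 w2 e - ?m))) \<longlongrightarrow> (if weight w1 w2 e = ?m then 1 else 0)) (at_right 0)"
    proof (cases "weight w1 w2 e = ?m")
      case True
      have "\<forall>\<^sub>F r in at_right 0. complex_of_real (r powr (weight w1 w2 e - ?m)) = 1"
        using eventually_at_right_less[of "0::real"] by eventually_elim (simp add: True)
      then show ?thesis using True by (simp add: tendsto_eventually)
    next
      case False
      then have "((\<lambda>r. complex_of_real (r powr (weight w1 w2 e - ?m))) \<longlongrightarrow> of_real 0) (at_right 0)"
        using m[OF e] by (intro tendsto_of_real tendsto_powr_0) simp
      then show ?thesis using False by simp
    qed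
  qed
  also have "(\<Sum>e\<in>Poly_Mapping.keys p. (if weight w1 w2 e = ?m then 1 else 0) *
    (Poly_Mapping.lookup p e * (u ^ Poly_Mapping.lookup e 1 * w ^ Poly_Mapping.lookup e 2)))
    = (\<Sum>e\<in>I. Poly_Mapping.lookup p e * (u ^ Poly_Mapping.lookup e 1 * w ^ Poly_Mapping.lookup e 2))"
    unfolding I_def by (intro sum.mono_neutral_cong_right) auto
  also have "\<dots> = poly Q u"
    by (simp add: Q_def poly_sum poly_monom d_def w_def power_add power_mult)
  finally have "((\<lambda>r. norm (F r)) \<longlongrightarrow> norm (poly Q u)) (at_right 0)" by (rule tendsto_norm)
  then have "\<forall>\<^sub>F r in at_right 0. norm (F r) > norm (poly Q u) / 2"
    using u(2) by (intro order_tendstoD(1)) auto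
  then obtain r0 where r0: "r0 > 0" "\<And>r. 0 < r \<Longrightarrow> r < r0 \<Longrightarrow> norm (F r) > norm (poly Q u) / 2"
    unfolding eventually_at_right_field by auto
  show ?thesis
  proof (rule that[OF u(1) w _ r0(1)])
    show "norm (poly Q u) / 2 > 0" using u(2) by simp
    fix r :: real assume r: "0 < r" "r < r0"
    have "curve r u w p = of_real (r powr ?m) * F r"
      unfolding curve_eq[OF r(1)] F_def sum_distrib_left
    proof (intro sum.cong refl)
      fix e
      have "r powr weight w1 w2 e = r powr ?m * r powr (weight w1 w2 e - ?m)" by (simp flip: powr_add)
      then show "of_real (r powr weight w1 w2 e) * (Poly_Mapping.lookup p e * (u ^ Poly_Mapping.lookup e 1 * w ^ Poly_Mapping.lookup e 2))
        = of_real (r powr ?m) * (of_real (r powr (weight w1 w2 e - ?m)) *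
          (Poly_Mapping.lookup p e * (u ^ Poly_Mapping.lookup e 1 * w ^ Poly_Mapping.lookup e 2)))"
        by (simp add: mult.assoc)
    qed
    then have "norm (curve r u w p) = norm (F r) * r powr ?m" by (simp add: norm_mult)
    moreover have "norm (poly Q u) / 2 * r powr ?m \<le> norm (F r) * r powr ?m"
      using r0(2)[OF r] by (intro mult_right_mono) auto
    ultimately show "norm (poly Q u) / 2 * r powr ?m \<le> norm (curve r u w p)" by simp
  qed
qed

lemma minimal_weight_key:
  assumes "p \<noteq> 0"
  obtains e0 where "e0 \<in> Poly_Mapping.keys p" "\<And>e. e \<in> Poly_Mapping.keys p \<Longrightarrow> weight w1 w2 e0 \<le> weight w1 w2 e"
proof -
  have "Poly_Mapping.keys p \<noteq> {}" using assms by simp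
  then have "Min (weight w1 w2 ` Poly_Mapping.keys p) \<in> weight w1 w2 ` Poly_Mapping.keys p" by (intro Min_in) auto
  then obtain e0 where e0: "e0 \<in> Poly_Mapping.keys p" "weight w1 w2 e0 = Min (weight w1 w2 ` Poly_Mapping.keys p)"
    by (metis imageE)
  show ?thesis by (rule that[OF e0(1)]) (simp add: e0(2))
qed

text \<open>The upper bound is demanded at all phases: for special \<open>u\<close> and
  \<open>w\<close> the dominant terms may cancel, and \<open>curve_lower\<close> only provides some
  pair where they do not.\<close>

lemma weight_ge_if_curve_le:
  assumes "r0 > 0" "\<And>r u w. 0 < r \<Longrightarrow> r < r0 \<Longrightarrow> norm u = 1 \<Longrightarrow> norm w = 1 \<Longrightarrow> norm (curve r u w p) \<le> C * r powr E"
    and e: "e \<in> Poly_Mapping.keys p"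
  shows "E \<le> weight w1 w2 e"
proof -
  have "p \<noteq> 0" using e by auto
  from minimal_weight_key[OF this] obtain e0 where e0: "e0 \<in> Poly_Mapping.keys p"
    "\<And>e. e \<in> Poly_Mapping.keys p \<Longrightarrow> weight w1 w2 e0 \<le> weight w1 w2 e" by blast
  obtain u w c r1 where u: "norm u = 1" "norm w = 1" "c > 0" "r1 > 0"
    "\<And>r. 0 < r \<Longrightarrow> r < r1 \<Longrightarrow> c * r powr weight w1 w2 e0 \<le> norm (curve r u w p)"
    using curve_lower[OF e0] by blast
  have "E \<le> weight w1 w2 e0"
  proof (rule powr_exponent_le[of c "min r0 r1" _ C])
    fix r assume "0 < r" "r < min r0 r1"
    then show "c * r powr weight w1 w2 e0 \<le> C * r powr E" using u(5)[of r] assms(2)[of r u w] u(1,2) by simp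
  qed (use u assms in auto)
  then show ?thesis using e0(2)[OF e] by simp
qed

text \<open>Here one phase is enough, because cancellation can only make the value smaller.\<close>

lemma weight_le_if_curve_ge:
  assumes "r0 > 0" "c > 0" "\<And>r. 0 < r \<Longrightarrow> r < r0 \<Longrightarrow> c * r powr E \<le> norm (curve r 1 1 p)"
  shows "\<exists>e\<in>Poly_Mapping.keys p. weight w1 w2 e \<le> E"
proof -
  have "p \<noteq> 0"
  proof
    assume "p = 0"
    then have "c * (r0 / 2) powr E \<le> 0" using assms(3)[of "r0 / 2"] assms(1) by (simp add: curve_def)
    moreover have "c * (r0 / 2) powr E > 0" using assms(1,2) by simp
    ultimately show False by simp
  qed
  from minimal_weight_key[OF this] obtain e0 where e0: "e0 \<in> Poly_Mapping.keys p"
    "\<And>e. e \<in> Poly_Mapping.keys p \<Longrightarrow> weight w1 w2 e0 \<le> weight w1 w2 e" by blast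
  have "weight w1 w2 e0 \<le> E"
  proof (rule powr_exponent_le[of c "min r0 1" _ "\<Sum>e\<in>Poly_Mapping.keys p. norm (Poly_Mapping.lookup p e)"])
    fix r assume "0 < r" "r < min r0 1"
    then show "c * r powr E \<le> (\<Sum>e\<in>Poly_Mapping.keys p. norm (Poly_Mapping.lookup p e)) * r powr weight w1 w2 e0"
      using assms(3)[of r] curve_upper[of p "weight w1 w2 e0" r 1 1] e0(2) by simp
  qed (use assms in auto)
  then show ?thesis using e0(1) by blast
qed

end

section \<open>Growth of the roots of a trinomial\<close>

lemma norm_zeta_eq:
  assumes "a \<ge> 2" "b \<noteq> 0" "k < a"
  shows "norm b * norm (zeta a (-1) 1 b k) ^ a = norm (1 - zeta a (-1) 1 b k)"
proof -
  have "b * zeta a (-1) 1 b k ^ a = 1 - zeta a (-1) 1 b k"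
    using zeta_root[OF assms, of "-1" 1] by (simp add: algebra_simps add_eq_0_iff)
  then have "norm (b * zeta a (-1) 1 b k ^ a) = norm (1 - zeta a (-1) 1 b k)" by simp
  then show ?thesis by (simp add: norm_mult norm_power)
qed

lemma powr_inverse_bounds:
  fixes n X q :: real
  assumes "q > 0" "n > 0" "X > 0"
  shows "X \<le> n powr q \<Longrightarrow> X powr (1 / q) \<le> n" "n powr q \<le> X \<Longrightarrow> n \<le> X powr (1 / q)"
proof -
  have n: "(n powr q) powr (1 / q) = n" using assms by (simp add: powr_powr)
  show "X \<le> n powr q \<Longrightarrow> X powr (1 / q) \<le> n"
    using powr_mono2[of "1 / q" X "n powr q"] n assms by simp
  show "n powr q \<le> X \<Longrightarrow> n \<le> X powr (1 / q)"
    using powr_mono2[of "1 / q" "n powr q" X] n assms by simp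
qed

text \<open>Each root is either bounded (and then close to \<open>1\<close>) or of size \<open>r powr (- 1 / (a - 1))\<close>. As the
  product of all roots has absolute value \<open>1 / norm b\<close>, exactly one of them is bounded.\<close>

lemma zeta_small_regime:
  fixes l :: real
  assumes a: "a \<ge> 2" and l: "l > 0"
  obtains C r0 where "C \<ge> 1" "r0 > 0"
    "\<And>r b. 0 < r \<Longrightarrow> r < r0 \<Longrightarrow> norm b = l * r \<Longrightarrow> \<exists>k0<a. \<forall>k<a.
       r powr (if k = k0 then 0 else - 1 / (real a - 1)) / C \<le> norm (zeta a (-1) 1 b k) \<and>
       norm (zeta a (-1) 1 b k) \<le> C * r powr (if k = k0 then 0 else - 1 / (real a - 1))"
proof -
  define q where "q = real a - 1"
  have q: "q \<ge> 1" "q > 0" using a by (auto simp: q_def)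
  have qa: "real (a - 1) = q" using a by (simp add: q_def)
  \<comment> \<open>A root with absolute value \<open>n > 2\<close> satisfies
    \<open>n / 2 \<le> l * r * n ^ a \<le> 2 * n\<close>; solving for \<open>n\<close> gives these
    two constants.\<close>
  define c1 where "c1 = (1 / (2 * l)) powr (1 / q)"
  define c2 where "c2 = (2 / l) powr (1 / q)"
  have c: "c1 > 0" "c2 > 0" using l by (auto simp: c1_def c2_def)
  define C where "C = 2 + 1 / c1 + c2"
  have C: "C \<ge> 2" "C \<ge> 1 / c1" "C \<ge> c2" "C > 0" using c by (auto simp: C_def add_pos_pos)
  have C1: "1 / C \<le> 1 / 2" "1 / C \<le> c1"
  proof -
    show "1 / C \<le> 1 / 2" using C by (intro divide_left_mono) auto
    show "1 / C \<le> c1" using C(2) C(4) c(1) by (simp add: field_simps)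
  qed
  \<comment> \<open>With too few or too many large roots, the product of all roots would force
    \<open>\<rho> \<le> C ^ a * l\<close> or \<open>\<rho> \<le> C ^ a / l\<close>; \<open>K\<close>
    exceeds both.\<close>
  define K where "K = C ^ a * (l + 1 / l) + 1"
  have CK: "C ^ a * l < K" "C ^ a / l < K" "K > 1"
  proof -
    have "C ^ a > 0" using C by simp
    then have "C ^ a * l > 0" "C ^ a / l > 0" using l by auto
    moreover have "K = C ^ a * l + C ^ a / l + 1" by (simp add: K_def distrib_left)
    ultimately show "C ^ a * l < K" "C ^ a / l < K" "K > 1" by auto
  qed
  \<comment> \<open>The first bound puts the roots of absolute value at most 2 within distance 1/2
    of 1, the second makes \<open>\<rho>\<close> larger than \<open>K\<close>.\<close>
  define r0 where "r0 = min (1 / (2 * l * 2 ^ a)) (K powr - q)"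
  show ?thesis
  proof (rule that[of C r0])
    show "C \<ge> 1" using C by simp
    show "r0 > 0" unfolding r0_def using l CK by (simp add: zero_less_mult_iff)
    fix r :: real and b :: complex assume r: "0 < r" "r < r0" and b: "norm b = l * r"
    define \<rho> where "\<rho> = r powr (- 1 / q)"
    have \<rho>0: "\<rho> > 0" using r by (simp add: \<rho>_def)
    have "K = (K powr - q) powr (- 1 / q)" using CK(3) q by (simp add: powr_powr)
    also have "\<dots> < r powr (- 1 / q)" using r q by (intro powr_less_mono2_neg) (auto simp: r0_def)
    finally have \<rho>K: "K < \<rho>" by (simp add: \<rho>_def)
    then have \<rho>1: "\<rho> > 1" using CK by simp
    have r\<rho>: "1 / r = \<rho> ^ (a - 1)"
    proof -
      have "\<rho> ^ (a - 1) = \<rho> powr q" using \<rho>0 by (simp add: qa[symmetric] powr_realpow)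
      also have "\<dots> = r powr (- 1)" unfolding \<rho>_def using q by (simp add: powr_powr)
      finally show ?thesis using r by (simp add: powr_minus_divide)
    qed
    have b0: "b \<noteq> 0" using b l r by auto
    define n where "n k = norm (zeta a (-1) 1 b k)" for k
    have lr: "l * r * 2 ^ a < 1 / 2"
    proof -
      have "r < 1 / (2 * l * 2 ^ a)" using r by (simp add: r0_def)
      then have "r * (2 * l * 2 ^ a) < 1" using l by (simp add: pos_less_divide_eq)
      then show ?thesis by (simp add: mult_ac)
    qed
    have small: "1 / C \<le> n k \<and> n k \<le> C" if k: "k < a" and "n k \<le> 2" for k
    proof -
      have "norm (1 - zeta a (-1) 1 b k) = l * r * n k ^ a"
        using norm_zeta_eq[OF a b0 k] b by (simp add: n_def)
      also have "\<dots> \<le> l * r * 2 ^ a" using that l r by (intro mult_left_mono power_mono) (auto simp: n_def)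
      finally have "norm (1 - zeta a (-1) 1 b k) \<le> 1 / 2" using lr by simp
      then have "n k \<ge> 1 / 2" using norm_triangle_sub[of "1 :: complex" "zeta a (-1) 1 b k"] by (simp add: n_def)
      then show ?thesis using that C C1 by linarith
    qed
    have large: "\<rho> / C \<le> n k \<and> n k \<le> C * \<rho>" if k: "k < a" and "n k > 2" for k
    proof -
      have eq: "l * r * n k ^ a = norm (1 - zeta a (-1) 1 b k)"
        using norm_zeta_eq[OF a b0 k] b by (simp add: n_def)
      have na: "n k ^ a = n k * n k powr q"
      proof -
        have "n k powr q = n k ^ (a - 1)" using \<open>n k > 2\<close> by (simp add: qa[symmetric] powr_realpow)
        moreover have "n k ^ a = n k * n k ^ (a - 1)" using a by (cases a) auto
        ultimately show ?thesis by simp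
      qed
      have "n k / 2 \<le> l * r * n k ^ a" "l * r * n k ^ a \<le> 2 * n k"
        unfolding eq using norm_triangle_ineq4[of "1 :: complex" "zeta a (-1) 1 b k"]
          norm_triangle_ineq2[of "zeta a (-1) 1 b k" 1] \<open>n k > 2\<close>
        by (auto simp: n_def norm_minus_commute)
      then have "n k * (1 / 2) \<le> n k * (l * r * n k powr q)" "n k * (l * r * n k powr q) \<le> n k * 2"
        unfolding na by (auto simp: mult_ac)
      then have "1 / 2 \<le> l * r * n k powr q" "l * r * n k powr q \<le> 2"
        using \<open>n k > 2\<close> by (auto simp only: mult_le_cancel_left_pos)
      then have "1 / (2 * l) * (1 / r) \<le> n k powr q" "n k powr q \<le> 2 / l * (1 / r)"
        using l r by (auto simp: field_simps)
      then have "(1 / (2 * l) * (1 / r)) powr (1 / q) \<le> n k" "n k \<le> (2 / l * (1 / r)) powr (1 / q)"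
        using powr_inverse_bounds[OF q(2), of "n k"] \<open>n k > 2\<close> l r by auto
      moreover have "(1 / r) powr (1 / q) = \<rho>"
        using r by (simp add: \<rho>_def powr_divide powr_minus_divide)
      ultimately have "c1 * \<rho> \<le> n k" "n k \<le> c2 * \<rho>"
        unfolding c1_def c2_def using l r by (auto simp only: powr_mult[symmetric])
      moreover have "\<rho> / C \<le> c1 * \<rho>" using mult_right_mono[OF C1(2), of \<rho>] \<rho>0 by simp
      moreover have "c2 * \<rho> \<le> C * \<rho>" using C \<rho>0 by (intro mult_right_mono) auto
      ultimately show ?thesis by linarith
    qed
    define L where "L = {k. k < a \<and> n k > 2}"
    have L: "L \<subseteq> {..<a}" "finite L" by (auto simp: L_def)
    have prod_n: "(\<Prod>k<a. n k) = \<rho> ^ (a - 1) / l"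
    proof -
      have "norm (b * (\<Prod>k<a. zeta a (-1) 1 b k)) = 1" unfolding prod_zeta[OF a b0] by (simp add: norm_mult norm_power)
      then have "l * r * (\<Prod>k<a. n k) = 1" by (simp add: norm_mult prod_norm[symmetric] b n_def)
      then have "(\<Prod>k<a. n k) = (1 / r) / l" using l r by (simp add: field_simps)
      then show ?thesis by (simp only: r\<rho>)
    qed
    have if_prod: "(\<Prod>k<a. if k \<in> L then \<rho> else 1) = \<rho> ^ card L"
      using L by (simp add: prod.If_cases Int_absorb1)
    have up: "\<rho> ^ (a - 1) / l \<le> C ^ a * \<rho> ^ card L"
    proof -
      have "(\<Prod>k<a. n k) \<le> (\<Prod>k<a. C * (if k \<in> L then \<rho> else 1))"
        using small large by (intro prod_mono) (auto simp: L_def n_def not_less)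
      then show ?thesis by (simp only: prod_n prod.distrib if_prod prod_constant card_lessThan)
    qed
    have lo: "\<rho> ^ card L / C ^ a \<le> \<rho> ^ (a - 1) / l"
    proof -
      have "(\<Prod>k<a. (if k \<in> L then \<rho> else 1) / C) \<le> (\<Prod>k<a. n k)"
        using small large C \<rho>0 by (intro prod_mono) (auto simp: L_def not_less)
      then show ?thesis by (simp only: prod_n prod_dividef if_prod prod_constant card_lessThan)
    qed
    have cardL: "card L = a - 1"
    proof (rule ccontr)
      assume "card L \<noteq> a - 1"
      moreover have "card L \<le> a" using card_mono[OF _ L(1)] by simp
      ultimately consider "card L \<le> a - 2" | "card L = a" using a by linarith
      then show False
      proof cases
        case 1
        have "\<rho> * \<rho> ^ (a - 2) = \<rho> ^ (a - 1)" 
        proof -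
          have "a - 1 = Suc (a - 2)" using a by simp
          then show ?thesis by simp
        qed
        also have "\<dots> \<le> C ^ a * l * \<rho> ^ card L" using up l by (simp add: field_simps)
        also have "\<dots> \<le> C ^ a * l * \<rho> ^ (a - 2)"
          using 1 C l \<rho>1 by (intro mult_left_mono power_increasing) auto
        finally have "\<rho> \<le> C ^ a * l" using \<rho>0 by simp
        then show False using CK \<rho>K by simp
      next
        case 2
        have "\<rho> * \<rho> ^ (a - 1) = \<rho> ^ a" using a by (cases a) auto
        also have "\<dots> \<le> C ^ a / l * \<rho> ^ (a - 1)" using lo 2 C l by (simp add: field_simps)
        finally have "\<rho> \<le> C ^ a / l" using \<rho>0 by (simp only: mult_le_cancel_right_pos zero_less_power)
        then show False using CK \<rho>K by simp
      qed
    qed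
    have "card ({..<a} - L) = 1" using cardL L a by (subst card_Diff_subset) auto
    then obtain k0 where k0: "{..<a} - L = {k0}" by (auto simp: card_1_singleton_iff)
    show "\<exists>k0<a. \<forall>k<a.
       r powr (if k = k0 then 0 else - 1 / (real a - 1)) / C \<le> norm (zeta a (-1) 1 b k) \<and>
       norm (zeta a (-1) 1 b k) \<le> C * r powr (if k = k0 then 0 else - 1 / (real a - 1))"
    proof (intro exI[of _ k0] conjI allI impI)
      show "k0 < a" using k0 by auto
      fix k assume k: "k < a"
      have *: "(k = k0) = (\<not> n k > 2)" using k k0 by (auto simp: L_def)
      show "r powr (if k = k0 then 0 else - 1 / (real a - 1)) / C \<le> norm (zeta a (-1) 1 b k)"
        "norm (zeta a (-1) 1 b k) \<le> C * r powr (if k = k0 then 0 else - 1 / (real a - 1))"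
        unfolding * n_def[symmetric] q_def[symmetric] using small[OF k] large[OF k] r by (auto simp: \<rho>_def)
    qed
  qed
qed

text \<open>Once \<open>norm b > 2\<close>, a root of absolute value \<open>n > 1\<close> would
  violate \<open>norm b * n ^ a \<le> 1 + n\<close>. Hence \<open>n \<le> 1\<close> and
  \<open>norm b * n ^ a \<le> 2\<close>, which is the bound up to taking the \<open>a\<close>-th
  root.\<close>

lemma zeta_large_regime:
  fixes l :: real
  assumes a: "a \<ge> 2" and l: "l > 0"
  obtains C r0 where "C > 0" "r0 > 0"
    "\<And>r b k. 0 < r \<Longrightarrow> r < r0 \<Longrightarrow> norm b = l / r \<Longrightarrow> k < a \<Longrightarrow> norm (zeta a (-1) 1 b k) \<le> C * r powr (1 / real a)"
proof (rule that[of "(2 / l) powr (1 / real a)" "l / 2"])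
  show "(2 / l) powr (1 / real a) > 0" "l / 2 > 0" using l by auto
  fix r :: real and b :: complex and k assume r: "0 < r" "r < l / 2" and b: "norm b = l / r" and k: "k < a"
  define n where "n = norm (zeta a (-1) 1 b k)"
  have b2: "norm b > 2" unfolding b using r by (simp add: pos_less_divide_eq)
  then have b0: "b \<noteq> 0" by auto
  have eq: "norm b * n ^ a \<le> 1 + n"
    unfolding n_def norm_zeta_eq[OF a b0 k] using norm_triangle_ineq4[of 1 "zeta a (-1) 1 b k"] by simp
  have n1: "n \<le> 1"
  proof (rule ccontr)
    assume "\<not> n \<le> 1"
    then have n: "n > 1" by simp
    have "2 * n < norm b * n" using b2 n by simp
    also have "\<dots> \<le> norm b * n ^ a" using n a self_le_power[of n a] by (intro mult_left_mono) auto
    finally show False using eq n by simp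
  qed
  show "n \<le> (2 / l) powr (1 / real a) * r powr (1 / real a)"
  proof (cases "n = 0")
    case False
    then have n: "n > 0" by (simp add: n_def)
    have "l / r * n ^ a \<le> 2" using eq n1 b by simp
    then have "n ^ a \<le> 2 / l * r" using l r by (simp add: field_simps)
    then have "n powr real a \<le> 2 / l * r" using n by (simp add: powr_realpow)
    then have "n \<le> (2 / l * r) powr (1 / real a)"
      using powr_inverse_bounds(2)[of "real a" n] n a l r by simp
    also have "\<dots> = (2 / l) powr (1 / real a) * r powr (1 / real a)" by (rule powr_mult)
    finally show ?thesis .
  next
    case True
    then show ?thesis using r l by (metis mult_nonneg_nonneg powr_ge_zero)
  qed
qed

section \<open>Growth of the A-polynomial\<close>

text \<open>A choice is unbounded exactly on \<open>K\<close> if it takes one of the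
  \<open>\<alpha> k - 1\<close> large roots for each \<open>k \<in> K\<close> and the single bounded
  root elsewhere, which leaves \<open>NK \<alpha> K\<close> choices.\<close>

lemma sum_over_bounded_choices:
  fixes \<alpha> :: "'n::finite \<Rightarrow> nat" and g :: "'n set \<Rightarrow> real"
  assumes "\<And>i. k0 i < \<alpha> i"
  shows "(\<Sum>f\<in>root_choices \<alpha> UNIV. g {i. f i \<noteq> k0 i}) = (\<Sum>K\<in>UNIV. real (NK \<alpha> K) * g K)"
proof -
  have "{f \<in> root_choices \<alpha> UNIV. {i. f i \<noteq> k0 i} = K}
      = PiE UNIV (\<lambda>i. if i \<in> K then {..<\<alpha> i} - {k0 i} else {k0 i})" for K
    by (auto simp: PiE_iff split: if_splits) (metis assms)
  moreover have "card (PiE UNIV (\<lambda>i. if i \<in> K then {..<\<alpha> i} - {k0 i} else {k0 i})) = NK \<alpha> K" for K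
  proof -
    have "(\<Prod>i\<in>UNIV. card (if i \<in> K then {..<\<alpha> i} - {k0 i} else {k0 i})) = (\<Prod>i\<in>UNIV. if i \<in> K then \<alpha> i - 1 else 1)"
      using assms by (intro prod.cong) auto
    then show ?thesis by (simp add: card_PiE NK_def prod.If_cases)
  qed
  ultimately have card: "card {f \<in> root_choices \<alpha> UNIV. {i. f i \<noteq> k0 i} = K} = NK \<alpha> K" for K by simp
  have "finite (root_choices \<alpha> (UNIV :: 'n set))" by (intro finite_PiE) auto
  then have "(\<Sum>f\<in>root_choices \<alpha> UNIV. g {i. f i \<noteq> k0 i})
      = (\<Sum>K\<in>UNIV. \<Sum>f\<in>{f \<in> root_choices \<alpha> UNIV. {i. f i \<noteq> k0 i} = K}. g {i. f i \<noteq> k0 i})"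
    by (intro sum.group[symmetric]) auto
  also have "\<dots> = (\<Sum>K\<in>UNIV. \<Sum>f\<in>{f \<in> root_choices \<alpha> UNIV. {i. f i \<noteq> k0 i} = K}. g K)"
    by (intro sum.cong) auto
  finally show ?thesis by (simp add: card)
qed

instance avar :: (finite) finite
proof
  have "(UNIV :: 'a avar set) \<subseteq> insert Y (range X)"
  proof
    fix v :: "'a avar"
    show "v \<in> insert Y (range X)" by (cases v) auto
  qed
  then show "finite (UNIV :: 'a avar set)" by (rule finite_subset) auto
qed

text \<open>As \<open>x \<rightarrow> 0\<close>, a product of roots of the specialized \<open>F\<^sub>i\<close>, of which exactly those with
  \<open>i \<in> K\<close> are unbounded, has size \<open>norm x powr (- slope \<alpha> K)\<close>.\<close>

definition slope :: "('n \<Rightarrow> nat) \<Rightarrow> 'n set \<Rightarrow> real" where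
  "slope \<alpha> K = (\<Sum>k\<in>K. 1 / (real (\<alpha> k) - 1))"

locale quiver =
  fixes \<alpha> :: "'n::finite \<Rightarrow> nat" and lam :: "'n \<Rightarrow> complex"
  assumes \<alpha>: "\<And>i. \<alpha> i \<ge> 2" and lam: "\<And>i. lam i \<noteq> 0"
begin

abbreviation A :: "(2, complex) mpoly" where "A \<equiv> quiver_A \<alpha> lam"

definition Ptot :: nat where "Ptot = (\<Prod>i\<in>UNIV. \<alpha> i)"

text \<open>The power of \<open>x\<close> contributed by the leading coefficients of the
  trinomials.\<close>

definition Psum :: nat where "Psum = (\<Sum>i\<in>UNIV. \<Prod>j\<in>UNIV - {i}. \<alpha> j)"

definition bx :: "complex \<Rightarrow> 'n \<Rightarrow> complex" where "bx x i = (-1) ^ \<alpha> i * (lam i * x)"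

definition rpx :: "complex \<Rightarrow> ('n \<Rightarrow> nat) \<Rightarrow> complex" where
  "rpx x f = (\<Prod>i\<in>UNIV. zeta (\<alpha> i) (-1) 1 (bx x i) (f i))"

lemma card_choices_UNIV: "card (root_choices \<alpha> (UNIV :: 'n set)) = Ptot"
  by (simp add: card_PiE Ptot_def)

text \<open>As \<open>a_1 = -1\<close>, the products of roots are the roots in \<open>y\<close>.
  Passing to absolute values merges the integer factor, the signs and the \<open>lam i\<close> into
  one constant.\<close>

lemma norm_eval2_A:
  obtains c where "c > 0" "\<And>x y. x \<noteq> 0 \<Longrightarrow>
    norm (eval2 x y A) = c * norm x ^ Psum * (\<Prod>f\<in>root_choices \<alpha> UNIV. norm (y - rpx x f))"
proof -
  obtain k where k: "k \<noteq> 0" "quiver_resultant \<alpha> = of_int k * norm_poly \<alpha>"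
    by (rule quiver_resultant_eq_norm_poly[where \<alpha> = \<alpha>, OF \<alpha>])
  define c where "c = norm (of_int k :: complex) * (\<Prod>i\<in>UNIV. norm (lam i) ^ (\<Prod>j\<in>UNIV - {i}. \<alpha> j))"
  show ?thesis
  proof (rule that[of c])
    show "c > 0" unfolding c_def using k lam by (intro mult_pos_pos prod_pos) auto
    fix x y :: complex assume x: "x \<noteq> 0"
    define cc where "cc v = (case v of A0 \<Rightarrow> y | A1 \<Rightarrow> -1 | B0 i \<Rightarrow> -1 | B1 i \<Rightarrow> 1 | B2 i \<Rightarrow> bx x i)" for v
    have cc: "subst (\<lambda>v. eval2 x y (diagonal_vars lam v)) (specialize \<alpha> v) = cc v" for v
      by (cases v) (simp_all add: cc_def bx_def subst_hom.hom_uminus subst_hom.hom_mult subst_hom.hom_power eval2_hom.hom_mult)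
    have "eval2 x y A = subst (\<lambda>v. eval2 x y (diagonal_vars lam v)) (quiver_A_multi \<alpha>)"
      unfolding quiver_A_def by (rule hom_subst[OF eval2_hom.comm_ring_hom_axioms])
    also have "\<dots> = subst cc (quiver_resultant \<alpha>)"
      unfolding quiver_A_multi_def subst_subst cc ..
    also have "\<dots> = of_int k * subst cc (norm_poly \<alpha>)"
      by (simp add: k(2) subst_hom.hom_mult subst_hom.hom_of_int)
    also have "subst cc (norm_poly \<alpha>) = (\<Prod>i\<in>UNIV. cc (B2 i) ^ (\<Prod>j\<in>UNIV - {i}. \<alpha> j)) *
      (\<Prod>f\<in>root_choices \<alpha> UNIV. cc A0 + cc A1 * rootprod \<alpha> UNIV cc f)"
      using lam x by (intro norm_poly[OF \<alpha>]) (auto simp: cc_def bx_def split: qvar.splits)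
    also have "(\<Prod>f\<in>root_choices \<alpha> UNIV. cc A0 + cc A1 * rootprod \<alpha> UNIV cc f) = (\<Prod>f\<in>root_choices \<alpha> UNIV. y - rpx x f)"
      by (simp add: cc_def rootprod_def zt_def rpx_def)
    finally have "norm (eval2 x y A) = norm (of_int k :: complex) * ((\<Prod>i\<in>UNIV. norm (bx x i) ^ (\<Prod>j\<in>UNIV - {i}. \<alpha> j)) *
      (\<Prod>f\<in>root_choices \<alpha> UNIV. norm (y - rpx x f)))"
      by (simp only: norm_mult prod_norm[symmetric] norm_power cc_def qvar.case)
    also have "(\<Prod>i\<in>UNIV. norm (bx x i) ^ (\<Prod>j\<in>UNIV - {i}. \<alpha> j))
      = (\<Prod>i\<in>UNIV. norm (lam i) ^ (\<Prod>j\<in>UNIV - {i}. \<alpha> j)) * norm x ^ Psum"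
      by (simp add: bx_def norm_mult norm_power power_mult_distrib prod.distrib Psum_def power_sum)
    finally show "norm (eval2 x y A) = c * norm x ^ Psum * (\<Prod>f\<in>root_choices \<alpha> UNIV. norm (y - rpx x f))"
      by (simp add: c_def mult_ac)
  qed
qed

lemma norm_bx: "norm (bx x i) = norm (lam i) * norm x"
  by (simp add: bx_def norm_mult norm_power)

text \<open>The position \<open>k0\<close> of the bounded roots may jump with \<open>x\<close>, as
  the roots are numbered by choice. This does no harm, because the later estimates only use how many
  products have each size.\<close>

lemma rpx_small:
  obtains C r0 where "C \<ge> 1" "r0 > 0" "r0 \<le> 1"
    "\<And>r x. 0 < r \<Longrightarrow> r < r0 \<Longrightarrow> norm x = r \<Longrightarrow> \<exists>k0. (\<forall>i. k0 i < \<alpha> i) \<and> (\<forall>f\<in>root_choices \<alpha> UNIV.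
       r powr (- slope \<alpha> {i. f i \<noteq> k0 i}) / C \<le> norm (rpx x f) \<and> norm (rpx x f) \<le> C * r powr (- slope \<alpha> {i. f i \<noteq> k0 i}))"
proof -
  define ex where "ex k k0 i = (if k = k0 then 0 else - 1 / (real (\<alpha> i) - 1))" for k k0 :: nat and i
  have "\<exists>C r0. C \<ge> 1 \<and> r0 > 0 \<and> (\<forall>r b. 0 < r \<longrightarrow> r < r0 \<longrightarrow> norm b = norm (lam i) * r \<longrightarrow> (\<exists>k0<\<alpha> i. \<forall>k<\<alpha> i.
       r powr ex k k0 i / C \<le> norm (zeta (\<alpha> i) (-1) 1 b k) \<and>
       norm (zeta (\<alpha> i) (-1) 1 b k) \<le> C * r powr ex k k0 i))" for i
  proof -
    have "norm (lam i) > 0" using lam by simp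
    from zeta_small_regime[OF \<alpha> this] show ?thesis unfolding ex_def by metis
  qed
  then obtain Ci Ri where Ci: "\<And>i. Ci i \<ge> 1" and Ri: "\<And>i. Ri i > 0" and
    bd: "\<And>i r b. 0 < r \<Longrightarrow> r < Ri i \<Longrightarrow> norm b = norm (lam i) * r \<Longrightarrow> \<exists>k0<\<alpha> i. \<forall>k<\<alpha> i.
       r powr ex k k0 i / Ci i \<le> norm (zeta (\<alpha> i) (-1) 1 b k) \<and>
       norm (zeta (\<alpha> i) (-1) 1 b k) \<le> Ci i * r powr ex k k0 i" by metis
  define r0 where "r0 = Min (insert 1 (range Ri))"
  have r0: "r0 \<le> 1" "r0 \<le> Ri i" "r0 > 0" for i
    unfolding r0_def using Ri by (auto intro!: Min_le simp del: Min_insert)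
  have prodC: "(\<Prod>i\<in>UNIV. Ci i) \<ge> 1" using Ci by (intro prod_ge_1) auto
  show ?thesis
  proof (rule that[OF prodC r0(3) r0(1)])
    fix r :: real and x :: complex assume r: "0 < r" "r < r0" and x: "norm x = r"
    have "\<exists>k0<\<alpha> i. \<forall>k<\<alpha> i. r powr ex k k0 i / Ci i \<le> norm (zeta (\<alpha> i) (-1) 1 (bx x i) k) \<and>
       norm (zeta (\<alpha> i) (-1) 1 (bx x i) k) \<le> Ci i * r powr ex k k0 i" for i
      using r r0(2)[of i] by (intro bd) (auto simp: norm_bx x)
    then obtain k0 where k0: "\<And>i. k0 i < \<alpha> i" and
      z: "\<And>i k. k < \<alpha> i \<Longrightarrow> r powr ex k (k0 i) i / Ci i \<le> norm (zeta (\<alpha> i) (-1) 1 (bx x i) k) \<and>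
       norm (zeta (\<alpha> i) (-1) 1 (bx x i) k) \<le> Ci i * r powr ex k (k0 i) i" by metis
    show "\<exists>k0. (\<forall>i. k0 i < \<alpha> i) \<and> (\<forall>f\<in>root_choices \<alpha> UNIV.
       r powr (- slope \<alpha> {i. f i \<noteq> k0 i}) / (\<Prod>i\<in>UNIV. Ci i) \<le> norm (rpx x f) \<and>
       norm (rpx x f) \<le> (\<Prod>i\<in>UNIV. Ci i) * r powr (- slope \<alpha> {i. f i \<noteq> k0 i}))"
    proof (intro exI[of _ k0] conjI allI ballI k0)
      fix f assume "f \<in> root_choices \<alpha> (UNIV :: 'n set)"
      then have f: "f i < \<alpha> i" for i by (auto simp: PiE_iff)
      have "(\<Sum>i\<in>UNIV. ex (f i) (k0 i) i) = - slope \<alpha> {i. f i \<noteq> k0 i}"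
        unfolding slope_def ex_def sum_negf[symmetric] by (rule sum.mono_neutral_cong_right) auto
      then have pw: "(\<Prod>i\<in>UNIV. r powr ex (f i) (k0 i) i) = r powr (- slope \<alpha> {i. f i \<noteq> k0 i})"
        using r by (simp add: powr_sum[symmetric])
      have nr: "norm (rpx x f) = (\<Prod>i\<in>UNIV. norm (zeta (\<alpha> i) (-1) 1 (bx x i) (f i)))"
        by (simp add: rpx_def prod_norm)
      have C0: "Ci i > 0" for i using Ci[of i] by simp
      have "(\<Prod>i\<in>UNIV. r powr ex (f i) (k0 i) i / Ci i) \<le> norm (rpx x f)"
        unfolding nr using z[OF f] C0 by (intro prod_mono conjI) (auto simp: less_imp_le)
      then show "r powr (- slope \<alpha> {i. f i \<noteq> k0 i}) / (\<Prod>i\<in>UNIV. Ci i) \<le> norm (rpx x f)"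
        by (simp only: prod_dividef pw)
      have "norm (rpx x f) \<le> (\<Prod>i\<in>UNIV. Ci i * r powr ex (f i) (k0 i) i)"
        unfolding nr using z[OF f] by (intro prod_mono conjI) auto
      then show "norm (rpx x f) \<le> (\<Prod>i\<in>UNIV. Ci i) * r powr (- slope \<alpha> {i. f i \<noteq> k0 i})"
        by (simp only: prod.distrib pw)
    qed
  qed
qed

lemma rpx_large:
  obtains C r0 where "C > 0" "r0 > 0"
    "\<And>r x f. 0 < r \<Longrightarrow> r < r0 \<Longrightarrow> norm x = 1 / r \<Longrightarrow> f \<in> root_choices \<alpha> UNIV \<Longrightarrow>
       norm (rpx x f) \<le> C * r powr (\<Sum>i\<in>UNIV. 1 / real (\<alpha> i))"
proof -
  have "\<exists>C r0. C > 0 \<and> r0 > 0 \<and> (\<forall>r b k. 0 < r \<longrightarrow> r < r0 \<longrightarrow> norm b = norm (lam i) / r \<longrightarrow> k < \<alpha> i \<longrightarrow>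
       norm (zeta (\<alpha> i) (-1) 1 b k) \<le> C * r powr (1 / real (\<alpha> i)))" for i
  proof -
    have "norm (lam i) > 0" using lam by simp
    from zeta_large_regime[OF \<alpha> this] show ?thesis by metis
  qed
  then obtain Ci Ri where Ci: "\<And>i. Ci i > 0" and Ri: "\<And>i. Ri i > 0" and
    bd: "\<And>i r b k. 0 < r \<Longrightarrow> r < Ri i \<Longrightarrow> norm b = norm (lam i) / r \<Longrightarrow> k < \<alpha> i \<Longrightarrow>
       norm (zeta (\<alpha> i) (-1) 1 b k) \<le> Ci i * r powr (1 / real (\<alpha> i))" by metis
  define r0 where "r0 = Min (range Ri)"
  have r0: "r0 \<le> Ri i" "r0 > 0" for i
    unfolding r0_def using Ri by (auto intro!: Min_le)
  have prodC: "(\<Prod>i\<in>UNIV. Ci i) > 0" using Ci by (intro prod_pos) auto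
  show ?thesis
  proof (rule that[OF prodC r0(2)])
    fix r :: real and x :: complex and f
    assume r: "0 < r" "r < r0" and x: "norm x = 1 / r" and f: "f \<in> root_choices \<alpha> (UNIV :: 'n set)"
    have "norm (rpx x f) = (\<Prod>i\<in>UNIV. norm (zeta (\<alpha> i) (-1) 1 (bx x i) (f i)))"
      by (simp add: rpx_def prod_norm)
    also have "\<dots> \<le> (\<Prod>i\<in>UNIV. Ci i * r powr (1 / real (\<alpha> i)))"
    proof (intro prod_mono conjI)
      fix i
      show "norm (zeta (\<alpha> i) (-1) 1 (bx x i) (f i)) \<le> Ci i * r powr (1 / real (\<alpha> i))"
        using r r0(1)[of i] f by (intro bd) (auto simp: norm_bx x PiE_iff)
    qed auto
    also have "\<dots> = (\<Prod>i\<in>UNIV. Ci i) * r powr (\<Sum>i\<in>UNIV. 1 / real (\<alpha> i))"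
      using r by (simp add: prod.distrib powr_sum)
    finally show "norm (rpx x f) \<le> (\<Prod>i\<in>UNIV. Ci i) * r powr (\<Sum>i\<in>UNIV. 1 / real (\<alpha> i))" .
  qed
qed

text \<open>The order in \<open>r\<close> of the A-polynomial at generic points with
  \<open>norm x = r\<close> and \<open>norm y = r powr (- s)\<close>: the larger of \<open>y\<close>
  and the root decides the size of each factor.\<close>

definition low :: "real \<Rightarrow> real" where
  "low s = real Psum - (\<Sum>K\<in>UNIV. real (NK \<alpha> K) * max s (slope \<alpha> K))"

lemma low_eq:
  assumes "\<And>i. k0 i < \<alpha> i" "r > 0"
  shows "r ^ Psum * (\<Prod>f\<in>root_choices \<alpha> UNIV. r powr (- max s (slope \<alpha> {i. f i \<noteq> k0 i}))) = r powr low s"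
proof -
  have "(\<Prod>f\<in>root_choices \<alpha> UNIV. r powr (- max s (slope \<alpha> {i. f i \<noteq> k0 i})))
      = r powr (\<Sum>f\<in>root_choices \<alpha> UNIV. - max s (slope \<alpha> {i. f i \<noteq> k0 i}))"
    using assms(2) by (simp add: powr_sum)
  also have "(\<Sum>f\<in>root_choices \<alpha> UNIV. - max s (slope \<alpha> {i. f i \<noteq> k0 i})) = - (\<Sum>K\<in>UNIV. real (NK \<alpha> K) * max s (slope \<alpha> K))"
    using sum_over_bounded_choices[OF assms(1), of "\<lambda>K. max s (slope \<alpha> K)"] by (simp add: sum_negf)
  finally show ?thesis
    using assms(2) by (simp add: low_def powr_diff powr_minus_divide powr_realpow)
qed

theorem keys_A_low:
  assumes "e \<in> Poly_Mapping.keys A"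
  shows "low s \<le> weight 1 (- s) e"
proof -
  obtain c where c: "c > 0" "\<And>x y. x \<noteq> 0 \<Longrightarrow>
    norm (eval2 x y A) = c * norm x ^ Psum * (\<Prod>f\<in>root_choices \<alpha> UNIV. norm (y - rpx x f))"
    by (rule norm_eval2_A) blast
  obtain C r0 where C: "C \<ge> 1" and r0: "r0 > 0" "r0 \<le> 1" and
    bd: "\<And>r x. 0 < r \<Longrightarrow> r < r0 \<Longrightarrow> norm x = r \<Longrightarrow> \<exists>k0. (\<forall>i. k0 i < \<alpha> i) \<and> (\<forall>f\<in>root_choices \<alpha> UNIV.
       r powr (- slope \<alpha> {i. f i \<noteq> k0 i}) / C \<le> norm (rpx x f) \<and> norm (rpx x f) \<le> C * r powr (- slope \<alpha> {i. f i \<noteq> k0 i}))"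
    by (rule rpx_small) blast
  show ?thesis
  proof (rule weight_ge_if_curve_le[OF r0(1) _ assms, where C = "c * (1 + C) ^ Ptot"])
    fix r :: real and u w :: complex assume r: "0 < r" "r < r0" and u: "norm u = 1" "norm w = 1"
    define x where "x = of_real (r powr 1) * u"
    define y where "y = of_real (r powr (- s)) * w"
    have x: "norm x = r" "x \<noteq> 0" and y: "norm y = r powr (- s)"
      using r u by (auto simp: x_def y_def norm_mult)
    obtain k0 where k0: "\<And>i. k0 i < \<alpha> i" and
      z: "\<And>f. f \<in> root_choices \<alpha> UNIV \<Longrightarrow> norm (rpx x f) \<le> C * r powr (- slope \<alpha> {i. f i \<noteq> k0 i})"
      using bd[OF r x(1)] by blast
    have fac: "norm (y - rpx x f) \<le> (1 + C) * r powr (- max s (slope \<alpha> {i. f i \<noteq> k0 i}))"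
      if f: "f \<in> root_choices \<alpha> UNIV" for f
    proof -
      let ?m = "r powr (- max s (slope \<alpha> {i. f i \<noteq> k0 i}))"
      have "r powr (- s) \<le> ?m" "r powr (- slope \<alpha> {i. f i \<noteq> k0 i}) \<le> ?m"
        using r r0 by (auto intro!: powr_mono')
      then have "norm y \<le> ?m" "norm (rpx x f) \<le> C * ?m"
        using y z[OF f] C by (auto intro: order_trans mult_left_mono)
      then show ?thesis using norm_triangle_ineq4[of y "rpx x f"] by (simp add: distrib_right)
    qed
    have "norm (curve 1 (- s) r u w A) = c * r ^ Psum * (\<Prod>f\<in>root_choices \<alpha> UNIV. norm (y - rpx x f))"
      unfolding curve_def x_def[symmetric] y_def[symmetric] c(2)[OF x(2)] x(1) ..
    also have "\<dots> \<le> c * r ^ Psum * (\<Prod>f\<in>root_choices \<alpha> UNIV. (1 + C) * r powr (- max s (slope \<alpha> {i. f i \<noteq> k0 i})))"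
      using c(1) r fac by (intro mult_left_mono prod_mono conjI) auto
    also have "\<dots> = c * (1 + C) ^ Ptot * (r ^ Psum * (\<Prod>f\<in>root_choices \<alpha> UNIV. r powr (- max s (slope \<alpha> {i. f i \<noteq> k0 i}))))"
      unfolding prod.distrib prod_constant card_choices_UNIV by (simp only: mult_ac)
    also have "\<dots> = c * (1 + C) ^ Ptot * r powr low s" by (simp only: low_eq[OF k0 r(1)])
    finally show "norm (curve 1 (- s) r u w A) \<le> c * (1 + C) ^ Ptot * r powr low s" .
  qed
qed

text \<open>If \<open>s\<close> is not a slope, \<open>y\<close> and each root have different
  orders, so no factor \<open>y - rpx x f\<close> can become small by cancellation.\<close>

theorem keys_A_attained:
  assumes s: "s \<notin> range (slope \<alpha>)"
  shows "\<exists>e\<in>Poly_Mapping.keys A. weight 1 (- s) e \<le> low s"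
proof -
  obtain c where c: "c > 0" "\<And>x y. x \<noteq> 0 \<Longrightarrow>
    norm (eval2 x y A) = c * norm x ^ Psum * (\<Prod>f\<in>root_choices \<alpha> UNIV. norm (y - rpx x f))"
    by (rule norm_eval2_A) blast
  obtain C r0 where C: "C \<ge> 1" and r0: "r0 > 0" "r0 \<le> 1" and
    bd: "\<And>r x. 0 < r \<Longrightarrow> r < r0 \<Longrightarrow> norm x = r \<Longrightarrow> \<exists>k0. (\<forall>i. k0 i < \<alpha> i) \<and> (\<forall>f\<in>root_choices \<alpha> UNIV.
       r powr (- slope \<alpha> {i. f i \<noteq> k0 i}) / C \<le> norm (rpx x f) \<and> norm (rpx x f) \<le> C * r powr (- slope \<alpha> {i. f i \<noteq> k0 i}))"
    by (rule rpx_small) blast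
  define \<delta> where "\<delta> = Min ((\<lambda>K. \<bar>s - slope \<alpha> K\<bar>) ` UNIV)"
  have \<delta>: "\<delta> \<le> \<bar>s - slope \<alpha> K\<bar>" for K unfolding \<delta>_def by (intro Min_le) auto
  have "0 < \<bar>s - slope \<alpha> K\<bar>" for K using s by auto
  then have \<delta>0: "\<delta> > 0" unfolding \<delta>_def by (subst Min_gr_iff) auto
  \<comment> \<open>This makes \<open>r powr \<delta>\<close> at most \<open>1 / (2 * C)\<close>, so
    the smaller of \<open>y\<close> and the root is at most half of the lower bound for the larger
    one.\<close>
  define r1 where "r1 = min r0 ((1 / (2 * C)) powr (1 / \<delta>))"
  have r1: "r1 > 0" "r1 \<le> r0" "r1 \<le> (1 / (2 * C)) powr (1 / \<delta>)" unfolding r1_def using r0 C by auto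
  show ?thesis
  proof (rule weight_le_if_curve_ge[OF r1(1), where c = "c * (1 / (2 * C)) ^ Ptot"])
    show "c * (1 / (2 * C)) ^ Ptot > 0" using c(1) C by simp
    fix r :: real assume r: "0 < r" "r < r1"
    have gap: "r powr d \<le> 1 / (2 * C)" if "d \<ge> \<delta>" for d
    proof -
      have "r powr d \<le> r powr \<delta>" using r r1 r0 that by (intro powr_mono') auto
      also have "\<dots> \<le> ((1 / (2 * C)) powr (1 / \<delta>)) powr \<delta>" using r r1 \<delta>0 by (intro powr_mono2) auto
      also have "\<dots> = 1 / (2 * C)" using \<delta>0 C by (simp add: powr_powr)
      finally show ?thesis .
    qed
    define x where "x = complex_of_real (r powr 1) * 1"
    define y where "y = complex_of_real (r powr (- s)) * 1"
    have x: "norm x = r" "x \<noteq> 0" and y: "norm y = r powr (- s)" using r by (auto simp: x_def y_def)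
    obtain k0 where k0: "\<And>i. k0 i < \<alpha> i" and
      z: "\<And>f. f \<in> root_choices \<alpha> UNIV \<Longrightarrow> r powr (- slope \<alpha> {i. f i \<noteq> k0 i}) / C \<le> norm (rpx x f) \<and>
         norm (rpx x f) \<le> C * r powr (- slope \<alpha> {i. f i \<noteq> k0 i})"
      using bd[OF r(1) less_le_trans[OF r(2) r1(2)] x(1)] by blast
    have fac: "1 / (2 * C) * r powr (- max s (slope \<alpha> {i. f i \<noteq> k0 i})) \<le> norm (y - rpx x f)"
      if f: "f \<in> root_choices \<alpha> UNIV" for f
    proof -
      define \<sigma> where "\<sigma> = slope \<alpha> {i. f i \<noteq> k0 i}"
      have zf: "r powr (- \<sigma>) / C \<le> norm (rpx x f)" "norm (rpx x f) \<le> C * r powr (- \<sigma>)" using z[OF f] by (auto simp: \<sigma>_def)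
      consider "s > \<sigma>" "s - \<sigma> \<ge> \<delta>" | "\<sigma> > s" "\<sigma> - s \<ge> \<delta>" 
      proof -
        have d: "\<delta> \<le> \<bar>s - \<sigma>\<bar>" unfolding \<sigma>_def by (rule \<delta>)
        show thesis
        proof (cases "s > \<sigma>")
          case True
          then show ?thesis using that(1) d by simp
        next
          case False
          then have "\<sigma> - s \<ge> \<delta>" using d by simp
          then show ?thesis using that(2) \<delta>0 by simp
        qed
      qed
      then show ?thesis
      proof cases
        case 1
        have "C * r powr (- \<sigma>) = C * r powr (s - \<sigma>) * r powr (- s)" using r by (simp flip: powr_add)
        also have "\<dots> \<le> C * (1 / (2 * C)) * r powr (- s)" using gap[OF 1(2)] C by (intro mult_right_mono mult_left_mono) auto
        finally have "norm (rpx x f) \<le> 1 / 2 * r powr (- s)" using zf(2) C by simp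
        then have "1 / 2 * r powr (- s) \<le> norm (y - rpx x f)" using norm_triangle_ineq2[of y "rpx x f"] y by simp
        moreover have "1 / (2 * C) * r powr (- s) \<le> 1 / 2 * r powr (- s)" using C by (intro mult_right_mono) (auto simp: field_simps)
        ultimately show ?thesis using 1 by (simp add: \<sigma>_def[symmetric] max_def)
      next
        case 2
        have "r powr (- s) = r powr (\<sigma> - s) * r powr (- \<sigma>)" using r by (simp flip: powr_add)
        also have "\<dots> \<le> 1 / (2 * C) * r powr (- \<sigma>)" using gap[OF 2(2)] by (intro mult_right_mono) auto
        finally have "norm y \<le> 1 / (2 * C) * r powr (- \<sigma>)" using y by simp
        moreover have "r powr (- \<sigma>) / C = 1 / (2 * C) * r powr (- \<sigma>) + 1 / (2 * C) * r powr (- \<sigma>)"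
          using C by (simp add: field_simps)
        ultimately have "1 / (2 * C) * r powr (- \<sigma>) \<le> norm (y - rpx x f)"
          using zf(1) norm_triangle_ineq2[of "rpx x f" y] by (simp add: norm_minus_commute)
        then show ?thesis using 2 by (simp add: \<sigma>_def[symmetric] max_def)
      qed
    qed
    have "c * (1 / (2 * C)) ^ Ptot * r powr low s
      = c * (1 / (2 * C)) ^ Ptot * (r ^ Psum * (\<Prod>f\<in>root_choices \<alpha> UNIV. r powr (- max s (slope \<alpha> {i. f i \<noteq> k0 i}))))"
      by (simp only: low_eq[OF k0 r(1)])
    also have "\<dots> = c * r ^ Psum * (\<Prod>f\<in>root_choices \<alpha> UNIV. 1 / (2 * C) * r powr (- max s (slope \<alpha> {i. f i \<noteq> k0 i})))"
      unfolding prod.distrib prod_constant card_choices_UNIV by (simp only: mult_ac)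
    also have "\<dots> \<le> c * r ^ Psum * (\<Prod>f\<in>root_choices \<alpha> UNIV. norm (y - rpx x f))"
      using c(1) r fac C by (intro mult_left_mono prod_mono conjI) auto
    also have "\<dots> = norm (curve 1 (- s) r 1 1 A)"
      unfolding curve_def x_def[symmetric] y_def[symmetric] c(2)[OF x(2)] x(1) ..
    finally show "c * (1 / (2 * C)) ^ Ptot * r powr low s \<le> norm (curve 1 (- s) r 1 1 A)" .
  qed
qed

lemma Psum_eq: "real Psum = real Ptot * (\<Sum>i\<in>UNIV. 1 / real (\<alpha> i))"
proof -
  have "real (\<Prod>j\<in>UNIV - {i}. \<alpha> j) = real Ptot * (1 / real (\<alpha> i))" for i
    using \<alpha>[of i] unfolding Ptot_def by (subst prod.remove[of UNIV i]) auto
  then show ?thesis by (simp add: Psum_def sum_distrib_left)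
qed

text \<open>Near \<open>x = \<infinity>\<close> all products of roots share one bound, and
  \<open>Psum_eq\<close> makes the powers of \<open>r\<close> cancel. The resulting supporting line
  passes through the origin.\<close>

theorem keys_A_high:
  assumes "e \<in> Poly_Mapping.keys A"
  shows "0 \<le> weight (- 1) (\<Sum>i\<in>UNIV. 1 / real (\<alpha> i)) e"
proof -
  define \<tau> where "\<tau> = (\<Sum>i\<in>UNIV. 1 / real (\<alpha> i))"
  obtain c where c: "c > 0" "\<And>x y. x \<noteq> 0 \<Longrightarrow>
    norm (eval2 x y A) = c * norm x ^ Psum * (\<Prod>f\<in>root_choices \<alpha> UNIV. norm (y - rpx x f))"
    by (rule norm_eval2_A) blast
  obtain C r0 where C: "C > 0" and r0: "r0 > 0" and
    bd: "\<And>r x f. 0 < r \<Longrightarrow> r < r0 \<Longrightarrow> norm x = 1 / r \<Longrightarrow> f \<in> root_choices \<alpha> UNIV \<Longrightarrow> norm (rpx x f) \<le> C * r powr \<tau>"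
    unfolding \<tau>_def by (rule rpx_large) blast
  have "0 \<le> weight (- 1) \<tau> e"
  proof (rule weight_ge_if_curve_le[OF r0(1) _ assms, where C = "c * (1 + C) ^ Ptot"])
    fix r :: real and u w :: complex assume r: "0 < r" "r < r0" and u: "norm u = 1" "norm w = 1"
    define x where "x = of_real (r powr - 1) * u"
    define y where "y = of_real (r powr \<tau>) * w"
    have x: "norm x = 1 / r" "x \<noteq> 0" and y: "norm y = r powr \<tau>"
      using r u by (auto simp: x_def y_def norm_mult norm_divide powr_minus_divide)
    have fac: "norm (y - rpx x f) \<le> (1 + C) * r powr \<tau>" if f: "f \<in> root_choices \<alpha> UNIV" for f
      using norm_triangle_ineq4[of y "rpx x f"] bd[OF r x(1) f] y by (simp add: distrib_right)
    have "norm (curve (- 1) \<tau> r u w A) = c * (1 / r) ^ Psum * (\<Prod>f\<in>root_choices \<alpha> UNIV. norm (y - rpx x f))"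
      unfolding curve_def x_def[symmetric] y_def[symmetric] c(2)[OF x(2)] x(1) ..
    also have "\<dots> \<le> c * (1 / r) ^ Psum * (\<Prod>f\<in>root_choices \<alpha> (UNIV :: 'n set). (1 + C) * r powr \<tau>)"
      using c(1) r fac by (intro mult_left_mono prod_mono conjI) auto
    also have "\<dots> = c * (1 + C) ^ Ptot * ((1 / r) ^ Psum * (r powr \<tau>) ^ Ptot)"
      unfolding prod_constant card_choices_UNIV power_mult_distrib by (simp only: mult_ac)
    also have "(1 / r) ^ Psum * (r powr \<tau>) ^ Ptot = r powr 0"
    proof -
      have "(r powr \<tau>) ^ Ptot = r powr real Psum"
        using r by (simp add: Psum_eq \<tau>_def powr_powr mult.commute flip: powr_realpow)
      then show ?thesis using r by (simp add: powr_realpow power_one_over)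
    qed
    finally show "norm (curve (- 1) \<tau> r u w A) \<le> c * (1 + C) ^ Ptot * r powr 0" .
  qed
  then show ?thesis by (simp add: \<tau>_def)
qed

end

section \<open>The polygon of a finite family of slopes\<close>

no_notation Matrix.vec_index (infixl \<open>$\<close> 100)

lemma vec2_eq_iff: "p = q \<longleftrightarrow> p $ 1 = q $ 1 \<and> p $ 2 = q $ 2" for p q :: "real ^ 2"
  by (auto simp: Finite_Cartesian_Product.vec_eq_iff forall_2)

lemma inner2: "a \<bullet> p = a $ 1 * p $ 1 + a $ 2 * p $ 2" for a p :: "real ^ 2"
  by (simp add: inner_vec_def sum_2)

lemma segment_lineI:
  fixes a b p :: "real ^ 2"
  assumes "a $ 2 \<le> p $ 2" "p $ 2 \<le> b $ 2" and "p $ 1 - a $ 1 = s * (p $ 2 - a $ 2)" "b $ 1 - a $ 1 = s * (b $ 2 - a $ 2)"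
  shows "p \<in> closed_segment a b"
proof (cases "b $ 2 = a $ 2")
  case True
  then have "p = a" using assms by (simp add: vec2_eq_iff)
  then show ?thesis by simp
next
  case False
  then have d: "b $ 2 - a $ 2 > 0" using assms by simp
  define u where "u = (p $ 2 - a $ 2) / (b $ 2 - a $ 2)"
  have u: "0 \<le> u" "u \<le> 1" "u * (b $ 2 - a $ 2) = p $ 2 - a $ 2" using assms d by (auto simp: u_def)
  have "p $ 1 - a $ 1 = u * (b $ 1 - a $ 1)" unfolding assms(3,4) u(3)[symmetric] by simp
  then have "p = (1 - u) *\<^sub>R a + u *\<^sub>R b" using u(3) by (simp add: vec2_eq_iff algebra_simps)
  then show ?thesis using u by (auto simp: closed_segment_def)
qed

text \<open>The convex geometry apart from its origin: \<open>E\<close> lies in half-planes given by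
  the piecewise linear function \<open>h\<close>, touches them away from the breakpoints, and lies
  on one side of the line through 0 with direction \<open>(\<tau>, 1)\<close>. The equation for
  \<open>\<tau>\<close> says that the chain of the vectors \<open>N k * (\<sigma> k, 1)\<close> ends
  on that line.\<close>

locale slope_polygon =
  fixes N \<sigma> :: "'k::finite \<Rightarrow> real" and E :: "(real ^ 2) set" and h :: "real \<Rightarrow> real" and \<tau> :: real
  assumes N: "\<And>k. N k > 0" and \<sigma>: "\<And>k. \<sigma> k \<ge> 0" and \<sigma>_zero: "\<exists>k. \<sigma> k = 0" and \<sigma>_pos: "\<exists>k. \<sigma> k > 0"
    and E: "finite E"
    and h_def: "h = (\<lambda>s. \<Sum>k\<in>UNIV. N k * max 0 (s - \<sigma> k))"
    and E_low: "\<And>e s. e \<in> E \<Longrightarrow> s * e $ 2 - h s \<le> e $ 1"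
    and E_att: "\<And>s. s \<notin> range \<sigma> \<Longrightarrow> \<exists>e\<in>E. e $ 1 \<le> s * e $ 2 - h s"
    and E_high: "\<And>e. e \<in> E \<Longrightarrow> e $ 1 \<le> \<tau> * e $ 2"
    and \<tau>: "(\<Sum>k\<in>UNIV. N k * \<sigma> k) = \<tau> * (\<Sum>k\<in>UNIV. N k)"
begin

text \<open>With the vectors \<open>N k * (\<sigma> k, 1)\<close> ordered by slope,
  \<open>V s\<close> and \<open>W s\<close> are the partial sums before and after those with
  \<open>\<sigma> k = s\<close>, hence the ends of the edge of slope \<open>s\<close>.\<close>

definition vx :: "real \<Rightarrow> real" where "vx s = (\<Sum>k | \<sigma> k < s. N k * \<sigma> k)"
definition vy :: "real \<Rightarrow> real" where "vy s = (\<Sum>k | \<sigma> k < s. N k)"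
definition wx :: "real \<Rightarrow> real" where "wx s = (\<Sum>k | \<sigma> k \<le> s. N k * \<sigma> k)"
definition wy :: "real \<Rightarrow> real" where "wy s = (\<Sum>k | \<sigma> k \<le> s. N k)"
definition V :: "real \<Rightarrow> real ^ 2" where "V s = vector [vx s, vy s]"
definition W :: "real \<Rightarrow> real ^ 2" where "W s = vector [wx s, wy s]"
definition top :: "real ^ 2" where "top = vector [\<Sum>k\<in>UNIV. N k * \<sigma> k, \<Sum>k\<in>UNIV. N k]"

abbreviation S :: "(real ^ 2) set" where "S \<equiv> convex hull E"

lemma V_comp [simp]: "V s $ 1 = vx s" "V s $ 2 = vy s" and W_comp [simp]: "W s $ 1 = wx s" "W s $ 2 = wy s"
  and top_comp [simp]: "top $ 1 = (\<Sum>k\<in>UNIV. N k * \<sigma> k)" "top $ 2 = (\<Sum>k\<in>UNIV. N k)"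
  by (simp_all add: V_def W_def top_def)

text \<open>Indices with \<open>\<sigma> k = t\<close> contribute 0 and may be placed on either
  side, so one formula serves strict and weak inequalities.\<close>

lemma h_eq:
  assumes "\<And>k. k \<in> T \<Longrightarrow> \<sigma> k \<le> t" "\<And>k. k \<notin> T \<Longrightarrow> t \<le> \<sigma> k"
  shows "h t = t * (\<Sum>k\<in>T. N k) - (\<Sum>k\<in>T. N k * \<sigma> k)"
proof -
  have "h t = (\<Sum>k\<in>T. N k * (t - \<sigma> k))"
    unfolding h_def using assms by (intro sum.mono_neutral_cong_right) auto
  then show ?thesis by (simp add: sum_distrib_left sum_subtractf right_diff_distrib mult.commute)
qed

lemma h_V: "h s = s * vy s - vx s" and h_W: "h s = s * wy s - wx s"
  unfolding vx_def vy_def wx_def wy_def by (rule h_eq; simp)+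

lemma exists_left: "\<exists>t<s. \<forall>k. \<sigma> k < s \<longrightarrow> \<sigma> k < t"
proof -
  define m where "m = Max (insert (s - 1) (\<sigma> ` {k. \<sigma> k < s}))"
  have "m < s" unfolding m_def by (subst Max_less_iff) auto
  moreover have "\<sigma> k \<le> m" if "\<sigma> k < s" for k unfolding m_def using that by (intro Max_ge) auto
  ultimately show ?thesis by (intro exI[of _ "(m + s) / 2"]) (fastforce simp: field_simps)
qed

lemma exists_right: "\<exists>t>s. \<forall>k. s < \<sigma> k \<longrightarrow> t < \<sigma> k"
proof -
  define m where "m = Min (insert (s + 1) (\<sigma> ` {k. s < \<sigma> k}))"
  have "m > s" unfolding m_def by (subst Min_gr_iff) auto
  moreover have "m \<le> \<sigma> k" if "s < \<sigma> k" for k unfolding m_def using that by (intro Min_le) auto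
  ultimately show ?thesis by (intro exI[of _ "(m + s) / 2"]) (fastforce simp: field_simps)
qed

text \<open>Just left of \<open>s\<close> the function \<open>h\<close> is linear with slope
  \<open>vy s\<close>, just right of it with slope \<open>wy s\<close>. A point whose line touches
  \<open>h\<close> at \<open>s\<close> has its height between these two.\<close>

lemma supporting_line_bounds:
  assumes low: "\<And>t. t * p $ 2 - h t \<le> p $ 1" and eq: "p $ 1 = s * p $ 2 - h s"
  shows "vy s \<le> p $ 2" "p $ 2 \<le> wy s"
proof -
  obtain t where t: "t < s" "\<And>k. \<sigma> k < s \<Longrightarrow> \<sigma> k < t" using exists_left by blast
  have "h t = t * vy s - vx s"
    unfolding vy_def vx_def
  proof (rule h_eq)
    show "\<sigma> k \<le> t" if "k \<in> {k. \<sigma> k < s}" for k using that t(2)[of k] by simp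
    show "t \<le> \<sigma> k" if "k \<notin> {k. \<sigma> k < s}" for k using that t(1) by simp
  qed
  then have "(s - t) * vy s \<le> (s - t) * p $ 2" using low[of t] eq h_V[of s] by (simp add: algebra_simps)
  then show "vy s \<le> p $ 2" using t(1) by simp
  obtain t where t: "t > s" "\<And>k. s < \<sigma> k \<Longrightarrow> t < \<sigma> k" using exists_right by blast
  have "h t = t * wy s - wx s"
    unfolding wy_def wx_def
  proof (rule h_eq)
    show "\<sigma> k \<le> t" if "k \<in> {k. \<sigma> k \<le> s}" for k using that t(1) by simp
    show "t \<le> \<sigma> k" if "k \<notin> {k. \<sigma> k \<le> s}" for k using that t(2)[of k] by simp
  qed
  then have "(t - s) * p $ 2 \<le> (t - s) * wy s" using low[of t] eq h_W[of s] by (simp add: algebra_simps)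
  then show "p $ 2 \<le> wy s" using t(1) by simp
qed

text \<open>Slightly left of \<open>s\<close> there is a \<open>t\<close> that is not a slope. There
  the two bounds of \<open>supporting_line_bounds\<close> coincide, so the point of \<open>E\<close>
  attained at \<open>t\<close> can only be \<open>V s\<close>.\<close>

lemma V_in_E: "V s \<in> E"
proof -
  obtain t where t: "t < s" "\<And>k. \<sigma> k < s \<Longrightarrow> \<sigma> k < t" using exists_left by blast
  have nr: "t \<notin> range \<sigma>" using t by force
  have sets: "{k. \<sigma> k < t} = {k. \<sigma> k < s}" "{k. \<sigma> k \<le> t} = {k. \<sigma> k < s}" using t by force+
  from E_att[OF nr] obtain e where e: "e \<in> E" "e $ 1 \<le> t * e $ 2 - h t" by blast
  then have eq: "e $ 1 = t * e $ 2 - h t" using E_low[of e t] by simp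
  have v: "vy t = vy s" "wy t = vy s" "vx t = vx s" unfolding vy_def wy_def vx_def sets by simp_all
  have "e $ 2 = vy s" using supporting_line_bounds[OF E_low[OF e(1)] eq] v by simp
  moreover from this have "e $ 1 = vx s" using eq h_V[of t] v by simp
  ultimately have "e = V s" by (simp add: vec2_eq_iff)
  then show ?thesis using e by simp
qed

lemma W_eq_V: "\<exists>t. W s = V t"
proof -
  obtain t where t: "t > s" "\<And>k. s < \<sigma> k \<Longrightarrow> t < \<sigma> k" using exists_right by blast
  have "\<sigma> k < t \<longleftrightarrow> \<sigma> k \<le> s" for k using t(1) t(2)[of k] by linarith
  then have "W s = V t" by (simp add: vec2_eq_iff vx_def vy_def wx_def wy_def)
  then show ?thesis by blast
qed

lemma V_0: "V 0 = 0"
proof -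
  have "{k. \<sigma> k < 0} = {}" using \<sigma> by (auto simp: not_less)
  then show ?thesis by (simp add: vec2_eq_iff vx_def vy_def)
qed

lemma V_top: "(\<And>k. \<sigma> k < s) \<Longrightarrow> V s = top"
  by (simp add: vec2_eq_iff vx_def vy_def)

lemma exists_above: "\<exists>M>\<tau>. \<forall>k. \<sigma> k < M"
proof -
  define M where "M = 1 + Max (insert \<tau> (range \<sigma>))"
  have "\<sigma> k < M" for k
  proof -
    have "\<sigma> k \<le> Max (insert \<tau> (range \<sigma>))" by (intro Max_ge) auto
    then show ?thesis unfolding M_def by linarith
  qed
  moreover have "\<tau> \<le> Max (insert \<tau> (range \<sigma>))" by (intro Max_ge) auto
  then have "\<tau> < M" unfolding M_def by linarith
  ultimately show ?thesis by blast
qed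

lemma zero_in_E: "0 \<in> E" using V_in_E[of 0] V_0 by simp

lemma top_in_E: "top \<in> E"
proof -
  obtain M where "\<And>k. \<sigma> k < M" using exists_above by blast
  then show ?thesis using V_in_E[of M] V_top by simp
qed

lemma in_S: "V s \<in> S" "W s \<in> S" "0 \<in> S" "top \<in> S"
  using V_in_E W_eq_V[of s] zero_in_E top_in_E by (auto intro: hull_inc)

section \<open>Half-planes, faces, edges and vertices of the polygon\<close>

lemma S_low: "p \<in> S \<Longrightarrow> s * p $ 2 - h s \<le> p $ 1"
proof -
  assume p: "p \<in> S"
  have eq: "(vector [1, - s] :: real ^ 2) \<bullet> q = q $ 1 - s * q $ 2" for q by (simp add: inner2)
  have "S \<subseteq> {q. (vector [1, - s] :: real ^ 2) \<bullet> q \<ge> - h s}"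
    by (rule hull_minimal[where S = convex, OF _ convex_halfspace_ge]) (use E_low[of _ s] in \<open>auto simp: eq algebra_simps\<close>)
  then show ?thesis using p by (auto simp: eq)
qed

lemma S_high: "p \<in> S \<Longrightarrow> p $ 1 \<le> \<tau> * p $ 2"
proof -
  assume p: "p \<in> S"
  have eq: "(vector [1, - \<tau>] :: real ^ 2) \<bullet> q = q $ 1 - \<tau> * q $ 2" for q by (simp add: inner2)
  have "S \<subseteq> {q. (vector [1, - \<tau>] :: real ^ 2) \<bullet> q \<le> 0}"
    by (rule hull_minimal[where S = convex, OF _ convex_halfspace_le]) (use E_high in \<open>auto simp: eq\<close>)
  then show ?thesis using p by (auto simp: eq)
qed

lemma Y_pos: "(\<Sum>k\<in>UNIV. N k) > 0" using N by (intro sum_pos) auto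

lemma X_pos: "(\<Sum>k\<in>UNIV. N k * \<sigma> k) > 0"
proof -
  obtain k where k: "\<sigma> k > 0" using \<sigma>_pos by blast
  then show ?thesis using N \<sigma> by (intro sum_pos2[of _ k]) (auto intro: mult_nonneg_nonneg less_imp_le)
qed

lemma \<tau>_pos: "\<tau> > 0" using X_pos Y_pos \<tau> by (simp add: zero_less_mult_iff)

lemma h_nonpos: "s \<le> 0 \<Longrightarrow> h s = 0"
proof -
  assume "s \<le> 0"
  then have "max 0 (s - \<sigma> k) = 0" for k using \<sigma>[of k] by simp
  then show ?thesis by (simp add: h_def)
qed

text \<open>The heights are confined by the line of direction \<open>(\<tau>, 1)\<close> together
  with a lower line: the one for \<open>s = -1\<close> at the bottom, and one for \<open>M\<close>
  beyond \<open>\<tau>\<close> and all slopes at the top.\<close>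

lemma S_y: "p \<in> S \<Longrightarrow> 0 \<le> p $ 2" "p \<in> S \<Longrightarrow> p $ 2 \<le> top $ 2"
proof -
  assume p: "p \<in> S"
  have "(\<tau> + 1) * p $ 2 \<ge> 0" using S_low[OF p, of "-1"] S_high[OF p] h_nonpos[of "-1"] by (simp add: distrib_right)
  then show "0 \<le> p $ 2" using \<tau>_pos by (simp add: zero_le_mult_iff)
  obtain M where M: "M > \<tau>" "\<And>k. \<sigma> k < M" using exists_above by blast
  have "h M = M * top $ 2 - \<tau> * top $ 2" using h_V[of M] V_top[of M] M(2) \<tau> by (simp add: vx_def vy_def)
  then have "(M - \<tau>) * p $ 2 \<le> (M - \<tau>) * top $ 2"
    using S_low[OF p, of M] S_high[OF p] by (simp add: algebra_simps)
  then show "p $ 2 \<le> top $ 2" using M(1) by simp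
qed

lemma eq_topI: "p \<in> S \<Longrightarrow> p $ 2 = top $ 2 \<Longrightarrow> p = top"
proof -
  assume p: "p \<in> S" "p $ 2 = top $ 2"
  obtain M where M: "M > \<tau>" "\<And>k. \<sigma> k < M" using exists_above by blast
  have "h M = M * top $ 2 - top $ 1" using h_V[of M] M(2) by (simp add: vx_def vy_def)
  then have "top $ 1 \<le> p $ 1" using S_low[OF p(1), of M] p(2) by simp
  moreover have "p $ 1 \<le> top $ 1" using S_high[OF p(1)] p(2) \<tau> by simp
  ultimately show "p = top" using p(2) by (simp add: vec2_eq_iff)
qed

lemma eq_zeroI: "p \<in> S \<Longrightarrow> p $ 2 = 0 \<Longrightarrow> p = 0"
  using S_low[of p 0] S_high[of p] h_nonpos[of 0] by (simp add: vec2_eq_iff)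

lemma wx_minus_vx: "wx s - vx s = s * (wy s - vy s)"
  using h_V[of s] h_W[of s] by (simp add: algebra_simps)

lemma wy_eq: "wy s = vy s + (\<Sum>k | \<sigma> k = s. N k)"
proof -
  have "{k. \<sigma> k \<le> s} = {k. \<sigma> k < s} \<union> {k. \<sigma> k = s}" by auto
  then show ?thesis unfolding wy_def vy_def by (subst sum.union_disjoint[symmetric]) auto
qed

lemma V_less_W: "s \<in> range \<sigma> \<Longrightarrow> vy s < wy s"
  unfolding wy_eq using N by (auto intro!: sum_pos)

lemma V_eq_W: "s \<notin> range \<sigma> \<Longrightarrow> V s = W s"
proof -
  assume "s \<notin> range \<sigma>"
  then have "{k. \<sigma> k \<le> s} = {k. \<sigma> k < s}" by force
  then show ?thesis by (simp add: vec2_eq_iff vx_def vy_def wx_def wy_def)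
qed

lemma lower_face: "S \<inter> {p. p $ 1 = s * p $ 2 - h s} = closed_segment (V s) (W s)"
proof
  show "S \<inter> {p. p $ 1 = s * p $ 2 - h s} \<subseteq> closed_segment (V s) (W s)"
  proof
    fix p assume p: "p \<in> S \<inter> {p. p $ 1 = s * p $ 2 - h s}"
    then have pS: "p \<in> S" and pe: "p $ 1 = s * p $ 2 - h s" by auto
    show "p \<in> closed_segment (V s) (W s)"
      using supporting_line_bounds[OF S_low[OF pS] pe] pe h_V[of s] wx_minus_vx[of s]
      by (intro segment_lineI[of _ _ _ s]) (auto simp: algebra_simps)
  qed
  have eq: "(vector [1, - s] :: real ^ 2) \<bullet> q = q $ 1 - s * q $ 2" for q by (simp add: inner2)
  have "convex (S \<inter> {q. (vector [1, - s] :: real ^ 2) \<bullet> q = - h s})" by (intro convex_Int convex_convex_hull convex_hyperplane)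
  moreover have "{V s, W s} \<subseteq> S \<inter> {q. (vector [1, - s] :: real ^ 2) \<bullet> q = - h s}"
    using in_S h_V[of s] h_W[of s] by (auto simp: eq)
  ultimately have "closed_segment (V s) (W s) \<subseteq> S \<inter> {q. (vector [1, - s] :: real ^ 2) \<bullet> q = - h s}"
    unfolding segment_convex_hull by (intro hull_minimal)
  then show "closed_segment (V s) (W s) \<subseteq> S \<inter> {p. p $ 1 = s * p $ 2 - h s}" by (auto simp: eq)
qed

lemma upper_face: "S \<inter> {p. p $ 1 = \<tau> * p $ 2} = closed_segment 0 top"
proof
  show "S \<inter> {p. p $ 1 = \<tau> * p $ 2} \<subseteq> closed_segment 0 top"
    using S_y \<tau> by (auto intro!: segment_lineI[of _ _ _ \<tau>])
  have eq: "(vector [1, - \<tau>] :: real ^ 2) \<bullet> q = q $ 1 - \<tau> * q $ 2" for q by (simp add: inner2)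
  have "convex (S \<inter> {q. (vector [1, - \<tau>] :: real ^ 2) \<bullet> q = 0})" by (intro convex_Int convex_convex_hull convex_hyperplane)
  moreover have "{0, top} \<subseteq> S \<inter> {q. (vector [1, - \<tau>] :: real ^ 2) \<bullet> q = 0}"
    using in_S \<tau> by (auto simp: eq)
  ultimately have "closed_segment 0 top \<subseteq> S \<inter> {q. (vector [1, - \<tau>] :: real ^ 2) \<bullet> q = 0}"
    unfolding segment_convex_hull by (intro hull_minimal)
  then show "closed_segment 0 top \<subseteq> S \<inter> {p. p $ 1 = \<tau> * p $ 2}" by (auto simp: eq)
qed

lemma face_lower: "closed_segment (V s) (W s) face_of S"
proof -
  have eq: "(vector [1, - s] :: real ^ 2) \<bullet> q = q $ 1 - s * q $ 2" for q by (simp add: inner2)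
  have "S \<inter> {q. (vector [1, - s] :: real ^ 2) \<bullet> q = - h s} face_of S"
    by (rule face_of_Int_supporting_hyperplane_ge) (use S_low[of _ s] in \<open>auto simp: eq algebra_simps\<close>)
  also have "S \<inter> {q. (vector [1, - s] :: real ^ 2) \<bullet> q = - h s} = closed_segment (V s) (W s)"
    unfolding lower_face[symmetric] by (auto simp: eq)
  finally show ?thesis .
qed

lemma face_upper: "closed_segment 0 top face_of S"
proof -
  have eq: "(vector [1, - \<tau>] :: real ^ 2) \<bullet> q = q $ 1 - \<tau> * q $ 2" for q by (simp add: inner2)
  have "S \<inter> {q. (vector [1, - \<tau>] :: real ^ 2) \<bullet> q = 0} face_of S"
    by (rule face_of_Int_supporting_hyperplane_le) (use S_high in \<open>auto simp: eq\<close>)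
  also have "S \<inter> {q. (vector [1, - \<tau>] :: real ^ 2) \<bullet> q = 0} = closed_segment 0 top"
    unfolding upper_face[symmetric] by (auto simp: eq)
  finally show ?thesis .
qed

text \<open>The sign of \<open>a $ 1\<close> decides. If it is negative, the functional exposes the
  lower face of slope \<open>- a $ 2 / a $ 1\<close>; if it is 0, only \<open>top\<close> or
  \<open>0\<close>. If it is positive, \<open>p $ 1 - s * p $ 2 \<le> (\<tau> - s) * p $ 2\<close>
  holds with equality at \<open>0\<close> and \<open>top\<close>, so for
  \<open>s \<noteq> \<tau>\<close> the maximum is attained only at the point of extreme
  height.\<close>

lemma exposed_faces:
  assumes T: "S \<subseteq> {x. a \<bullet> x \<le> b}" "T = S \<inter> {x. a \<bullet> x = b}" "T \<noteq> {}" "a \<noteq> 0"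
  shows "(\<exists>s. T = closed_segment (V s) (W s)) \<or> T = closed_segment 0 top \<or> T = {0} \<or> T = {top}"
proof -
  have le: "a $ 1 * p $ 1 + a $ 2 * p $ 2 \<le> b" if "p \<in> S" for p using T(1) that by (auto simp: inner2)
  have Tp: "p \<in> T \<longleftrightarrow> p \<in> S \<and> a $ 1 * p $ 1 + a $ 2 * p $ 2 = b" for p unfolding T(2) by (simp add: inner2)
  obtain p0 where p0: "p0 \<in> S" "a $ 1 * p0 $ 1 + a $ 2 * p0 $ 2 = b" using T(3) Tp by blast
  have single: "T = {q}" if "\<And>p. p \<in> T \<Longrightarrow> p = q" for q using that T(3) by blast
  consider "a $ 1 < 0" | "a $ 1 = 0" "a $ 2 > 0" | "a $ 1 = 0" "a $ 2 < 0" | "a $ 1 > 0"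
  proof -
    have "a $ 1 \<noteq> 0 \<or> a $ 2 \<noteq> 0" using T(4) by (auto simp: vec2_eq_iff)
    then show ?thesis using that
      by (cases "a $ 1" "0::real" rule: linorder_cases; cases "a $ 2" "0::real" rule: linorder_cases) auto
  qed
  then show ?thesis
  proof cases
    case 1
    define s where "s = - a $ 2 / a $ 1"
    have a2: "a $ 2 = - a $ 1 * s" using 1 by (simp add: s_def)
    have form: "a $ 1 * p $ 1 + a $ 2 * p $ 2 = a $ 1 * (p $ 1 - s * p $ 2)" for p :: "real ^ 2"
      by (simp add: a2 algebra_simps)
    have "a $ 1 * (- h s) \<le> b" using le[OF in_S(1), of s] h_V[of s] unfolding form by simp
    moreover have "b \<le> a $ 1 * (- h s)"
      unfolding p0(2)[symmetric] form using 1 S_low[OF p0(1), of s] by (intro mult_left_mono_neg) auto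
    ultimately have b: "b = a $ 1 * (- h s)" by simp
    have "p \<in> T \<longleftrightarrow> p \<in> S \<and> p $ 1 - s * p $ 2 = - h s" for p
      unfolding Tp form b mult_cancel_left using 1 by auto
    then have "T = S \<inter> {p. p $ 1 = s * p $ 2 - h s}" by (auto simp: algebra_simps)
    then show ?thesis unfolding lower_face by blast
  next
    case 2
    have "p = top" if p: "p \<in> T" for p
    proof -
      have pS: "p \<in> S" and "a $ 2 * p $ 2 = b" using p 2 by (auto simp: Tp)
      then have "a $ 2 * top $ 2 \<le> a $ 2 * p $ 2" using le[OF in_S(4)] 2 by simp
      then have "top $ 2 \<le> p $ 2" using 2 by (simp only: mult_le_cancel_left_pos)
      then show ?thesis using eq_topI[OF pS] S_y(2)[OF pS] by simp
    qed
    from single[OF this] show ?thesis by blast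
  next
    case 3
    have "p = 0" if p: "p \<in> T" for p
    proof -
      have pS: "p \<in> S" and "a $ 2 * p $ 2 = b" using p 3 by (auto simp: Tp)
      then have "a $ 2 * p $ 2 \<ge> 0" using le[OF in_S(3)] 3 by simp
      then have "p $ 2 \<le> 0" using 3 by (simp add: zero_le_mult_iff)
      then show ?thesis using eq_zeroI[OF pS] S_y(1)[OF pS] by simp
    qed
    from single[OF this] show ?thesis by blast
  next
    case 4
    define s where "s = - a $ 2 / a $ 1"
    have a2: "a $ 2 = - a $ 1 * s" using 4 by (simp add: s_def)
    have form: "a $ 1 * p $ 1 + a $ 2 * p $ 2 = a $ 1 * (p $ 1 - s * p $ 2)" for p :: "real ^ 2"
      by (simp add: a2 algebra_simps)
    define B where "B = b / a $ 1"
    have B: "p $ 1 - s * p $ 2 \<le> B" if "p \<in> S" for p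
      using le[OF that] 4 unfolding form B_def by (simp add: pos_le_divide_eq mult.commute)
    have TB: "p \<in> T \<longleftrightarrow> p \<in> S \<and> p $ 1 - s * p $ 2 = B" for p
      unfolding Tp form B_def using 4 by (auto simp: eq_divide_eq mult.commute)
    have up: "p $ 1 - s * p $ 2 \<le> (\<tau> - s) * p $ 2" if "p \<in> S" for p
      using S_high[OF that] by (simp add: left_diff_distrib)
    have B0: "0 \<le> B" using B[OF in_S(3)] by simp
    have Btop: "(\<tau> - s) * top $ 2 \<le> B" using B[OF in_S(4)] \<tau> by (simp add: left_diff_distrib)
    consider "s = \<tau>" | "s < \<tau>" | "s > \<tau>" by linarith
    then show ?thesis
    proof cases
      case 1
      have "B \<le> 0" using up[OF p0(1)] TB[of p0] Tp[of p0] p0 1 by simp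
      with B0 have "B = 0" by simp
      then have "T = S \<inter> {p. p $ 1 = \<tau> * p $ 2}" using TB 1 by auto
      then show ?thesis unfolding upper_face by blast
    next
      case 2
      have "p = top" if p: "p \<in> T" for p
      proof -
        have pS: "p \<in> S" and "p $ 1 - s * p $ 2 = B" using p by (auto simp: TB)
        then have "(\<tau> - s) * top $ 2 \<le> (\<tau> - s) * p $ 2" using Btop up[OF pS] by linarith
        then have "top $ 2 \<le> p $ 2" using 2 by (simp only: mult_le_cancel_left_pos diff_gt_0_iff_gt)
        then show ?thesis using eq_topI[OF pS] S_y(2)[OF pS] by simp
      qed
      from single[OF this] show ?thesis by blast
    next
      case 3
      have "p = 0" if p: "p \<in> T" for p
      proof -
        have pS: "p \<in> S" and "p $ 1 - s * p $ 2 = B" using p by (auto simp: TB)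
        then have "(\<tau> - s) * p $ 2 \<ge> 0" using B0 up[OF pS] by linarith
        then have "p $ 2 \<le> 0" using 3 by (simp add: zero_le_mult_iff)
        then show ?thesis using eq_zeroI[OF pS] S_y(1)[OF pS] by simp
      qed
      from single[OF this] show ?thesis by blast
    qed
  qed
qed

lemma V_neq_W: "s \<in> range \<sigma> \<Longrightarrow> V s \<noteq> W s"
  using V_less_W[of s] by (auto simp: vec2_eq_iff)

lemma zero_neq_top: "0 \<noteq> top"
  using X_pos by (auto simp: vec2_eq_iff)

lemma edge_lower: "s \<in> range \<sigma> \<Longrightarrow> closed_segment (V s) (W s) edge_of S"
  unfolding edge_of_def using face_lower V_neq_W by (simp add: segment_convex_hull aff_dim_convex_hull aff_dim_2)

lemma edge_upper: "closed_segment 0 top edge_of S"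
  unfolding edge_of_def using face_upper zero_neq_top by (simp add: segment_convex_hull aff_dim_convex_hull aff_dim_2)

lemma face_cases:
  assumes T: "T face_of S" "T \<noteq> {}" "aff_dim T \<le> 1"
  shows "(\<exists>s. T = closed_segment (V s) (W s)) \<or> T = closed_segment 0 top \<or> T = {0} \<or> T = {top}"
proof -
  have "polyhedron S" using E by (intro polytope_imp_polyhedron) (auto simp: polytope_def)
  then have "T exposed_face_of S" using exposed_face_of_polyhedron T(1) by blast
  then obtain a b where ab: "S \<subseteq> {x. a \<bullet> x \<le> b}" "T = S \<inter> {x. a \<bullet> x = b}"
    unfolding exposed_face_of_def by blast
  \<comment> \<open>Otherwise \<open>T\<close> would be the whole polygon, whose dimension exceeds
    1: the edge of slope 0 is a proper face, as it misses \<open>top\<close>.\<close>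
  have "a \<noteq> 0"
  proof
    assume "a = 0"
    then have "T = S" using ab T(2) by auto
    obtain k where k: "\<sigma> k = 0" using \<sigma>_zero by blast
    have "top \<notin> closed_segment (V 0) (W 0)"
      unfolding lower_face[symmetric] using h_nonpos[of 0] X_pos by simp
    then have "closed_segment (V 0) (W 0) \<noteq> S" using in_S(4) by blast
    then have "aff_dim (closed_segment (V 0) (W 0)) < aff_dim S"
      using face_of_aff_dim_lt[OF convex_convex_hull face_lower[of 0]] by simp
    moreover have "aff_dim (closed_segment (V 0) (W 0)) = 1"
      using edge_lower[of 0] k by (auto simp: edge_of_def)
    ultimately show False using T(3) \<open>T = S\<close> by simp
  qed
  then show ?thesis using exposed_faces[OF ab T(2)] by blast
qed

theorem edges_eq: "{T. T edge_of S} = insert (closed_segment 0 top) ((\<lambda>s. closed_segment (V s) (W s)) ` range \<sigma>)"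
proof (intro equalityI subsetI)
  fix T assume "T \<in> {T. T edge_of S}"
  then have T: "T face_of S" "aff_dim T = 1" by (auto simp: edge_of_def)
  then have "T \<noteq> {}" by auto
  have ns: "T \<noteq> {q}" for q using T(2) by auto
  from face_cases[OF T(1) \<open>T \<noteq> {}\<close>] T(2) ns have
    "(\<exists>s. T = closed_segment (V s) (W s)) \<or> T = closed_segment 0 top" by auto
  then show "T \<in> insert (closed_segment 0 top) ((\<lambda>s. closed_segment (V s) (W s)) ` range \<sigma>)"
  proof
    assume "\<exists>s. T = closed_segment (V s) (W s)"
    then obtain s where s: "T = closed_segment (V s) (W s)" by blast
    have "s \<in> range \<sigma>"
    proof (rule ccontr)
      assume "s \<notin> range \<sigma>"
      from V_eq_W[OF this] s ns[of "W s"] show False by simp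
    qed
    then show ?thesis using s by blast
  qed simp
qed (use edge_lower edge_upper in auto)

theorem card_edges: "card {T. T edge_of S} = card (range \<sigma>) + 1"
proof -
  have less: "False" if "s \<in> range \<sigma>" "s' \<in> range \<sigma>" "s < s'" "closed_segment (V s) (W s) = closed_segment (V s') (W s')" for s s'
  proof -
    have "W s' \<in> S \<inter> {p. p $ 1 = s * p $ 2 - h s}" unfolding lower_face that(4) by simp
    then have "W s' \<in> S" and "W s' $ 1 = s * W s' $ 2 - h s" by auto
    from supporting_line_bounds(2)[OF S_low[OF this(1)] this(2)] have "wy s' \<le> wy s" by simp
    moreover have "wy s \<le> vy s'" unfolding wy_def vy_def using N that(3) by (intro sum_mono2) (auto intro: less_imp_le)
    ultimately show False using V_less_W[OF that(2)] by simp
  qed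
  have "inj_on (\<lambda>s. closed_segment (V s) (W s)) (range \<sigma>)"
  proof (rule inj_onI)
    fix s s' assume s: "s \<in> range \<sigma>" "s' \<in> range \<sigma>" "closed_segment (V s) (W s) = closed_segment (V s') (W s')"
    show "s = s'" using less[OF s(1,2) _ s(3)] less[OF s(2,1) _ s(3)[symmetric]] by (metis linorder_neqE)
  qed
  \<comment> \<open>If both ends of the upper edge lay on one lower line, then
    \<open>h s = 0\<close> for some \<open>s > 0\<close>; but an index of slope 0 makes
    \<open>h\<close> positive there.\<close>
  moreover have "closed_segment 0 top \<notin> (\<lambda>s. closed_segment (V s) (W s)) ` range \<sigma>"
  proof
    assume "closed_segment 0 top \<in> (\<lambda>s. closed_segment (V s) (W s)) ` range \<sigma>"
    then obtain s where s: "closed_segment 0 top = closed_segment (V s) (W s)" by blast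
    have "0 \<in> S \<inter> {p. p $ 1 = s * p $ 2 - h s}" "top \<in> S \<inter> {p. p $ 1 = s * p $ 2 - h s}"
      unfolding lower_face s[symmetric] by auto
    then have hs: "h s = 0" and t: "top $ 1 = s * top $ 2" by auto
    have "s > 0" using t X_pos Y_pos by (simp add: zero_less_mult_iff)
    obtain k where k: "\<sigma> k = 0" using \<sigma>_zero by blast
    have "0 < h s" unfolding h_def using N \<open>s > 0\<close> k
      by (intro sum_pos2[of _ k]) (simp_all add: less_imp_le)
    with hs show False by simp
  qed
  ultimately show ?thesis unfolding edges_eq by (simp add: card_image)
qed

theorem extreme_points_eq: "{v. v extreme_point_of S} = {0, top} \<union> V ` range \<sigma> \<union> W ` range \<sigma>"
proof (intro equalityI subsetI)
  fix v assume "v \<in> {v. v extreme_point_of S}"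
  then have "{v} face_of S" by (simp add: face_of_singleton)
  from face_cases[OF this] have "(\<exists>s. {v} = closed_segment (V s) (W s)) \<or> {v} = closed_segment 0 top \<or> v = 0 \<or> v = top"
    by auto
  moreover have "{v} \<noteq> closed_segment 0 top"
  proof
    assume "{v} = closed_segment 0 top"
    then have "0 \<in> {v}" "top \<in> {v}" by auto
    then show False using zero_neq_top by simp
  qed
  moreover have "v \<in> {0, top} \<union> V ` range \<sigma> \<union> W ` range \<sigma>" if "{v} = closed_segment (V s) (W s)" for s
  proof -
    have "V s \<in> {v}" unfolding that by simp
    then have v: "v = V s" by simp
    show ?thesis
    proof (cases "\<exists>k. s \<le> \<sigma> k")
      case False
      then show ?thesis using V_top[of s] v by (auto simp: not_le)
    next
      case True
      \<comment> \<open>The next slope at or after \<open>s\<close>; no slope is passed on the way,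
        so \<open>V\<close> takes the same value at \<open>s\<close> and at
        \<open>m\<close>.\<close>
      define m where "m = Min (\<sigma> ` {k. s \<le> \<sigma> k})"
      have "m \<in> \<sigma> ` {k. s \<le> \<sigma> k}" unfolding m_def using True by (intro Min_in) auto
      then have m: "m \<in> range \<sigma>" "s \<le> m" by auto
      have "\<sigma> k < s" if "\<sigma> k < m" for k
      proof (rule ccontr)
        assume "\<not> \<sigma> k < s"
        then have "m \<le> \<sigma> k" unfolding m_def by (intro Min_le) auto
        with that show False by simp
      qed
      then have "\<sigma> k < s \<longleftrightarrow> \<sigma> k < m" for k using m(2) by force
      then have "V s = V m" by (simp add: vec2_eq_iff vx_def vy_def)
      then show ?thesis using v m(1) by blast
    qed
  qed
  ultimately show "v \<in> {0, top} \<union> V ` range \<sigma> \<union> W ` range \<sigma>" by blast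
next
  fix v assume "v \<in> {0, top} \<union> V ` range \<sigma> \<union> W ` range \<sigma>"
  then have "v extreme_point_of closed_segment 0 top \<or> (\<exists>s. v extreme_point_of closed_segment (V s) (W s))"
    by (auto simp: extreme_point_of_segment)
  then show "v \<in> {v. v extreme_point_of S}"
    using extreme_point_of_face[OF face_upper] extreme_point_of_face[OF face_lower] by blast
qed

end

section \<open>Polynomials with unique extremal terms along a line\<close>

definition degA :: "('n qvar \<Rightarrow>\<^sub>0 nat) \<Rightarrow> nat" where
  "degA e = Poly_Mapping.lookup e A0"

definition degB :: "('n::finite qvar \<Rightarrow>\<^sub>0 nat) \<Rightarrow> nat" where
  "degB e = (\<Sum>i\<in>UNIV. Poly_Mapping.lookup e (B2 i))"

lemma degA_add: "degA (e + e') = degA e + degA e'" and degB_add: "degB (e + e') = degB e + degB e'"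
  by (simp_all add: degA_def degB_def lookup_add sum.distrib)

text \<open>The condition on \<open>degB\<close> puts the projected exponents on a line with direction \<open>(c, 1)\<close>.\<close>

definition ends :: "real \<Rightarrow> ('n::finite qvar, int) mpoly \<Rightarrow> ('n qvar \<Rightarrow>\<^sub>0 nat) \<Rightarrow> ('n qvar \<Rightarrow>\<^sub>0 nat) \<Rightarrow> bool" where
  "ends c p l u \<longleftrightarrow> l \<in> Poly_Mapping.keys p \<and> u \<in> Poly_Mapping.keys p \<and> (\<forall>e\<in>Poly_Mapping.keys p.
     real (degB e) = real (degB l) + c * (real (degA e) - real (degA l)) \<and>
     degA l \<le> degA e \<and> degA e \<le> degA u \<and> (degA e = degA l \<longrightarrow> e = l) \<and> (degA e = degA u \<longrightarrow> e = u))"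

text \<open>An exponent that arises from a single pair of terms is safe from cancellation.\<close>

lemma lookup_mult_unique:
  fixes p q :: "('v, 'c::comm_ring_1) mpoly"
  assumes "\<And>a b. a \<in> Poly_Mapping.keys p \<Longrightarrow> b \<in> Poly_Mapping.keys q \<Longrightarrow> a + b = l + l' \<Longrightarrow> a = l \<and> b = l'"
  shows "Poly_Mapping.lookup (p * q) (l + l') = Poly_Mapping.lookup p l * Poly_Mapping.lookup q l'"
proof -
  let ?c = "\<lambda>a b. Poly_Mapping.lookup p a * Poly_Mapping.lookup q b"
  have "p * q = (\<Sum>a\<in>Poly_Mapping.keys p. Poly_Mapping.single a (Poly_Mapping.lookup p a)) *
      (\<Sum>b\<in>Poly_Mapping.keys q. Poly_Mapping.single b (Poly_Mapping.lookup q b))"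
    using poly_mapping_sum_single[of p] poly_mapping_sum_single[of q] by simp
  also have "\<dots> = (\<Sum>a\<in>Poly_Mapping.keys p. \<Sum>b\<in>Poly_Mapping.keys q. Poly_Mapping.single (a + b) (?c a b))"
    by (simp add: sum_product mult_single)
  finally have "Poly_Mapping.lookup (p * q) (l + l')
      = (\<Sum>a\<in>Poly_Mapping.keys p. \<Sum>b\<in>Poly_Mapping.keys q. if a + b = l + l' then ?c a b else 0)"
    by (simp add: lookup_sum lookup_single when_def)
  also have "\<dots> = (\<Sum>a\<in>Poly_Mapping.keys p. \<Sum>b\<in>Poly_Mapping.keys q. if a = l then (if b = l' then ?c a b else 0) else 0)"
    using assms by (intro sum.cong refl) auto
  also have "\<dots> = (\<Sum>a\<in>Poly_Mapping.keys p. if a = l then (\<Sum>b\<in>Poly_Mapping.keys q. if b = l' then ?c a b else 0) else 0)"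
    by (intro sum.cong refl) auto
  also have "\<dots> = ?c l l'" by (auto simp: in_keys_iff)
  finally show ?thesis .
qed

text \<open>The extremal degree in \<open>a_0\<close> of a product is reached only by the extremal
  terms of both factors, so these survive.\<close>

lemma ends_mult:
  assumes p: "ends c p l u" and q: "ends c q l' u'"
  shows "ends c (p * q) (l + l') (u + u')"
proof -
  have P: "real (degB e) = real (degB l) + c * (real (degA e) - real (degA l))" "degA l \<le> degA e" "degA e \<le> degA u"
    "degA e = degA l \<Longrightarrow> e = l" "degA e = degA u \<Longrightarrow> e = u" if "e \<in> Poly_Mapping.keys p" for e
    using p that unfolding ends_def by blast+
  have Q: "real (degB e) = real (degB l') + c * (real (degA e) - real (degA l'))" "degA l' \<le> degA e" "degA e \<le> degA u'"
    "degA e = degA l' \<Longrightarrow> e = l'" "degA e = degA u' \<Longrightarrow> e = u'" if "e \<in> Poly_Mapping.keys q" for e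
    using q that unfolding ends_def by blast+
  have low: "a = l \<and> b = l'" if "a \<in> Poly_Mapping.keys p" "b \<in> Poly_Mapping.keys q" "degA (a + b) = degA (l + l')" for a b
    using that(3) P(2,4)[OF that(1)] Q(2,4)[OF that(2)] by (simp add: degA_add)
  have high: "a = u \<and> b = u'" if "a \<in> Poly_Mapping.keys p" "b \<in> Poly_Mapping.keys q" "degA (a + b) = degA (u + u')" for a b
    using that(3) P(3,5)[OF that(1)] Q(3,5)[OF that(2)] by (simp add: degA_add)
  have nz: "Poly_Mapping.lookup p l \<noteq> 0" "Poly_Mapping.lookup q l' \<noteq> 0" "Poly_Mapping.lookup p u \<noteq> 0" "Poly_Mapping.lookup q u' \<noteq> 0"
    using p q by (auto simp: ends_def in_keys_iff)
  have "l + l' \<in> Poly_Mapping.keys (p * q)"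
    unfolding in_keys_iff using lookup_mult_unique[of p q l l'] low nz by auto
  moreover have "u + u' \<in> Poly_Mapping.keys (p * q)"
    unfolding in_keys_iff using lookup_mult_unique[of p q u u'] high nz by auto
  moreover have "real (degB e) = real (degB (l + l')) + c * (real (degA e) - real (degA (l + l'))) \<and>
     degA (l + l') \<le> degA e \<and> degA e \<le> degA (u + u') \<and> (degA e = degA (l + l') \<longrightarrow> e = l + l') \<and> (degA e = degA (u + u') \<longrightarrow> e = u + u')"
    if e: "e \<in> Poly_Mapping.keys (p * q)" for e
  proof -
    from e keys_mult[of p q] obtain a b where ab: "a \<in> Poly_Mapping.keys p" "b \<in> Poly_Mapping.keys q" "e = a + b" by blast
    show ?thesis
      using low[OF ab(1,2)] high[OF ab(1,2)] P(1-3)[OF ab(1)] Q(1-3)[OF ab(2)]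
      by (auto simp: ab(3) degA_add degB_add algebra_simps)
  qed
  ultimately show ?thesis unfolding ends_def by blast
qed

text \<open>What the projection sees: the lower end \<open>(x, y)\<close> and the height
  \<open>y'\<close> of the upper end, whose first coordinate follows from the direction
  \<open>c\<close>.\<close>

definition has_ends :: "real \<Rightarrow> ('n::finite qvar, int) mpoly \<Rightarrow> nat \<Rightarrow> nat \<Rightarrow> nat \<Rightarrow> bool" where
  "has_ends c p x y y' \<longleftrightarrow> (\<exists>l u. ends c p l u \<and> degB l = x \<and> degA l = y \<and> degA u = y')"

lemma has_ends_mult: "has_ends c p x y y' \<Longrightarrow> has_ends c q z w w' \<Longrightarrow> has_ends c (p * q) (x + z) (y + w) (y' + w')"
  unfolding has_ends_def
  by (elim exE conjE, intro exI conjI, rule ends_mult, assumption, assumption) (simp_all add: degA_add degB_add)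

lemma has_ends_single:
  fixes e :: "'n::finite qvar \<Rightarrow>\<^sub>0 nat"
  shows "k \<noteq> 0 \<Longrightarrow> has_ends c (Poly_Mapping.single e k) (degB e) (degA e) (degA e)"
  unfolding has_ends_def ends_def by auto

lemma has_ends_1: "has_ends c (1 :: ('n::finite qvar, int) mpoly) 0 0 0"
  using has_ends_single[of 1 c "0 :: 'n qvar \<Rightarrow>\<^sub>0 nat"] by (simp add: degA_def degB_def)

lemma has_ends_minus_1: "has_ends c (- 1 :: ('n::finite qvar, int) mpoly) 0 0 0"
  using has_ends_single[of "- 1" c "0 :: 'n qvar \<Rightarrow>\<^sub>0 nat"] by (simp add: degA_def degB_def single_uminus)

lemma has_ends_Var: "has_ends c (Var v :: ('n::finite qvar, int) mpoly)
    (if v \<in> range B2 then 1 else 0) (if v = A0 then 1 else 0) (if v = A0 then 1 else 0)"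
proof -
  have "(\<Sum>i\<in>UNIV. if v = B2 i then 1 else (0::nat)) = (if v \<in> range B2 then 1 else 0)"
    by (cases v) auto
  then have "degB (Poly_Mapping.single v 1) = (if v \<in> range B2 then 1 else 0)"
    by (simp add: degB_def lookup_single when_def del: One_nat_def)
  moreover have "degA (Poly_Mapping.single v 1) = (if v = A0 then 1 else 0)"
    by (simp add: degA_def lookup_single when_def)
  ultimately show ?thesis using has_ends_single[of 1 c "Poly_Mapping.single v 1"] by (simp add: Var_def)
qed

lemma has_ends_power: "has_ends c p x y y' \<Longrightarrow> has_ends c (p ^ n) (n * x) (n * y) (n * y')"
proof (induction n)
  case 0
  then show ?case using has_ends_1 by simp
next
  case (Suc n)
  then show ?case using has_ends_mult[of c p x y y' "p ^ n"] by simp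
qed

lemma has_ends_prod:
  assumes "\<And>i. i \<in> I \<Longrightarrow> has_ends c (f i) (x i) (y i) (y' i)"
  shows "has_ends c (prod f I) (sum x I) (sum y I) (sum y' I)"
  using assms
proof (induction I rule: infinite_finite_induct)
  case (insert i I)
  then show ?case using has_ends_mult[of c "f i" "x i" "y i" "y' i" "prod f I"] by simp
qed (auto intro: has_ends_1)

text \<open>Equal lowest and highest degree force \<open>p\<close> and \<open>q\<close> to have a
  single term each; the assumption on \<open>x\<close> puts both terms on a line of direction
  \<open>(c, 1)\<close>.\<close>

lemma has_ends_binomial:
  assumes p: "has_ends c p x y y" and q: "has_ends c q z w w" and less: "w < y"
    and x: "real x = real z + c * (real y - real w)"
  shows "has_ends c (p + q) z w y"
proof -
  from p obtain l u where l: "ends c p l u" "degB l = x" "degA l = y" "degA u = y" unfolding has_ends_def by blast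
  from q obtain l' u' where l': "ends c q l' u'" "degB l' = z" "degA l' = w" "degA u' = w" unfolding has_ends_def by blast
  have kp: "Poly_Mapping.keys p = {l}"
  proof -
    have "e = l" if "e \<in> Poly_Mapping.keys p" for e using l that unfolding ends_def by (metis le_antisym)
    then show ?thesis using l(1) unfolding ends_def by blast
  qed
  have kq: "Poly_Mapping.keys q = {l'}"
  proof -
    have "e = l'" if "e \<in> Poly_Mapping.keys q" for e using l' that unfolding ends_def by (metis le_antisym)
    then show ?thesis using l'(1) unfolding ends_def by blast
  qed
  have ne: "l \<noteq> l'" using l l' less by auto
  have "Poly_Mapping.lookup p l' = 0" "Poly_Mapping.lookup q l = 0" "Poly_Mapping.lookup p l \<noteq> 0" "Poly_Mapping.lookup q l' \<noteq> 0"
    using kp kq ne by (auto simp flip: in_keys_iff)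
  then have "l \<in> Poly_Mapping.keys (p + q)" "l' \<in> Poly_Mapping.keys (p + q)"
    by (auto simp: in_keys_iff lookup_add)
  moreover have "Poly_Mapping.keys (p + q) \<subseteq> {l, l'}" using Poly_Mapping.keys_add[of p q] kp kq by auto
  ultimately have "Poly_Mapping.keys (p + q) = {l, l'}" by auto
  then have "ends c (p + q) l' l" unfolding ends_def using l l' less x by auto
  then show ?thesis unfolding has_ends_def using l l' by blast
qed

lemma proj_expvec: "proj (expvec e) = vector [real (degB e), real (degA e)]"
  by (simp add: proj_def expvec_def degA_def degB_def)

lemma linear_proj: "linear (proj :: real ^ 'n::finite qvar \<Rightarrow> real ^ 2)"
  by (rule linearI) (simp_all add: vec2_eq_iff proj_def sum.distrib sum_distrib_left)

lemma has_ends_imp: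
  fixes p :: "('n::finite qvar, int) mpoly"
  assumes "has_ends c p x y y'"
  defines "P \<equiv> vector [real x, real y] :: real ^ 2"
    and "Q \<equiv> vector [real x + c * (real y' - real y), real y'] :: real ^ 2"
  shows "proj ` newton_polytope p = closed_segment P Q"
    and "proj (expvec (min_term p)) = P" and "proj (expvec (max_term p)) = Q"
proof -
  from assms(1) obtain l u where e: "ends c p l u" "degB l = x" "degA l = y" "degA u = y'" unfolding has_ends_def by blast
  then have l: "l \<in> Poly_Mapping.keys p" and u: "u \<in> Poly_Mapping.keys p" and
    K: "\<And>e. e \<in> Poly_Mapping.keys p \<Longrightarrow> real (degB e) = real x + c * (real (degA e) - real y)"
      "\<And>e. e \<in> Poly_Mapping.keys p \<Longrightarrow> y \<le> degA e" "\<And>e. e \<in> Poly_Mapping.keys p \<Longrightarrow> degA e \<le> y'"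
      "\<And>e. e \<in> Poly_Mapping.keys p \<Longrightarrow> degA e = y \<Longrightarrow> e = l" "\<And>e. e \<in> Poly_Mapping.keys p \<Longrightarrow> degA e = y' \<Longrightarrow> e = u"
    unfolding ends_def by auto
  have Pl: "proj (expvec l) = P" using e by (simp add: proj_expvec P_def)
  have Qu: "proj (expvec u) = Q" using K(1)[OF u] e by (simp add: proj_expvec Q_def)
  have "proj (expvec e) \<in> closed_segment P Q" if "e \<in> Poly_Mapping.keys p" for e
    using K(1-3)[OF that] by (intro segment_lineI[of _ _ _ c]) (auto simp: proj_expvec P_def Q_def)
  then have sub: "proj ` expvec ` Poly_Mapping.keys p \<subseteq> closed_segment P Q" by auto
  have "proj ` newton_polytope p = convex hull (proj ` expvec ` Poly_Mapping.keys p)"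
    unfolding newton_polytope_def by (rule convex_hull_linear_image[OF linear_proj])
  also have "\<dots> = closed_segment P Q"
  proof
    show "convex hull (proj ` expvec ` Poly_Mapping.keys p) \<subseteq> closed_segment P Q"
      by (rule hull_minimal[where S = convex, OF sub convex_closed_segment])
    have "{P, Q} \<subseteq> proj ` expvec ` Poly_Mapping.keys p" using l u Pl Qu by force
    then show "closed_segment P Q \<subseteq> convex hull (proj ` expvec ` Poly_Mapping.keys p)"
      unfolding segment_convex_hull by (rule hull_mono)
  qed
  finally show "proj ` newton_polytope p = closed_segment P Q" .
  have "min_term p = l" unfolding min_term_def degA_def[symmetric]
  proof (rule the_equality)
    show "is_arg_min (\<lambda>e. degA e) (\<lambda>e. e \<in> Poly_Mapping.keys p) l"
      using l K(2) e(3) by (auto simp: is_arg_min_def not_less)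
    fix k assume k: "is_arg_min (\<lambda>e. degA e) (\<lambda>e. e \<in> Poly_Mapping.keys p) k"
    then have "k \<in> Poly_Mapping.keys p" "degA k \<le> y" using l e(3) by (auto simp: is_arg_min_def not_less)
    then show "k = l" using K(2)[of k] K(4)[of k] by simp
  qed
  then show "proj (expvec (min_term p)) = P" using Pl by simp
  have "max_term p = u" unfolding max_term_def degA_def[symmetric]
  proof (rule the_equality)
    show "is_arg_max (\<lambda>e. degA e) (\<lambda>e. e \<in> Poly_Mapping.keys p) u"
      using u K(3) e(4) by (auto simp: is_arg_max_def not_less)
    fix k assume k: "is_arg_max (\<lambda>e. degA e) (\<lambda>e. e \<in> Poly_Mapping.keys p) k"
    then have "k \<in> Poly_Mapping.keys p" "y' \<le> degA k" using u e(4) by (auto simp: is_arg_max_def not_less)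
    then show "k = u" using K(3)[of k] K(5)[of k] by simp
  qed
  then show "proj (expvec (max_term p)) = Q" using Qu by simp
qed

section \<open>The forms phi\<close>

lemma NK_remove: "k \<in> K \<Longrightarrow> NK \<alpha> K = (\<alpha> k - 1) * NK \<alpha> (K - {k})" for K :: "'n::finite set"
  unfolding NK_def by (rule prod.remove) auto

lemma has_ends_sign: "has_ends c ((- 1) ^ n :: ('n::finite qvar, int) mpoly) 0 0 0"
  using has_ends_power[OF has_ends_minus_1, of c n] by simp

text \<open>The common shape of \<open>Phi\<close> and \<open>phi_00\<close>: after projection the
  exponents of the two terms differ by \<open>n * (c, 1)\<close>, and the power \<open>g\<close>
  stretches this segment.\<close>

lemma has_ends_form:
  fixes U W s0 :: "('n::finite qvar, int) mpoly"
  assumes U: "has_ends c U x 1 1" and W: "has_ends c W 0 0 0"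
    and L: "\<And>k. k \<in> K \<Longrightarrow> has_ends c (L k) 1 0 0" and M: "\<And>k. k \<in> K \<Longrightarrow> has_ends c (M k) 0 0 0"
    and x: "x = 0" and n: "n > 0" and c: "real (\<Sum>k\<in>K. nk k) = c * real n" and s0: "has_ends c s0 0 0 0"
  shows "has_ends c ((U ^ n * (\<Prod>k\<in>K. L k ^ nk k) + s0 * W ^ n * (\<Prod>k\<in>K. M k ^ nk k)) ^ g) 0 0 (g * n)"
proof -
  have "has_ends c (U ^ n * (\<Prod>k\<in>K. L k ^ nk k)) (n * x + (\<Sum>k\<in>K. nk k * 1)) (n * 1 + (\<Sum>k\<in>K. nk k * 0)) (n * 1 + (\<Sum>k\<in>K. nk k * 0))"
    by (intro has_ends_mult has_ends_prod has_ends_power U L)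
  moreover have "has_ends c (s0 * W ^ n * (\<Prod>k\<in>K. M k ^ nk k)) (0 + n * 0 + (\<Sum>k\<in>K. nk k * 0)) (0 + n * 0 + (\<Sum>k\<in>K. nk k * 0)) (0 + n * 0 + (\<Sum>k\<in>K. nk k * 0))"
    by (intro has_ends_mult has_ends_prod has_ends_power W M s0)
  ultimately have "has_ends c (U ^ n * (\<Prod>k\<in>K. L k ^ nk k) + s0 * W ^ n * (\<Prod>k\<in>K. M k ^ nk k)) 0 0 n"
    using n c x by (intro has_ends_binomial[where x = "\<Sum>k\<in>K. nk k"]) auto
  from has_ends_power[OF this, of g] show ?thesis by simp
qed

lemma has_ends_B1: "has_ends c (Var (B1 i)) 0 0 0" and has_ends_B0: "has_ends c (Var (B0 i)) 0 0 0"
  and has_ends_A1: "has_ends c (Var A1) 0 0 0" and has_ends_A0: "has_ends c (Var A0) 0 1 1"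
  and has_ends_B2: "has_ends c (Var (B2 i)) 1 0 0"
  using has_ends_Var[of c "B1 i"] has_ends_Var[of c "B0 i"] has_ends_Var[of c A1] has_ends_Var[of c A0]
    has_ends_Var[of c "B2 i"] by (auto simp: image_iff)

context quiver
begin

lemma NK_pos: "NK \<alpha> K > 0"
proof -
  have "\<alpha> k - 1 > 0" for k using \<alpha>[of k] by simp
  then show ?thesis by (simp add: NK_def prod_pos)
qed

lemma NK_div: "k \<in> K \<Longrightarrow> real (NK \<alpha> (K - {k})) = real (NK \<alpha> K) * (1 / (real (\<alpha> k) - 1))"
  using NK_remove[of k K \<alpha>] \<alpha>[of k] by (simp add: of_nat_diff)

lemma NK_slope: "real (NK \<alpha> K) * slope \<alpha> K = (\<Sum>k\<in>K. real (NK \<alpha> (K - {k})))"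
  unfolding slope_def sum_distrib_left by (intro sum.cong refl) (simp add: NK_div)

text \<open>Dividing the exponents by the gcd and raising to the power \<open>g\<close> compensate
  in the height, and the direction is the quotient computed in \<open>NK_slope\<close>.\<close>

lemma has_ends_Phi: "has_ends (slope \<alpha> K) (Phi \<alpha> I K) 0 0 (NK \<alpha> K)"
proof -
  define g where "g = gK \<alpha> K"
  define n where "n = NK \<alpha> K div g"
  define nk where "nk k = NK \<alpha> (K - {k}) div g" for k
  have gn: "g dvd NK \<alpha> K" and gk: "k \<in> K \<Longrightarrow> g dvd NK \<alpha> (K - {k})" for k
    unfolding g_def gK_def by (rule Gcd_dvd; simp)+
  have n: "g * n = NK \<alpha> K" using gn by (simp add: n_def)
  have npos: "n > 0" "g > 0" using NK_pos[of K] n by (metis mult_0_right gr0I, metis mult_0 gr0I)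
  have nk: "real g * real (nk k) = real (NK \<alpha> (K - {k}))" if "k \<in> K" for k
    using gk[OF that] by (simp add: nk_def flip: of_nat_mult)
  have "real g * real (\<Sum>k\<in>K. nk k) = real (NK \<alpha> K) * slope \<alpha> K"
    unfolding NK_slope by (simp add: sum_distrib_left nk)
  also have "\<dots> = real g * (slope \<alpha> K * real n)" by (simp flip: n)
  finally have c: "real (\<Sum>k\<in>K. nk k) = slope \<alpha> K * real n" using npos by simp
  have I1: "has_ends c (\<Prod>i\<in>I. Var (B1 i)) 0 0 0" "has_ends c (\<Prod>i\<in>I. Var (B0 i)) 0 0 0" for c
    using has_ends_prod[of I c "\<lambda>i. Var (B1 i)" "\<lambda>_. 0" "\<lambda>_. 0" "\<lambda>_. 0"] has_ends_B1
      has_ends_prod[of I c "\<lambda>i. Var (B0 i)" "\<lambda>_. 0" "\<lambda>_. 0" "\<lambda>_. 0"] has_ends_B0 by auto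
  have "has_ends (slope \<alpha> K) (Var A0 * (\<Prod>i\<in>I. Var (B1 i))) 0 1 1" "has_ends (slope \<alpha> K) (Var A1 * (\<Prod>i\<in>I. Var (B0 i))) 0 0 0"
    using has_ends_mult[OF has_ends_A0 I1(1)] has_ends_mult[OF has_ends_A1 I1(2)] by auto
  from has_ends_form[where L = "\<lambda>k. Var (B2 k)" and M = "\<lambda>k. Var (B1 k)" and g = g,
      OF this has_ends_B2 has_ends_B1 refl npos(1) c has_ends_sign]
  show ?thesis unfolding Phi_def Let_def g_def[symmetric] n_def[symmetric] nk_def[symmetric] n .
qed

lemma has_ends_mu: "has_ends c (mu \<alpha> q) (\<Sum>i\<in>UNIV. \<Sum>K | card K + 2 \<le> q \<and> i \<notin> K. NK \<alpha> K)
    (\<Sum>K | card K + 1 \<le> q. NK \<alpha> K) (\<Sum>K | card K + 1 \<le> q. NK \<alpha> K)"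
proof -
  have "has_ends c (mu \<alpha> q)
    ((\<Sum>K | card K + 1 \<le> q. NK \<alpha> K) * 0 + (\<Sum>K | card K \<ge> q + 1. NK \<alpha> K) * 0 +
      (\<Sum>i\<in>UNIV. (\<Sum>K | card K \<ge> q + 1 \<and> i \<notin> K. NK \<alpha> K) * 0 + (\<Sum>K | card K + 2 \<le> q \<and> i \<notin> K. NK \<alpha> K) * 1))
    ((\<Sum>K | card K + 1 \<le> q. NK \<alpha> K) * 1 + (\<Sum>K | card K \<ge> q + 1. NK \<alpha> K) * 0 +
      (\<Sum>i\<in>UNIV. (\<Sum>K | card K \<ge> q + 1 \<and> i \<notin> K. NK \<alpha> K) * 0 + (\<Sum>K | card K + 2 \<le> q \<and> i \<notin> K. NK \<alpha> K) * 0))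
    ((\<Sum>K | card K + 1 \<le> q. NK \<alpha> K) * 1 + (\<Sum>K | card K \<ge> q + 1. NK \<alpha> K) * 0 +
      (\<Sum>i\<in>UNIV. (\<Sum>K | card K \<ge> q + 1 \<and> i \<notin> K. NK \<alpha> K) * 0 + (\<Sum>K | card K + 2 \<le> q \<and> i \<notin> K. NK \<alpha> K) * 0))"
    unfolding mu_def
    by (intro has_ends_mult has_ends_prod has_ends_power has_ends_A0 has_ends_A1 has_ends_B0 has_ends_B2)
  then show ?thesis by simp
qed

text \<open>Factors with different slopes would project to a polygon instead of a segment; hence the
  assumption of a common slope for all \<open>K\<close> of size \<open>q\<close>.\<close>

lemma has_ends_phi_pq:
  assumes "p + q = CARD('n)" and c: "\<And>K. card K = q \<Longrightarrow> slope \<alpha> K = c"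
  shows "has_ends c (phi_pq \<alpha> p q) (\<Sum>i\<in>UNIV. \<Sum>K | card K + 2 \<le> q \<and> i \<notin> K. NK \<alpha> K)
    (\<Sum>K | card K + 1 \<le> q. NK \<alpha> K) ((\<Sum>K | card K + 1 \<le> q. NK \<alpha> K) + (\<Sum>K | card K = q. NK \<alpha> K))"
proof -
  let ?D = "{(I, K :: 'n set). I \<inter> K = {} \<and> I \<union> K = UNIV \<and> card I = p \<and> card K = q}"
  have "card (- K) = p" if "card K = q" for K :: "'n set"
    using that assms(1) by (simp add: Compl_eq_Diff_UNIV card_Diff_subset)
  moreover have "I = - K" if "I \<inter> K = {}" "I \<union> K = UNIV" for I K :: "'n set" using that by blast
  ultimately have D: "?D = (\<lambda>K. (- K, K)) ` {K. card K = q}" by auto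
  have "(\<Prod>(I, K)\<in>?D. Phi \<alpha> I K) = (\<Prod>K | card K = q. Phi \<alpha> (- K) K)"
    unfolding D by (subst prod.reindex) (auto simp: inj_on_def)
  moreover have "has_ends c (\<Prod>K | card K = q. Phi \<alpha> (- K) K) 0 0 (\<Sum>K | card K = q. NK \<alpha> K)"
  proof -
    have "has_ends c (Phi \<alpha> (- K) K) 0 0 (NK \<alpha> K)" if "K \<in> {K. card K = q}" for K
      using has_ends_Phi[of K "- K"] c that by simp
    from has_ends_prod[of "{K. card K = q}" c "\<lambda>K. Phi \<alpha> (- K) K" "\<lambda>_. 0" "\<lambda>_. 0" "NK \<alpha>", OF this]
    show ?thesis by simp
  qed
  ultimately have "has_ends c (\<Prod>(I, K)\<in>?D. Phi \<alpha> I K) 0 0 (\<Sum>K | card K = q. NK \<alpha> K)" by simp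
  from has_ends_mult[OF has_ends_mu this] show ?thesis unfolding phi_pq_def add_0_right .
qed

lemma has_ends_phi_00: "has_ends (\<Sum>i\<in>UNIV. 1 / real (\<alpha> i)) (phi_00 \<alpha>) 0 0 Ptot"
proof -
  define \<tau> where "\<tau> = (\<Sum>i\<in>UNIV. 1 / real (\<alpha> i))"
  define pj where "pj j = (\<Prod>j'\<in>UNIV - {j}. \<alpha> j')" for j
  define g where "g = Gcd (insert Ptot (range pj))"
  define n where "n = Ptot div g"
  define nk where "nk k = pj k div g" for k
  have gn: "g dvd Ptot" and gk: "g dvd pj k" for k
    unfolding g_def by (rule Gcd_dvd; simp)+
  have n: "g * n = Ptot" using gn by (simp add: n_def)
  have "Ptot > 0" unfolding Ptot_def using \<alpha> by (intro prod_pos) (metis less_le_trans pos2)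
  then have npos: "n > 0" "g > 0" using n by (metis mult_0_right gr0I, metis mult_0 gr0I)
  have nk: "real g * real (nk k) = real (pj k)" for k
    using gk[of k] by (simp add: nk_def flip: of_nat_mult)
  have "real g * real (\<Sum>k\<in>UNIV. nk k) = real Psum"
    unfolding Psum_def by (simp add: sum_distrib_left nk pj_def)
  also have "\<dots> = real g * (\<tau> * real n)" unfolding Psum_eq by (simp add: \<tau>_def flip: n)
  finally have c: "real (\<Sum>k\<in>UNIV. nk k) = \<tau> * real n" using npos by simp
  show ?thesis
    using has_ends_form[where L = "\<lambda>k. Var (B2 k)" and M = "\<lambda>k. Var (B0 k)" and g = g,
      OF has_ends_A0 has_ends_A1 has_ends_B2 has_ends_B0 refl npos(1) c has_ends_sign]
    unfolding phi_00_def Let_def Ptot_def[symmetric] pj_def[symmetric] g_def[symmetric] n_def[symmetric]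
      nk_def[symmetric] n \<tau>_def[symmetric] .
qed

section \<open>Edges and vertices of the Newton polygon\<close>

text \<open>Double counting of the pairs of \<open>K\<close> and \<open>i \<in> K\<close>, with
  \<open>K - {i}\<close> as the new set. It turns the first coordinate of a vertex into the
  exponents of the \<open>b_{i,2}\<close> in \<open>mu\<close> and explains why these stop at
  \<open>q - 2\<close> instead of \<open>q - 1\<close>.\<close>

lemma sum_NK_slope:
  "(\<Sum>K | P (card K). real (NK \<alpha> K) * slope \<alpha> K) = (\<Sum>i\<in>UNIV. \<Sum>K | P (card K + 1) \<and> i \<notin> K. real (NK \<alpha> K))"
proof -
  have "(\<Sum>K | P (card K). real (NK \<alpha> K) * slope \<alpha> K)
      = (\<Sum>K | P (card K). \<Sum>i | i \<in> K. real (NK \<alpha> (K - {i})))" by (simp add: NK_slope)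
  also have "\<dots> = (\<Sum>i\<in>UNIV. \<Sum>K | P (card K) \<and> i \<in> K. real (NK \<alpha> (K - {i})))"
    using sum.swap_restrict[of "{K. P (card K)}" UNIV "\<lambda>K i. real (NK \<alpha> (K - {i}))" "\<lambda>K i. i \<in> K"] by simp
  also have "\<dots> = (\<Sum>i\<in>UNIV. \<Sum>K | P (card K + 1) \<and> i \<notin> K. real (NK \<alpha> K))"
  proof (rule sum.cong[OF refl])
    fix i
    have c: "Suc (card K - Suc 0) = card K" if "i \<in> K" for K :: "'n set"
      using that card_gt_0_iff[of K] by auto
    show "(\<Sum>K | P (card K) \<and> i \<in> K. real (NK \<alpha> (K - {i}))) = (\<Sum>K | P (card K + 1) \<and> i \<notin> K. real (NK \<alpha> K))"
      by (rule sum.reindex_bij_witness[of _ "insert i" "\<lambda>K. K - {i}"])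
         (auto simp: insert_absorb c)
  qed
  finally show ?thesis .
qed

lemma sum_NK: "(\<Sum>K | K \<subseteq> T. NK \<alpha> K) = (\<Prod>i\<in>T. \<alpha> i)"
proof -
  have "(\<Prod>i\<in>T. \<alpha> i) = (\<Prod>i\<in>T. (\<alpha> i - 1) + 1)" using \<alpha> by (intro prod.cong refl) (metis Suc_eq_plus1 Suc_pred' less_le_trans pos2)
  also have "\<dots> = (\<Sum>K\<in>Pow T. (\<Prod>k\<in>K. \<alpha> k - 1) * (\<Prod>k\<in>T - K. 1))" by (rule prod_add) simp
  finally show ?thesis by (simp add: NK_def Pow_def)
qed

text \<open>The index type consists of all subsets \<open>K\<close>, each contributing the vector
  \<open>(slope \<alpha> K, 1)\<close> with multiplicity \<open>NK \<alpha> K\<close>.\<close>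

sublocale slope_polygon "\<lambda>K. real (NK \<alpha> K)" "slope \<alpha>" "expvec ` Poly_Mapping.keys A"
  "\<lambda>s. \<Sum>K\<in>UNIV. real (NK \<alpha> K) * max 0 (s - slope \<alpha> K)" "\<Sum>i\<in>UNIV. 1 / real (\<alpha> i)"
proof
  have a1: "real (\<alpha> k) - 1 > 0" for k using \<alpha>[of k] by simp
  show "slope \<alpha> K \<ge> 0" for K unfolding slope_def using a1 by (intro sum_nonneg) (simp add: less_imp_le)
  show "\<exists>K. slope \<alpha> K = 0" by (intro exI[of _ "{}"]) (simp add: slope_def)
  show "\<exists>K. slope \<alpha> K > 0" 
    using a1[of undefined] by (intro exI[of _ "{undefined}"]) (simp add: slope_def)
  have X: "(\<Sum>K\<in>UNIV. real (NK \<alpha> K) * slope \<alpha> K) = real Psum"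
  proof -
    have "{K. i \<notin> K} = {K. K \<subseteq> UNIV - {i}}" for i :: 'n by auto
    then have R: "(\<Sum>K | i \<notin> K. real (NK \<alpha> K)) = real (\<Prod>j\<in>UNIV - {i}. \<alpha> j)" for i
      by (simp only: sum_NK flip: of_nat_sum)
    have "(\<Sum>K\<in>UNIV. real (NK \<alpha> K) * slope \<alpha> K) = (\<Sum>i\<in>UNIV. real (\<Prod>j\<in>UNIV - {i}. \<alpha> j))"
      using sum_NK_slope[of "\<lambda>_. True"] by (simp add: R del: of_nat_prod)
    then show ?thesis by (simp only: Psum_def of_nat_sum)
  qed
  have Y: "(\<Sum>K\<in>UNIV. real (NK \<alpha> K)) = real Ptot"
    using sum_NK[of UNIV] by (simp add: Ptot_def flip: of_nat_sum)
  show "(\<Sum>K\<in>UNIV. real (NK \<alpha> K) * slope \<alpha> K) = (\<Sum>i\<in>UNIV. 1 / real (\<alpha> i)) * (\<Sum>K\<in>UNIV. real (NK \<alpha> K))"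
    unfolding X Y Psum_eq by (rule mult.commute)
  \<comment> \<open>Since \<open>max s \<sigma> = \<sigma> + max 0 (s - \<sigma>)\<close> and the
    weighted slopes add up to \<open>Psum\<close>, only the second summands remain.\<close>
  have low: "low s = - (\<Sum>K\<in>UNIV. real (NK \<alpha> K) * max 0 (s - slope \<alpha> K))" for s
  proof -
    have "max s (slope \<alpha> K) = slope \<alpha> K + max 0 (s - slope \<alpha> K)" for K by simp
    then show ?thesis unfolding low_def X[symmetric] by (simp add: distrib_left sum.distrib)
  qed
  have wt: "weight w1 w2 e = w1 * expvec e $ 1 + w2 * expvec e $ 2" for w1 w2 e
    by (simp add: weight_def expvec_def)
  show "s * e $ 2 - (\<Sum>K\<in>UNIV. real (NK \<alpha> K) * max 0 (s - slope \<alpha> K)) \<le> e $ 1"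
    if "e \<in> expvec ` Poly_Mapping.keys A" for e s
  proof -
    from that obtain f where f: "f \<in> Poly_Mapping.keys A" "e = expvec f" by blast
    show ?thesis using keys_A_low[OF f(1), of s] unfolding low wt f(2) by simp
  qed
  show "\<exists>e\<in>expvec ` Poly_Mapping.keys A. e $ 1 \<le> s * e $ 2 - (\<Sum>K\<in>UNIV. real (NK \<alpha> K) * max 0 (s - slope \<alpha> K))"
    if "s \<notin> range (slope \<alpha>)" for s
  proof -
    from keys_A_attained[OF that] obtain f where "f \<in> Poly_Mapping.keys A" "weight 1 (- s) f \<le> low s" by blast
    then show ?thesis unfolding low wt by (intro bexI[of _ "expvec f"]) auto
  qed
  show "e $ 1 \<le> (\<Sum>i\<in>UNIV. 1 / real (\<alpha> i)) * e $ 2" if "e \<in> expvec ` Poly_Mapping.keys A" for e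
  proof -
    from that obtain f where f: "f \<in> Poly_Mapping.keys A" "e = expvec f" by blast
    show ?thesis using keys_A_high[OF f(1)] unfolding wt f(2) by simp
  qed
qed (auto simp: NK_pos)

lemma newton_polytope_A: "newton_polytope A = S"
  by (simp add: newton_polytope_def)

lemma proj_phi_00:
  "proj ` newton_polytope (phi_00 \<alpha>) = closed_segment 0 top"
  "proj (expvec (min_term (phi_00 \<alpha>))) = 0" "proj (expvec (max_term (phi_00 \<alpha>))) = top"
proof -
  have Y: "real Ptot = top $ 2" using sum_NK[of UNIV] by (simp add: Ptot_def flip: of_nat_sum)
  have P: "vector [real 0, real 0] = (0 :: real ^ 2)" by (simp add: vec2_eq_iff)
  have Q: "vector [real 0 + (\<Sum>i\<in>UNIV. 1 / real (\<alpha> i)) * (real Ptot - real 0), real Ptot] = top"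
    unfolding Y using \<tau> by (simp add: vec2_eq_iff)
  show "proj ` newton_polytope (phi_00 \<alpha>) = closed_segment 0 top"
    "proj (expvec (min_term (phi_00 \<alpha>))) = 0" "proj (expvec (max_term (phi_00 \<alpha>))) = top"
    using has_ends_imp[OF has_ends_phi_00] unfolding P Q by auto
qed

section \<open>Counting the distinct slopes\<close>

lemma slope_insert: "k \<notin> K \<Longrightarrow> slope \<alpha> (insert k K) = 1 / (real (\<alpha> k) - 1) + slope \<alpha> K"
  by (simp add: slope_def)

lemma slope_singleton_pos: "1 / (real (\<alpha> k) - 1) > 0"
  using \<alpha>[of k] by simp

text \<open>If \<open>\<alpha>\<^sub>j < \<alpha>\<^sub>i\<close>, the slopes of a chain \<open>\<emptyset> \<subset> {i} \<subset> {i, j} \<subset> \<dots>\<close> and the slope of \<open>{j}\<close> are pairwise distinct.\<close>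

lemma card_slopes_unequal:
  assumes ij: "\<alpha> j < \<alpha> i"
  shows "card (range (slope \<alpha>)) \<ge> CARD('n) + 2"
proof -
  \<comment> \<open>Slopes of the sets containing \<open>i\<close> and \<open>j\<close>: adding the
    other \<open>m - 2\<close> elements one at a time gives at least \<open>m - 1\<close> values.
    All are at least \<open>slope \<alpha> {i} + slope \<alpha> {j}\<close>, hence different from
    the three values for \<open>{}\<close>, \<open>{i}\<close> and \<open>{j}\<close>.\<close>
  define f where "f U = slope \<alpha> ({i, j} \<union> U)" for U
  have mono: "f U \<le> f T" if "U \<subseteq> T" for U T
    unfolding f_def slope_def
  proof (rule sum_mono2)
    show "{i, j} \<union> U \<subseteq> {i, j} \<union> T" using that by blast
    show "0 \<le> 1 / (real (\<alpha> k) - 1)" for k using slope_singleton_pos[of k] by linarith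
  qed simp
  have "card (f ` Pow T) \<ge> card T + 1" if "T \<subseteq> UNIV - {i, j}" for T
  proof -
    have "finite T" by simp
    then show ?thesis using that
    proof (induction T rule: finite_induct)
      case empty
      show ?case by simp
    next
      case (insert k T)
      have k: "f (insert k T) = 1 / (real (\<alpha> k) - 1) + f T"
      proof -
        have eq: "{i, j} \<union> insert k T = insert k ({i, j} \<union> T)" by blast
        have "k \<notin> {i, j} \<union> T" using insert.hyps insert.prems by blast
        then show ?thesis unfolding f_def eq by (rule slope_insert)
      qed
      have less: "f (insert k T) > f U" if "U \<in> Pow T" for U
      proof -
        have "f U \<le> f T" using mono that by blast
        then show ?thesis unfolding k using slope_singleton_pos[of k] by linarith
      qed
      have "f (insert k T) \<notin> f ` Pow T"
      proof
        assume "f (insert k T) \<in> f ` Pow T"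
        then obtain U where "U \<in> Pow T" "f (insert k T) = f U" by blast
        with less[OF this(1)] show False by simp
      qed
      then have "card (insert (f (insert k T)) (f ` Pow T)) = card (f ` Pow T) + 1" by simp
      moreover have "insert (f (insert k T)) (f ` Pow T) \<subseteq> f ` Pow (insert k T)" by blast
      then have "card (insert (f (insert k T)) (f ` Pow T)) \<le> card (f ` Pow (insert k T))"
        by (intro card_mono) auto
      moreover have "card T + 1 \<le> card (f ` Pow T)" using insert.IH insert.prems by blast
      ultimately show ?case using insert.hyps by simp
    qed
  qed
  from this[of "UNIV - {i, j}"] have "card (f ` Pow (UNIV - {i, j})) \<ge> card (UNIV - {i, j}) + 1" by simp
  moreover have ne: "i \<noteq> j" using ij by auto
  moreover have "card (UNIV - {i, j}) + 2 = CARD('n)"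
    using ne card_mono[of UNIV "{i, j}"] by (subst card_Diff_subset) auto
  ultimately have cB: "card (f ` Pow (UNIV - {i, j})) + 1 \<ge> CARD('n)" by simp
  define B where "B = f ` Pow (UNIV - {i, j})"
  define si sj where "si = slope \<alpha> {i}" and "sj = slope \<alpha> {j}"
  have s: "0 < si" "si < sj"
  proof -
    show "0 < si" unfolding si_def slope_def using slope_singleton_pos[of i] by simp
    have "real (\<alpha> j) - 1 > 0" "real (\<alpha> j) - 1 < real (\<alpha> i) - 1" using ij \<alpha>[of j] by auto
    then show "si < sj" unfolding si_def sj_def slope_def by (simp add: frac_less2)
  qed
  have "b \<ge> si + sj" if "b \<in> B" for b
  proof -
    from that obtain U where U: "b = f U" unfolding B_def by blast
    have "f {} = si + sj" using ne by (simp add: f_def si_def sj_def slope_def)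
    then show ?thesis using U mono[of "{}" U] by simp
  qed
  then have "{0, si, sj} \<inter> B = {}" using s by fastforce
  moreover have "card {0, si, sj} = 3" using s by simp
  moreover have "finite B" by (simp add: B_def)
  ultimately have "card ({0, si, sj} \<union> B) = 3 + card B" by (subst card_Un_disjoint) auto
  moreover have "{0, si, sj} \<union> B \<subseteq> range (slope \<alpha>)"
  proof -
    have "0 = slope \<alpha> {}" by (simp add: slope_def)
    then show ?thesis by (auto simp: si_def sj_def B_def f_def)
  qed
  then have "card ({0, si, sj} \<union> B) \<le> card (range (slope \<alpha>))" by (intro card_mono) auto
  ultimately show ?thesis using cB by (simp add: B_def)
qed

section \<open>The case of equal \<alpha>\<close>

context
  fixes a :: nat
  assumes a: "\<And>i. \<alpha> i = a"
begin

definition level :: "nat \<Rightarrow> real" where "level q = real q / (real a - 1)"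

lemma a_gt_1: "real a > 1" using \<alpha>[of undefined] a by simp

lemma slope_level: "slope \<alpha> K = level (card K)"
  by (simp add: slope_def level_def a)

lemma level_less: "level q < level q' \<longleftrightarrow> q < q'" and level_le: "level q \<le> level q' \<longleftrightarrow> q \<le> q'"
  and level_eq: "level q = level q' \<longleftrightarrow> q = q'"
  using a_gt_1 by (auto simp: level_def divide_less_cancel divide_le_cancel)

lemma range_slope: "range (slope \<alpha>) = level ` {..CARD('n)}"
proof (intro equalityI subsetI)
  fix s assume "s \<in> range (slope \<alpha>)"
  then show "s \<in> level ` {..CARD('n)}" by (auto simp: slope_level card_mono)
next
  fix s assume "s \<in> level ` {..CARD('n)}"
  then obtain q where q: "q \<le> CARD('n)" "s = level q" by auto
  obtain K :: "'n set" where "card K = q" using obtain_subset_with_card_n[of q UNIV] q(1) by auto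
  then have "s = slope \<alpha> K" using q(2) slope_level[of K] by simp
  then show "s \<in> range (slope \<alpha>)" by (rule range_eqI)
qed

lemma card_range_slope: "card (range (slope \<alpha>)) = CARD('n) + 1"
  unfolding range_slope by (subst card_image) (auto simp: inj_on_def level_eq)

text \<open>For equal \<alpha>, \<open>slope \<alpha> K < level q\<close> means
  \<open>card K < q\<close>. So the exponents in \<open>mu \<alpha> q\<close> give the coordinates
  of \<open>V (level q)\<close>, and the factors \<open>Phi\<close> supply the way from there to
  \<open>W (level q)\<close>.\<close>

lemma proj_phi_pq:
  assumes "p + q = CARD('n)"
  shows "proj ` newton_polytope (phi_pq \<alpha> p q) = closed_segment (V (level q)) (W (level q))"
    and "proj (expvec (min_term (phi_pq \<alpha> p q))) = V (level q)"
    and "proj (expvec (max_term (phi_pq \<alpha> p q))) = W (level q)"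
proof -
  let ?x = "\<Sum>i\<in>UNIV. \<Sum>K | card K + 2 \<le> q \<and> i \<notin> K. NK \<alpha> K"
  let ?y = "\<Sum>K | card K + 1 \<le> q. NK \<alpha> K" and ?d = "\<Sum>K | card K = q. NK \<alpha> K"
  have vy: "vy (level q) = real ?y" by (simp add: vy_def slope_level level_less Suc_le_eq)
  have vx: "vx (level q) = real ?x"
    using sum_NK_slope[of "\<lambda>n. n < q"] by (simp add: vx_def slope_level level_less Suc_le_eq)
  have wy: "wy (level q) = real (?y + ?d)"
    unfolding wy_eq vy by (simp add: slope_level level_eq)
  have wx: "wx (level q) = real ?x + level q * (real (?y + ?d) - real ?y)"
    using wx_minus_vx[of "level q"] unfolding vx vy wy by simp
  have P: "vector [real ?x, real ?y] = V (level q)" by (simp add: vec2_eq_iff vx vy)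
  have Q: "vector [real ?x + level q * (real (?y + ?d) - real ?y), real (?y + ?d)] = W (level q)"
    unfolding vec2_eq_iff vector_2 W_comp wx wy by (intro conjI refl)
  have E: "has_ends (level q) (phi_pq \<alpha> p q) ?x ?y (?y + ?d)"
    by (rule has_ends_phi_pq[OF assms]) (simp add: slope_level)
  show "proj ` newton_polytope (phi_pq \<alpha> p q) = closed_segment (V (level q)) (W (level q))"
    "proj (expvec (min_term (phi_pq \<alpha> p q))) = V (level q)"
    "proj (expvec (max_term (phi_pq \<alpha> p q))) = W (level q)"
    using has_ends_imp[OF E] unfolding P Q by auto
qed

end
end

lemma card_index_set:
  assumes "m > 0"
  shows "card ({(p, q). p + q = m} \<union> {(0, 0)}) = m + 2" "finite ({(p, q). p + q = m} \<union> {(0::nat, 0::nat)})"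
    and "{(p, q). p + q = m} = (\<lambda>q. (m - q, q)) ` {..m}"
proof -
  show eq: "{(p, q). p + q = m} = (\<lambda>q. (m - q, q)) ` {..m}" by (auto simp: image_iff)
  have "card ((\<lambda>q. (m - q, q)) ` {..m}) = m + 1" by (subst card_image) (auto simp: inj_on_def)
  moreover have "(0, 0) \<notin> (\<lambda>q. (m - q, q)) ` {..m}" using assms by auto
  ultimately show "card ({(p, q). p + q = m} \<union> {(0, 0)}) = m + 2" unfolding eq by simp
  show "finite ({(p, q). p + q = m} \<union> {(0::nat, 0::nat)})" unfolding eq by simp
qed

theorem theorem7p1:
  fixes \<alpha> :: "'n::finite \<Rightarrow> nat" and lam :: "'n \<Rightarrow> complex" and \<I> :: "(nat \<times> nat) set"
  assumes "CARD('n) \<ge> 2"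
    and "\<And>i. \<alpha> i \<ge> 2"
    and "\<And>i. lam i \<noteq> 0"
    and "\<I> = {(p, q). p + q = CARD('n)} \<union> {(0, 0)}"
  shows "(bij_betw (\<lambda>pq. proj ` newton_polytope (phi \<alpha> pq)) \<I>
            {E. E edge_of newton_polytope (quiver_A \<alpha> lam)}
          \<longleftrightarrow> (\<forall>i j. \<alpha> i = \<alpha> j)) \<and>
         ((\<forall>i j. \<alpha> i = \<alpha> j) \<longrightarrow>
          {v. v extreme_point_of newton_polytope (quiver_A \<alpha> lam)} =
            (\<lambda>pq. proj (expvec (min_term (phi \<alpha> pq)))) ` \<I> \<union>
            (\<lambda>pq. proj (expvec (max_term (phi \<alpha> pq)))) ` \<I>)"
proof -
  interpret quiver \<alpha> lam using assms(2,3) by unfold_locales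
  let ?m = "CARD('n)"
  have m: "?m > 0" using assms(1) by simp
  note I = card_index_set[OF m]
  let ?e = "\<lambda>pq. proj ` newton_polytope (phi \<alpha> pq)"
  have I_eq: "\<I> = insert (0, 0) ((\<lambda>q. (?m - q, q)) ` {..?m})" unfolding assms(4) I(3) by auto
  have phi_q: "phi \<alpha> (?m - q, q) = phi_pq \<alpha> (?m - q) q" if "q \<le> ?m" for q
    using that m by (auto simp: phi_def)
  have phi_0: "phi \<alpha> (0, 0) = phi_00 \<alpha>" by (simp add: phi_def)
  have unequal: "\<forall>i j. \<alpha> i = \<alpha> j" if "bij_betw ?e \<I> {E. E edge_of S}"
  proof (rule ccontr)
    assume "\<not> (\<forall>i j. \<alpha> i = \<alpha> j)"
    then obtain i j where "\<alpha> i \<noteq> \<alpha> j" by blast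
    then have "card (range (slope \<alpha>)) \<ge> ?m + 2"
      using card_slopes_unequal[of i j] card_slopes_unequal[of j i] by linarith
    \<comment> \<open>Cardinalities decide: there would be at least \<open>m + 3\<close> edges
      against \<open>m + 2\<close> indices.\<close>
    then show False using bij_betw_same_card[OF that] card_edges I(1) unfolding assms(4) by simp
  qed
  have equal: "bij_betw ?e \<I> {E. E edge_of S} \<and> {v. v extreme_point_of S} =
      (\<lambda>pq. proj (expvec (min_term (phi \<alpha> pq)))) ` \<I> \<union> (\<lambda>pq. proj (expvec (max_term (phi \<alpha> pq)))) ` \<I>"
    if eq: "\<forall>i j. \<alpha> i = \<alpha> j"
  proof -
    define a where "a = \<alpha> undefined"
    have a: "\<alpha> i = a" for i using eq by (simp add: a_def)
    note pq = proj_phi_pq[OF a]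
    have im: "f ` \<I> = insert (f (0, 0)) ((\<lambda>q. f (?m - q, q)) ` {..?m})" for f :: "nat \<times> nat \<Rightarrow> 'b"
      unfolding I_eq by (simp add: image_image)
    have "?e ` \<I> = insert (closed_segment 0 top) ((\<lambda>q. closed_segment (V (level a q)) (W (level a q))) ` {..?m})"
      unfolding im phi_0 proj_phi_00 by (intro arg_cong2[of _ _ _ _ insert] image_cong refl) (simp add: phi_q pq)
    then have img: "?e ` \<I> = {E. E edge_of S}"
      unfolding edges_eq range_slope[OF a] by (simp add: image_image)
    \<comment> \<open>Injectivity by counting: the image is already known to be the set of edges,
      which has as many elements as \<open>\<I>\<close>.\<close>
    have "card (?e ` \<I>) = ?m + 2"
      unfolding img card_edges card_range_slope[OF a] by simp
    also have "\<dots> = card \<I>" unfolding assms(4) by (rule I(1)[symmetric])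
    finally have "card (?e ` \<I>) = card \<I>" .
    then have "inj_on ?e \<I>" using I(2) unfolding assms(4) by (intro eq_card_imp_inj_on) auto
    then have "bij_betw ?e \<I> {E. E edge_of S}" using img by (simp add: bij_betw_def)
    moreover have "(\<lambda>pq. proj (expvec (min_term (phi \<alpha> pq)))) ` \<I> = insert 0 ((\<lambda>q. V (level a q)) ` {..?m})"
      unfolding im phi_0 proj_phi_00 by (intro arg_cong2[of _ _ _ _ insert] image_cong refl) (simp add: phi_q pq)
    moreover have "(\<lambda>pq. proj (expvec (max_term (phi \<alpha> pq)))) ` \<I> = insert top ((\<lambda>q. W (level a q)) ` {..?m})"
      unfolding im phi_0 proj_phi_00 by (intro arg_cong2[of _ _ _ _ insert] image_cong refl) (simp add: phi_q pq)
    moreover have "{v. v extreme_point_of S} = {0, top} \<union> (\<lambda>q. V (level a q)) ` {..?m} \<union> (\<lambda>q. W (level a q)) ` {..?m}"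
      unfolding extreme_points_eq range_slope[OF a] by (simp add: image_image)
    ultimately show ?thesis by auto
  qed
  show ?thesis unfolding newton_polytope_A using unequal equal by blast
qed

end
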